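(* $$\int_0^{2\pi}(1-\cos\theta)^2\log w(\theta)\frac{d\theta}{2\pi}>-\infty\iff\sum_{n=0}^{\infty}\left(|\alpha_{n+2}-2\alpha_{n+1}+\alpha_n|^2+|\alpha_n|^6\right)<\infty.$$ More precisely, for any sequence $\alpha$ of Verblunsky coefficients, $$\int_0^{2\pi}(1-\cos\theta)^2\log w(\theta)\frac{d\theta}{2\pi}=\frac98+\frac32\sum_{j=0}^{\infty}\Big[\log(1-|\alpha_j|^2)+|\alpha_j|^2+\frac12|\alpha_j|^4\Big]-\frac14\sum_{j=0}^{\infty}\big(|\alpha_j|^2-|\alpha_{j-1}|^2\big)^2$$ $$-\frac14\sum_{j=0}^{\infty}\rho_j^2|\alpha_{j+1}-2\alpha_j+\alpha_{j-1}|^2-\frac18\sum_{j=0}^{\infty}\big(6|\alpha_j|^2+6|\alpha_{j-1}|^2-|\alpha_j-\alpha_{j-1}|^2\big)|\alpha_j-\alpha_{j-1}|^2,$$ and this also equals $$\frac98+\frac32\sum_{j=0}^{\infty}\Big[\log(1-|\alpha_j|^2)+|\alpha_j|^2+\frac12|\alpha_j|^4\Big]-\frac14\sum_{j=0}^{\infty}\big(|\alpha_j|^2-|\alpha_{j-1}|^2\big)^2$$ $$-\frac14\sum_{j=0}^{\infty}\rho_j^2|\alpha_{j+1}-2\alpha_j+\alpha_{j-1}|^2-\frac18\sum_{j=0}^{\infty}\big(4|\alpha_j|^2+4|\alpha_{j-1}|^2+|\alpha_j+\alpha_{j-1}|^2\big)|\alpha_j-\alpha_{j-1}|^2.$$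
   Context: $\mu$ is a probability measure with infinite support on the unit circle (identified with $[0,2\pi]$ via $e^{i\theta}\mapsto\theta$), with Lebesgue decomposition $d\mu(\theta)=w(\theta)\frac{d\theta}{2\pi}+d\mu_s(\theta)$. $\Phi_n$ are its monic orthogonal polynomials, and its Verblunsky coefficients are $\alpha_n=-\overline{\Phi_{n+1}(0)}\in\mathbb{D}$, $n\ge0$, with the convention $\alpha_{-1}=-1$; $\rho_j=(1-|\alpha_j|^2)^{1/2}$. The integral is well defined in $[-\infty,\infty)$, and the sums on the right sides have terms of constant sign, so that the right sides are well defined in $[-\infty,\infty)$; the identities allow all sides to be $-\infty$. *)

theory Defs
  imports "HOL-Probability.Probability" "HOL-Computational_Algebra.Polynomial"
begin

text \<open>The support of a Borel measure: all points whose every open neighbourhood has positive measure.\<close>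

definition msupport :: "'a::topological_space measure \<Rightarrow> 'a set" where
  "msupport \<mu> = {x. \<forall>U. open U \<longrightarrow> x \<in> U \<longrightarrow> 0 < emeasure \<mu> U}"

text \<open>Measures on the unit circle are Borel measures on the complex plane that are carried by the
  circle.\<close>

definition circle_prob_measure :: "complex measure \<Rightarrow> bool" where
  "circle_prob_measure \<mu> \<longleftrightarrow>
     prob_space \<mu> \<and> sets \<mu> = sets borel \<and> (AE z in \<mu>. z \<in> sphere 0 1)"

text \<open>The normalised measure \<open>d\<theta>/(2\<pi>)\<close> on \<open>[0, 2\<pi>]\<close>; pushing forward
  along \<open>cis \<theta> = exp (\<i> \<theta>)\<close> identifies the interval with the circle.\<close>

definition angle_measure :: "real measure" where
  "angle_measure = uniform_measure lborel {0..2 * pi}"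

definition mutually_singular :: "'a measure \<Rightarrow> 'a measure \<Rightarrow> bool" where
  "mutually_singular M N \<longleftrightarrow>
     (\<exists>A \<in> sets M \<inter> sets N. emeasure M A = 0 \<and> emeasure N (space N - A) = 0)"

text \<open>\<open>d\<mu>(\<theta>) = w(\<theta>) d\<theta>/(2\<pi>) + d\<mu>\<^sub>s(\<theta>)\<close> with
  \<open>\<mu>\<^sub>s\<close> singular.\<close>

definition lebesgue_decomposition ::
  "complex measure \<Rightarrow> (real \<Rightarrow> real) \<Rightarrow> complex measure \<Rightarrow> bool" where
  "lebesgue_decomposition \<mu> w \<mu>\<^sub>s \<longleftrightarrow>
     w \<in> borel_measurable borel \<and> (\<forall>\<theta>\<in>{0..2 * pi}. 0 \<le> w \<theta>) \<and>
     sets \<mu>\<^sub>s = sets borel \<and>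
     (\<forall>A\<in>sets borel. emeasure \<mu> A =
        emeasure (distr (density angle_measure (\<lambda>\<theta>. ennreal (w \<theta>))) borel cis) A
        + emeasure \<mu>\<^sub>s A) \<and>
     mutually_singular (distr angle_measure borel cis) \<mu>\<^sub>s"

definition monic_orthogonal_poly :: "complex measure \<Rightarrow> nat \<Rightarrow> complex poly" where
  "monic_orthogonal_poly \<mu> n =
     (THE P. degree P = n \<and> lead_coeff P = 1 \<and>
        (\<forall>Q. degree Q < n \<longrightarrow> (\<integral>z. cnj (poly Q z) * poly P z \<partial>\<mu>) = 0))"

text \<open>The index is an integer, to allow for the convention \<open>\<alpha>\<^sub>-\<^sub>1 = -1\<close>; indices
  below \<open>-1\<close> are never used.\<close>

definition verblunsky :: "complex measure \<Rightarrow> int \<Rightarrow> complex" where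
  "verblunsky \<mu> n =
     (if n < 0 then -1 else - cnj (poly (monic_orthogonal_poly \<mu> (nat n + 1)) 0))"

text \<open>The logarithm with \<open>log 0 = -\<infinity>\<close>; note that the real \<^const>\<open>ln\<close> has
  \<open>ln 0 = 0\<close>.\<close>

definition elog :: "real \<Rightarrow> ereal" where
  "elog x = (if x \<le> 0 then - \<infinity> else ereal (ln x))"

text \<open>The integral of an extended real function as the integral of its positive part minus that of its
  negative part (\<^const>\<open>e2ennreal\<close> sends negative values to 0). It is meaningful as soon as
  one of the two is finite; for \<open>\<integral>(1 - cos \<theta>)\<^sup>2 log w d\<theta>/(2\<pi>)\<close> the
  positive part is finite, since \<open>log w \<le> w\<close>.\<close>

definition ext_integral :: "'a measure \<Rightarrow> ('a \<Rightarrow> ereal) \<Rightarrow> ereal" where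
  "ext_integral M f =
     enn2ereal (\<integral>\<^sup>+ x. e2ennreal (f x) \<partial>M) - enn2ereal (\<integral>\<^sup>+ x. e2ennreal (- f x) \<partial>M)"

end

(*
Let mu_n be the Bernstein-Szego measure of density W_n = ||Phi_n||^2 / |Phi_n|^2, whose Verblunsky
coefficients are alpha_0, ..., alpha_{n-1}, 0, 0, .... The weight Q = (1 - cos)^2 is a trigonometric
polynomial of degree two, so the integral of Q log W_n only involves the first two Taylor
coefficients of log Phi_n^*, which the Szego recursion gives explicitly. This sum telescopes into the
n-th partial sum of the right side, up to a bounded boundary term that vanishes as alpha -> 0.

Upper bound: log t <= t - 1 with t = w / W_n gives
  int Q log w <= int Q log W_n + int Q |phi_n|^2 dmu - int Q,
and the last difference is bounded, and tends to 0 if alpha -> 0.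
Lower bound: for continuous g > 0 the same inequality with t = g W_n and the weak convergence of
mu_n to mu give lim int Q log W_n <= int Q g dmu - int Q - int Q log g. By approximation this holds
for bounded Borel g > 0 bounded away from 0; now let g be a truncation of 1/w off the support
of the singular part, and nearly 0 on that support.

The right side is finite iff the sixth powers and the squared second differences are summable, by a
discrete Gagliardo-Nirenberg inequality for the first differences.
*)
theory Submission
  imports Defs "HOL-Complex_Analysis.Complex_Analysis"
begin

section \<open>The Szego recursion\<close>

text \<open>The coefficients are not known to tend to 0, so at first the boundary term and the
  defect of the upper bound are merely bounded. What saves the argument is that all summands of the
  right side have one sign. Either the partial sums converge, and then the logarithmic terms force
  the coefficients to 0, so that both errors vanish; or they decrease to -infinity, and then bounded
  errors and the upper bound alone suffice. The lower bound is therefore needed only when the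
  entropies of the approximants converge. The constants come from Q, whose Fourier coefficients are
  3/2 at order 0, -1 at orders 1 and -1, and 1/4 at orders 2 and -2. The 9/8 is the starting value
  of the telescoping potential, fixed by the convention \<open>\<alpha> (-1) = -1\<close>. The lower
  bound has to deal with two measures that may be far apart: the test function is integrated against
  \<mu> and its logarithm against arc length. Weak convergence asks for continuous test functions,
  so each Borel test function must be approximated in both measures at once.\<close>

primrec szego :: "(nat \<Rightarrow> complex) \<Rightarrow> nat \<Rightarrow> complex poly \<times> complex poly" where
  "szego a 0 = (1, 1)"
| "szego a (Suc n) =
     (pCons 0 (fst (szego a n)) - smult (cnj (a n)) (snd (szego a n)),
      snd (szego a n) - smult (a n) (pCons 0 (fst (szego a n))))"

definition Phi :: "(nat \<Rightarrow> complex) \<Rightarrow> nat \<Rightarrow> complex poly" where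
  "Phi a n = fst (szego a n)"

text \<open>The reversed polynomials \<open>\<Phi>\<^sub>n\<^sup>*\<close>; see \<open>Psi_circle\<close>.\<close>

definition Psi :: "(nat \<Rightarrow> complex) \<Rightarrow> nat \<Rightarrow> complex poly" where
  "Psi a n = snd (szego a n)"

lemma Phi_0 [simp]: "Phi a 0 = 1" and Psi_0 [simp]: "Psi a 0 = 1"
  by (simp_all add: Phi_def Psi_def)

lemma Phi_Suc: "Phi a (Suc n) = pCons 0 (Phi a n) - smult (cnj (a n)) (Psi a n)"
  and Psi_Suc: "Psi a (Suc n) = Psi a n - smult (a n) (pCons 0 (Phi a n))"
  by (simp_all add: Phi_def Psi_def)

lemma degree_Psi_le: "degree (Psi a n) \<le> n"
  and degree_Phi_le: "degree (Phi a n) \<le> n"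
proof (induction n)
  case (Suc n)
  { case 1
    show ?case unfolding Psi_Suc using Suc
      by (intro degree_diff_le) (auto intro: order.trans[OF degree_smult_le] order.trans[OF degree_pCons_le])
  next
    case 2
    show ?case unfolding Phi_Suc using Suc
      by (intro degree_diff_le) (auto intro: order.trans[OF degree_smult_le] order.trans[OF degree_pCons_le])
  }
qed auto

lemma coeff_Phi_n [simp]: "coeff (Phi a n) n = 1"
proof (induction n)
  case (Suc n)
  have "coeff (Psi a n) (Suc n) = 0"
    using degree_Psi_le[of a n] by (intro coeff_eq_0) auto
  with Suc show ?case by (simp add: Phi_Suc)
qed auto

lemma degree_Phi [simp]: "degree (Phi a n) = n"
  using degree_Phi_le[of a n] by (intro antisym le_degree) auto

lemma poly_Psi_0 [simp]: "poly (Psi a n) 0 = 1"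
  by (induction n) (auto simp: Psi_Suc)

lemma unit_circle_mult_cnj: "cmod z = 1 \<Longrightarrow> z * cnj z = 1" "cmod z = 1 \<Longrightarrow> cnj z * z = 1"
  by (simp_all add: complex_norm_square[symmetric] mult.commute[of "cnj z"])

text \<open>The two forms are proved together because the recursion mixes \<open>Phi\<close> and
  \<open>Psi\<close>. Since all integrals live on the circle, this pointwise form can stand in for
  reversing the list of coefficients.\<close>

lemma Psi_circle:
  assumes "cmod z = 1"
  shows "poly (Psi a n) z = z ^ n * cnj (poly (Phi a n) z)"
    and "poly (Phi a n) z = z ^ n * cnj (poly (Psi a n) z)"
proof (induction n)
  case (Suc n)
  note z = unit_circle_mult_cnj[OF assms]
  { case 1
    have "z ^ Suc n * cnj (poly (Phi a (Suc n)) z) =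
      z * cnj z * (z ^ n * cnj (poly (Phi a n) z)) - a n * z * (z ^ n * cnj (poly (Psi a n) z))"
      by (simp add: Phi_Suc algebra_simps)
    also have "\<dots> = poly (Psi a (Suc n)) z"
      using Suc by (simp add: z Psi_Suc)
    finally show ?case ..
  next
    case 2
    have "z ^ Suc n * cnj (poly (Psi a (Suc n)) z) =
      z * (z ^ n * cnj (poly (Psi a n) z)) - cnj (a n) * (z * cnj z) * (z ^ n * cnj (poly (Phi a n) z))"
      by (simp add: Psi_Suc algebra_simps)
    also have "\<dots> = poly (Phi a (Suc n)) z"
      using Suc by (simp add: z Phi_Suc)
    finally show ?case ..
  }
qed auto

lemma cmod_Psi_circle: "cmod z = 1 \<Longrightarrow> cmod (poly (Psi a n) z) = cmod (poly (Phi a n) z)"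
  by (simp add: Psi_circle(1) norm_mult norm_power)

text \<open>For |c| < 1 the map taking u/v to (u - cnj c v)/(v - c u) is an automorphism of the
  disc; this is its invariance in homogeneous form, free of division.\<close>

lemma mobius_norm_identity:
  "(cmod (v - c * u))\<^sup>2 - (cmod (u - cnj c * v))\<^sup>2 = (1 - (cmod c)\<^sup>2) * ((cmod v)\<^sup>2 - (cmod u)\<^sup>2)"
  by (simp only: cmod_power2) (simp add: power2_eq_square algebra_simps)

lemma disc_diff_nonzero:
  fixes u v c :: complex
  assumes "cmod c < 1" "cmod u \<le> cmod v" "v \<noteq> 0"
  shows "v - c * u \<noteq> 0"
proof
  assume "v - c * u = 0"
  then have "cmod v = cmod c * cmod u" by (simp add: norm_mult)
  also have "\<dots> \<le> cmod c * cmod v" using assms by (intro mult_left_mono) auto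
  also have "\<dots> < 1 * cmod v" using assms by (intro mult_strict_right_mono) auto
  finally show False by simp
qed

text \<open>The Schur algorithm: on s = z Phi/Psi each step of the recursion acts by a disc
  automorphism followed by multiplication by z. Nonvanishing and the bound feed each other in the
  induction.\<close>

lemma szego_disc:
  assumes a: "\<forall>k. cmod (a k) < 1" and z: "cmod z \<le> 1"
  shows "poly (Psi a n) z \<noteq> 0 \<and> cmod (poly (Phi a n) z) \<le> cmod (poly (Psi a n) z)"
proof (induction n)
  case (Suc n)
  define u v where "u = z * poly (Phi a n) z" and "v = poly (Psi a n) z"
  have uv: "cmod u \<le> cmod v" "v \<noteq> 0"
    using Suc z mult_mono[of "cmod z" 1 "cmod (poly (Phi a n) z)" "cmod (poly (Psi a n) z)"]
    by (auto simp: u_def v_def norm_mult)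
  have "(1 - (cmod (a n))\<^sup>2) * ((cmod v)\<^sup>2 - (cmod u)\<^sup>2) \<ge> 0"
    using uv a[rule_format, of n] by (intro mult_nonneg_nonneg) (auto simp: abs_square_le_1 power_mono)
  then have "(cmod (u - cnj (a n) * v))\<^sup>2 \<le> (cmod (v - a n * u))\<^sup>2"
    using mobius_norm_identity[of v "a n" u] by linarith
  then have "cmod (u - cnj (a n) * v) \<le> cmod (v - a n * u)"
    by (simp add: power2_le_iff_abs_le)
  moreover have "v - a n * u \<noteq> 0" using disc_diff_nonzero[OF a[rule_format] uv] .
  ultimately show ?case by (simp add: Phi_Suc Psi_Suc u_def v_def mult.left_commute)
qed auto

text \<open>Places the ratio of consecutive \<open>Psi\<close> in the open unit disc about 1, which
  keeps the principal logarithm in \<open>szego_log\<close> off its cut.\<close>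

lemma szego_mult_z_less:
  assumes a: "\<forall>k. cmod (a k) < 1" and z: "cmod z \<le> 1"
  shows "cmod (a n * (z * poly (Phi a n) z / poly (Psi a n) z)) < 1"
proof -
  have "cmod (z * poly (Phi a n) z / poly (Psi a n) z) \<le> 1"
    using szego_disc[OF a z, of n] z
      mult_mono[of "cmod z" 1 "cmod (poly (Phi a n) z)" "cmod (poly (Psi a n) z)"]
    by (auto simp: norm_mult norm_divide)
  then have "cmod (a n) * cmod (z * poly (Phi a n) z / poly (Psi a n) z) \<le> cmod (a n) * 1"
    by (intro mult_left_mono) auto
  then show ?thesis using a[rule_format, of n] by (simp only: norm_mult[of "a n"])
qed

lemma Phi_circle_nonzero:
  assumes "\<forall>k. cmod (a k) < 1" "cmod z = 1"
  shows "poly (Phi a n) z \<noteq> 0"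
  using szego_disc[of a z n] assms cmod_Psi_circle[of z a n] by auto

section \<open>Orthogonality on the circle\<close>

locale circle_measure = finite_measure \<nu> for \<nu> :: "complex measure" +
  assumes sets_circle [simp, measurable_cong]: "sets \<nu> = sets borel"
    and AE_circle: "AE z in \<nu>. cmod z = 1"
begin

lemma space_circle [simp]: "space \<nu> = UNIV"
  using sets_circle by (metis sets_eq_imp_space_eq space_borel)

text \<open>Continuity is asked on the circle only, because later integrands such as
  \<open>bs_weight\<close> are singular at the zeros of \<open>Phi\<close>, which avoid the circle
  but not the plane.\<close>

lemma integrable_circle:
  fixes f :: "complex \<Rightarrow> 'b::{banach, second_countable_topology}"
  assumes "f \<in> borel_measurable borel" "continuous_on (sphere 0 1) f"
  shows "integrable \<nu> f"
proof -
  have "compact (f ` sphere 0 1)" using assms(2) by (intro compact_continuous_image) auto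
  then obtain B where "\<And>z. z \<in> sphere 0 1 \<Longrightarrow> norm (f z) \<le> B"
    by (meson bounded_iff compact_imp_bounded imageI)
  then show ?thesis
    using AE_circle assms(1) measurable_cong_sets[OF sets_circle refl]
    by (intro integrable_const_bound[of _ B]) auto
qed

lemma integrable_continuous:
  fixes f :: "complex \<Rightarrow> 'b::{banach, second_countable_topology}"
  assumes "continuous_on UNIV f"
  shows "integrable \<nu> f"
  using assms by (intro integrable_circle borel_measurable_continuous_onI)
    (auto intro: continuous_on_subset)

lemma integral_cong_circle:
  fixes f g :: "complex \<Rightarrow> 'b::{banach, second_countable_topology}"
  assumes "\<And>z. cmod z = 1 \<Longrightarrow> f z = g z"
    and "f \<in> borel_measurable borel" "g \<in> borel_measurable borel"
  shows "(\<integral>z. f z \<partial>\<nu>) = (\<integral>z. g z \<partial>\<nu>)"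
  using AE_circle assms by (intro integral_cong_AE) auto

definition ip :: "complex poly \<Rightarrow> complex poly \<Rightarrow> complex" where
  "ip P Q = (\<integral>z. cnj (poly P z) * poly Q z \<partial>\<nu>)"

lemma integrable_ip [simp]: "integrable \<nu> (\<lambda>z. cnj (poly P z) * poly Q z)"
  by (intro integrable_continuous continuous_intros)

lemma ip_add_right: "ip P (Q + R) = ip P Q + ip P R"
  by (simp add: ip_def distrib_left)

lemma ip_diff_right: "ip P (Q - R) = ip P Q - ip P R"
  by (simp add: ip_def right_diff_distrib)

lemma ip_smult_right: "ip P (smult c Q) = c * ip P Q"
  by (simp add: ip_def mult.left_commute)

lemma cnj_ip: "cnj (ip P Q) = ip Q P"
proof -
  have "cnj (ip P Q) = (\<integral>z. cnj (cnj (poly P z) * poly Q z) \<partial>\<nu>)"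
    by (simp only: ip_def Bochner_Integration.integral_cnj)
  then show ?thesis by (simp add: ip_def mult.commute)
qed

lemma ip_add_left: "ip (P + Q) R = ip P R + ip Q R"
  by (simp add: ip_def distrib_right)

lemma ip_smult_left: "ip (smult c P) Q = cnj c * ip P Q"
  by (simp add: ip_def mult.assoc)

lemma ip_0_left [simp]: "ip 0 Q = 0"
  by (simp add: ip_def)

lemma ip_sum_left: "ip (\<Sum>i\<in>A. P i) Q = (\<Sum>i\<in>A. ip (P i) Q)"
  by (induction A rule: infinite_finite_induct) (simp_all add: ip_add_left)

text \<open>Multiplication by z is unitary, as |z| = 1 almost everywhere.\<close>

lemma ip_pCons: "ip (pCons 0 P) (pCons 0 Q) = ip P Q"
proof -
  have "cnj (poly (pCons 0 P) z) * poly (pCons 0 Q) z = cnj (poly P z) * poly Q z"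
    if "cmod z = 1" for z
    using unit_circle_mult_cnj[OF that] by simp
  then show ?thesis unfolding ip_def
    by (intro integral_cong_circle) (auto intro!: borel_measurable_continuous_onI continuous_intros)
qed

definition nsq :: "complex poly \<Rightarrow> real" where
  "nsq P = (\<integral>z. (cmod (poly P z))\<^sup>2 \<partial>\<nu>)"

lemma integrable_nsq [simp]: "integrable \<nu> (\<lambda>z. (cmod (poly P z))\<^sup>2)"
  by (intro integrable_continuous continuous_intros)

lemma ip_self: "ip P P = of_real (nsq P)"
proof -
  have "cnj w * w = of_real ((cmod w)\<^sup>2)" for w
    by (metis complex_norm_square mult.commute)
  then show ?thesis unfolding ip_def nsq_def by (simp del: of_real_power)
qed

lemma nsq_nonneg: "nsq P \<ge> 0"
  unfolding nsq_def by simp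

lemma nsq_Psi: "nsq (Psi a n) = nsq (Phi a n)"
  unfolding nsq_def
  by (intro integral_cong_circle) (auto simp: cmod_Psi_circle intro!: borel_measurable_continuous_onI continuous_intros)

text \<open>On the circle the conjugate of z^k times z^n is z^(n-k). So where \<open>Phi\<close> is
  orthogonal to 1, ..., z^(n-1), its reversal is orthogonal to z, ..., z^n.\<close>

lemma ip_monom_Psi:
  assumes "k \<le> n"
  shows "ip (monom 1 k) (Psi a n) = cnj (ip (monom 1 (n - k)) (Phi a n))"
proof -
  have "cnj (z ^ k) * poly (Psi a n) z = cnj (cnj (z ^ (n - k)) * poly (Phi a n) z)"
    if "cmod z = 1" for z
  proof -
    have "cnj z ^ k * z ^ n = cnj z ^ k * z ^ k * z ^ (n - k)"
      using assms by (simp flip: power_add add: mult.assoc)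
    also have "cnj z ^ k * z ^ k = 1"
      using unit_circle_mult_cnj[OF that] by (simp flip: power_mult_distrib)
    finally show ?thesis by (simp add: Psi_circle(1)[OF that])
  qed
  then have "ip (monom 1 k) (Psi a n) = (\<integral>z. cnj (cnj (z ^ (n - k)) * poly (Phi a n) z) \<partial>\<nu>)"
    unfolding ip_def poly_monom mult_1
    by (intro integral_cong_circle) (auto intro!: borel_measurable_continuous_onI continuous_intros)
  also have "\<dots> = cnj (ip (monom 1 (n - k)) (Phi a n))"
    by (simp add: ip_def poly_monom del: complex_cnj_mult)
  finally show ?thesis .
qed

text \<open>Testing on monomials turns multiplication by z into an index shift;
  \<open>orth_iff\<close> returns to all polynomials of lower degree.\<close>

definition orth :: "complex poly \<Rightarrow> nat \<Rightarrow> bool" where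
  "orth P n \<longleftrightarrow> (\<forall>k<n. ip (monom 1 k) P = 0)"

lemma orth_iff: "orth P n \<longleftrightarrow> (\<forall>Q. degree Q < n \<longrightarrow> ip Q P = 0)" if "n > 0"
proof
  assume o: "orth P n"
  show "\<forall>Q. degree Q < n \<longrightarrow> ip Q P = 0"
  proof safe
    fix Q :: "complex poly" assume "degree Q < n"
    then have "ip (monom (coeff Q k) k) P = 0" if "k \<le> degree Q" for k
      using that o ip_smult_left[of "coeff Q k" "monom 1 k" P]
      by (simp add: orth_def smult_monom)
    moreover have "ip Q P = ip (\<Sum>k\<le>degree Q. monom (coeff Q k) k) P"
      by (simp add: poly_as_sum_of_monoms)
    ultimately show "ip Q P = 0" by (simp add: ip_sum_left)
  qed
qed (auto simp: orth_def degree_monom_eq)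

lemma ip_orth: "orth P n \<Longrightarrow> degree Q < n \<Longrightarrow> ip Q P = 0"
  by (metis orth_iff gr_implies_not_zero neq0_conv)

lemma ip_orth': "orth P n \<Longrightarrow> degree Q < n \<Longrightarrow> ip P Q = 0"
  by (metis ip_orth cnj_ip complex_cnj_zero)

lemma ip_Psi_orth:
  assumes "orth (Phi a n) n" "0 < k" "k \<le> n"
  shows "ip (monom 1 k) (Psi a n) = 0"
  using assms ip_monom_Psi[of k n a] by (simp add: orth_def)

lemma ip_monom_self:
  assumes o: "orth P n" and P: "degree P = n" "lead_coeff P = 1"
  shows "ip (monom 1 n) P = of_real (nsq P)"
proof -
  let ?R = "P - monom 1 n"
  have "ip ?R P = 0"
  proof (cases "?R = 0")
    case False
    moreover have "degree ?R \<le> n" using P by (intro degree_diff_le) (auto simp: degree_monom_eq)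
    moreover have "coeff ?R n = 0" using P by simp
    ultimately have "degree ?R < n" by (metis le_neq_implies_less leading_coeff_0_iff)
    then show ?thesis using o ip_orth by blast
  qed simp
  then have "ip (monom 1 n + ?R) P = ip (monom 1 n) P" by (subst ip_add_left) simp
  then show ?thesis by (simp add: ip_self)
qed

text \<open>Pythagoras: z Phi is \<open>Phi a (Suc n)\<close> plus a multiple of
  \<open>Psi a n\<close>. The latter has degree at most n, so the two are orthogonal, and reversal
  preserves norms.\<close>

lemma nsq_Phi_Suc:
  assumes "orth (Phi a (Suc n)) (Suc n)"
  shows "nsq (Phi a (Suc n)) = (1 - (cmod (a n))\<^sup>2) * nsq (Phi a n)"
proof -
  let ?F = "Phi a (Suc n)" and ?G = "smult (cnj (a n)) (Psi a n)"
  have z: "pCons 0 (Phi a n) = ?F + ?G" by (simp add: Phi_Suc)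
  have 0: "ip (Psi a n) ?F = 0" "ip ?F (Psi a n) = 0"
    using ip_orth[OF assms] ip_orth'[OF assms] degree_Psi_le[of a n] by (auto simp: less_Suc_eq_le)
  have "of_real (nsq (Phi a n)) = ip (?F + ?G) (?F + ?G)"
    by (metis z ip_pCons ip_self)
  also have "\<dots> = ip ?F ?F + a n * cnj (a n) * ip (Psi a n) (Psi a n)"
    by (simp add: ip_add_left ip_add_right ip_smult_left ip_smult_right 0)
  also have "\<dots> = of_real (nsq ?F + (cmod (a n))\<^sup>2 * nsq (Phi a n))"
    by (simp add: ip_self nsq_Psi complex_norm_square del: of_real_power)
  finally show ?thesis by (simp only: of_real_eq_iff) (simp add: algebra_simps)
qed

text \<open>The inverse Szego recursion, by which the orthogonality of one polynomial
  descends to all earlier ones.\<close>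

lemma orth_Phi_pred:
  assumes o: "orth (Phi a (Suc n)) (Suc n)" and a: "cmod (a n) < 1"
  shows "orth (Phi a n) n"
  unfolding orth_def
proof safe
  fix k assume k: "k < n"
  have 1: "1 - a n * cnj (a n) \<noteq> 0"
  proof
    assume "1 - a n * cnj (a n) = 0"
    then have "complex_of_real ((cmod (a n))\<^sup>2) = 1" by (simp only: complex_norm_square) simp
    then have "(cmod (a n))\<^sup>2 = 1" by (simp only: of_real_eq_1_iff)
    with a show False by (metis norm_ge_zero power2_eq_1_iff abs_norm_cancel less_irrefl abs_minus_cancel abs_one)
  qed
  \<comment> \<open>Eliminates \<open>Psi a n\<close> from the two recursion formulas. Both terms on
    the right are orthogonal to z, ..., z^n; cancelling the factor z on the left shifts this to 1,
    ..., z^(n-1).\<close>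
  have "smult (1 - a n * cnj (a n)) (pCons 0 (Phi a n)) = Phi a (Suc n) + smult (cnj (a n)) (Psi a (Suc n))"
    by (simp add: Phi_Suc Psi_Suc smult_diff_right smult_diff_left algebra_simps)
  moreover have "ip (monom 1 (Suc k)) (Phi a (Suc n) + smult (cnj (a n)) (Psi a (Suc n))) = 0"
    using o k ip_Psi_orth[OF o, of "Suc k"] by (simp add: ip_add_right ip_smult_right orth_def)
  ultimately have "ip (monom 1 (Suc k)) (pCons 0 (Phi a n)) = 0"
    using 1 by (metis ip_smult_right mult_eq_0_iff)
  then show "ip (monom 1 k) (Phi a n) = 0" by (simp add: monom_Suc ip_pCons)
qed

lemma orth_Phi_le:
  assumes a: "\<forall>k. cmod (a k) < 1" and "orth (Phi a n) n" "m \<le> n"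
  shows "orth (Phi a m) m"
  using assms(3,2) by (induction rule: inc_induct) (use a in \<open>auto intro: orth_Phi_pred\<close>)

lemma nsq_Phi_eq_prod:
  assumes a: "\<forall>k. cmod (a k) < 1" and "orth (Phi a n) n"
  shows "nsq (Phi a n) = (\<Prod>j<n. 1 - (cmod (a j))\<^sup>2) * measure \<nu> UNIV"
  using assms(2)
proof (induction n)
  case 0
  show ?case by (simp add: nsq_def)
next
  case (Suc n)
  then show ?case
    using orth_Phi_le[OF a, of "Suc n" n] nsq_Phi_Suc[of a n] by simp
qed

end

text \<open>Orthogonality of the monic \<open>Phi a k\<close> to 1 expresses the k-th moment through
  lower ones, with coefficients that depend on \<open>a\<close> only. By \<open>orth_Phi_le\<close>
  orthogonality at the single order n covers all k up to n.\<close>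

lemma moments_eq:
  assumes "circle_measure \<mu>" "circle_measure \<nu>"
    and a: "\<forall>k. cmod (a k) < 1"
    and o: "circle_measure.orth \<mu> (Phi a n) n" "circle_measure.orth \<nu> (Phi a n) n"
    and m: "measure \<mu> UNIV = measure \<nu> UNIV"
    and "k \<le> n"
  shows "(\<integral>z. z ^ k \<partial>\<mu>) = (\<integral>z. z ^ k \<partial>\<nu>)"
  using \<open>k \<le> n\<close>
proof (induction k rule: less_induct)
  case (less k)
  interpret M: circle_measure \<mu> by fact
  interpret N: circle_measure \<nu> by fact
  show ?case
  proof (cases "k = 0")
    case False
    have *: "(\<integral>z. z ^ k \<partial>\<kappa>) = - (\<Sum>i<k. coeff (Phi a k) i * (\<integral>z. z ^ i \<partial>\<kappa>))"
      if "circle_measure \<kappa>" "circle_measure.orth \<kappa> (Phi a n) n" for \<kappa>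
    proof -
      interpret K: circle_measure \<kappa> by fact
      have "K.orth (Phi a k) k" using that K.orth_Phi_le[OF a] less.prems by blast
      then have "K.ip (monom 1 0) (Phi a k) = 0" using False unfolding K.orth_def by blast
      moreover have "K.ip (monom 1 0) (Phi a k) = (\<Sum>i\<le>k. coeff (Phi a k) i * (\<integral>z. z ^ i \<partial>\<kappa>))"
        unfolding K.ip_def poly_altdef[of "Phi a k"]
        by (simp add: poly_monom K.integrable_continuous continuous_intros)
      moreover have "\<dots> = (\<Sum>i<k. coeff (Phi a k) i * (\<integral>z. z ^ i \<partial>\<kappa>)) + (\<integral>z. z ^ k \<partial>\<kappa>)"
        by (simp flip: lessThan_Suc_atMost)
      ultimately show ?thesis by (simp add: add_eq_0_iff)
    qed
    show ?thesis
      using less assms by (simp add: *[OF assms(1) o(1)] *[OF assms(2) o(2)])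
  qed (simp add: m)
qed

section \<open>Measures of infinite support and their Verblunsky coefficients\<close>

locale nontrivial_circle_measure = circle_measure +
  assumes infinite_msupport: "infinite (msupport \<nu>)"
begin

text \<open>Otherwise the open set where P is nonzero would be null, and the support would lie in
  the finite zero set of P.\<close>

lemma nsq_pos:
  assumes "P \<noteq> 0"
  shows "nsq P > 0"
proof (rule ccontr)
  assume "\<not> nsq P > 0"
  then have "nsq P = 0" using nsq_nonneg[of P] by simp
  then have "AE z in \<nu>. (cmod (poly P z))\<^sup>2 = 0"
    unfolding nsq_def by (subst (asm) integral_nonneg_eq_0_iff_AE) auto
  then have AE: "AE z in \<nu>. \<not> poly P z \<noteq> 0" by simp
  have U: "open {z. poly P z \<noteq> 0}"
    by (intro open_Collect_neq continuous_intros)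
  then have "emeasure \<nu> {z. poly P z \<noteq> 0} = 0"
    using AE AE_iff_measurable[of "{z. poly P z \<noteq> 0}" \<nu> "\<lambda>z. \<not> poly P z \<noteq> 0"] by simp
  with U have "msupport \<nu> \<subseteq> {z. poly P z = 0}"
    unfolding msupport_def by force
  then show False
    using infinite_msupport poly_roots_finite[OF assms] finite_subset by blast
qed

text \<open>Resolves the description operator: two candidates differ by a polynomial of degree below
  n, which is then orthogonal to itself.\<close>

lemma monic_orthogonal_poly_eqI:
  assumes "orth P n" "degree P = n" "lead_coeff P = 1" "n > 0"
  shows "monic_orthogonal_poly \<nu> n = P"
  unfolding monic_orthogonal_poly_def
proof (rule the_equality)
  have *: "(\<forall>Q. degree Q < n \<longrightarrow> (\<integral>z. cnj (poly Q z) * poly R z \<partial>\<nu>) = 0) \<longleftrightarrow> orth R n" for R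
    using orth_iff[OF \<open>n > 0\<close>, of R] by (simp add: ip_def)
  show "degree P = n \<and> lead_coeff P = 1 \<and>
      (\<forall>Q. degree Q < n \<longrightarrow> (\<integral>z. cnj (poly Q z) * poly P z \<partial>\<nu>) = 0)"
    using assms by (simp add: *)
  fix R assume "degree R = n \<and> lead_coeff R = 1 \<and>
      (\<forall>Q. degree Q < n \<longrightarrow> (\<integral>z. cnj (poly Q z) * poly R z \<partial>\<nu>) = 0)"
  then have R: "degree R = n" "lead_coeff R = 1" "orth R n" unfolding * by blast+
  show "R = P"
  proof (rule ccontr)
    assume "R \<noteq> P"
    then have nz: "R - P \<noteq> 0" by simp
    moreover have "coeff (R - P) n = 0" using R(1,2) assms(2,3) by (metis coeff_diff diff_self)
    moreover have "degree (R - P) \<le> n" using R assms by (intro degree_diff_le) auto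
    ultimately have "degree (R - P) < n" by (metis le_neq_implies_less leading_coeff_0_iff)
    then have "ip (R - P) (R - P) = 0"
      using ip_orth[OF R(3)] ip_orth[OF assms(1)] by (simp add: ip_diff_right)
    then show False using nsq_pos[OF nz] by (simp add: ip_self)
  qed
qed

text \<open>The shifted polynomial and the reversed one are both orthogonal to z, ..., z^n, so one
  free coefficient \<open>d\<close> has only to settle the pairing with 1. The value of the result
  at 0 then identifies \<open>d\<close> with the conjugate Verblunsky coefficient.\<close>

lemma verblunsky_Suc:
  assumes o: "orth (Phi a n) n" and a: "a n = verblunsky \<nu> (int n)"
  shows "orth (Phi a (Suc n)) (Suc n)"
proof -
  define d where "d = ip 1 (pCons 0 (Phi a n)) / of_real (nsq (Phi a n))"
  define R where "R = pCons 0 (Phi a n) - smult d (Psi a n)"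
  have deg: "degree (smult d (Psi a n)) \<le> n"
    using degree_Psi_le order.trans degree_smult_le by blast
  then have c: "coeff (smult d (Psi a n)) (Suc n) = 0" by (intro coeff_eq_0) auto
  then have cR: "coeff R (Suc n) = 1" by (simp add: R_def)
  moreover have "degree R \<le> Suc n" unfolding R_def using deg by (intro degree_diff_le) auto
  ultimately have dR: "degree R = Suc n" by (intro antisym le_degree) auto
  have "Phi a n \<noteq> 0" by (metis coeff_0 coeff_Phi_n zero_neq_one)
  then have pos: "nsq (Phi a n) > 0" by (rule nsq_pos)
  have oR: "orth R (Suc n)"
    unfolding orth_def
  proof safe
    fix k assume k: "k < Suc n"
    show "ip (monom 1 k) R = 0"
    proof (cases k)
      case 0
      \<comment> \<open>Reversal turns the pairing with 1 into the pairing of \<open>Phi a n\<close>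
        with z^n, which for a monic orthogonal polynomial is its squared norm.\<close>
      have "ip 1 (Psi a n) = of_real (nsq (Phi a n))"
        using ip_monom_Psi[of 0 n a] ip_monom_self[OF o]
        by (simp add: monom_0 flip: one_pCons)
      then show ?thesis using pos
        by (simp add: 0 monom_0 R_def ip_diff_right ip_smult_right d_def flip: one_pCons)
    next
      case (Suc j)
      then show ?thesis using k o ip_Psi_orth[OF o, of k]
        by (simp add: R_def ip_diff_right ip_smult_right monom_Suc ip_pCons orth_def)
    qed
  qed
  have "monic_orthogonal_poly \<nu> (Suc n) = R"
    using monic_orthogonal_poly_eqI[OF oR dR] cR dR by simp
  then have "verblunsky \<nu> (int n) = - cnj (poly R 0)"
    by (simp add: verblunsky_def nat_add_distrib flip: Suc_eq_plus1)
  then have "cnj (a n) = d" by (simp add: a R_def)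
  then have "Phi a (Suc n) = R" by (simp add: Phi_Suc R_def)
  with oR show ?thesis by simp
qed

lemma orth_Phi:
  assumes "\<And>n. a n = verblunsky \<nu> (int n)"
  shows "orth (Phi a n) n"
proof (induction n)
  case 0
  show ?case by (simp add: orth_def)
qed (intro verblunsky_Suc assms)

text \<open>Consecutive squared norms are positive and have ratio 1 - |a n|^2.\<close>

lemma cmod_verblunsky_less_1: "cmod (verblunsky \<nu> (int n)) < 1"
proof -
  define a where "a k = verblunsky \<nu> (int k)" for k :: nat
  have "Phi a k \<noteq> 0" for k by (metis coeff_0 coeff_Phi_n zero_neq_one)
  then have pos: "nsq (Phi a k) > 0" for k by (rule nsq_pos)
  have "nsq (Phi a (Suc n)) = (1 - (cmod (a n))\<^sup>2) * nsq (Phi a n)"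
    by (intro nsq_Phi_Suc orth_Phi) (simp add: a_def)
  with pos[of n] pos[of "Suc n"] have "(cmod (a n))\<^sup>2 < 1"
    by (simp add: zero_less_mult_iff)
  then have "\<bar>cmod (a n)\<bar> < 1" by (simp only: abs_square_less_1)
  then show ?thesis by (simp add: a_def)
qed

end

section \<open>Normalised arc length\<close>

definition arc_measure :: "complex measure" where
  "arc_measure = distr angle_measure borel cis"

lemma cis_measurable [measurable]: "cis \<in> borel_measurable borel"
  by (intro borel_measurable_continuous_onI continuous_intros)

lemma cnj_measurable [measurable]: "cnj \<in> borel_measurable borel"
  by (intro borel_measurable_continuous_onI continuous_intros)

lemma sets_angle_measure [simp, measurable_cong]: "sets angle_measure = sets borel"
  by (simp add: angle_measure_def)

lemma prob_space_angle_measure: "prob_space angle_measure"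
  unfolding angle_measure_def by (intro prob_space_uniform_measure) auto

lemma circle_measure_arc: "circle_measure arc_measure"
proof -
  interpret prob_space angle_measure by (rule prob_space_angle_measure)
  interpret D: prob_space arc_measure
    unfolding arc_measure_def by (rule prob_space_distr) simp
  show ?thesis
  proof
    show "sets arc_measure = sets borel" by (simp add: arc_measure_def)
    show "AE z in arc_measure. cmod z = 1"
      unfolding arc_measure_def by (subst AE_distr_iff) simp_all
  qed
qed

interpretation arc: circle_measure arc_measure
  by (rule circle_measure_arc)

lemma measure_arc_UNIV [simp]: "measure arc_measure UNIV = 1"
proof -
  interpret prob_space angle_measure by (rule prob_space_angle_measure)
  interpret D: prob_space arc_measure
    unfolding arc_measure_def by (rule prob_space_distr) simp
  show ?thesis using D.prob_space by simp
qed

lemma integral_angle_measure: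
  fixes f :: "real \<Rightarrow> 'a::{banach, second_countable_topology}"
  assumes "f \<in> borel_measurable borel"
  shows "(\<integral>t. f t \<partial>angle_measure) = (1 / (2 * pi)) *\<^sub>R (LINT t:{0..2*pi}|lborel. f t)"
proof -
  have "indicator {0..2*pi} x / emeasure lborel {0..2*pi} = ennreal (indicator {0..2*pi} x / (2*pi))" for x :: real
    using divide_ennreal[of 1 "2*pi"] by (cases "x \<in> {0..2*pi}") auto
  then have am: "angle_measure = density lborel (\<lambda>x. ennreal (indicator {0..2*pi} x / (2*pi)))"
    unfolding angle_measure_def uniform_measure_def by (simp only: cong: if_cong)
  have "(\<integral>t. f t \<partial>angle_measure) = (\<integral>t. (indicator {0..2*pi} t / (2*pi)) *\<^sub>R f t \<partial>lborel)"
    unfolding am using assms by (intro integral_density) auto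
  also have "\<dots> = (1 / (2 * pi)) *\<^sub>R (\<integral>t. indicator {0..2*pi} t *\<^sub>R f t \<partial>lborel)"
    by (simp flip: integral_scaleR_right)
  finally show ?thesis by (simp add: set_lebesgue_integral_def)
qed

lemma integral_arc_measure:
  fixes f :: "complex \<Rightarrow> complex"
  assumes f: "f \<in> borel_measurable borel" "continuous_on (sphere 0 1) f"
  shows "(\<integral>z. f z \<partial>arc_measure) = integral {0..2*pi} (\<lambda>t. f (cis t)) / (2 * pi)"
proof -
  have c: "continuous_on {0..2*pi} (\<lambda>t. f (cis t))"
    by (rule continuous_on_compose2[OF f(2)]) (auto intro!: continuous_intros)
  have "(\<integral>z. f z \<partial>arc_measure) = (\<integral>t. f (cis t) \<partial>angle_measure)"
    unfolding arc_measure_def using f by (subst integral_distr) auto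
  also have "\<dots> = (1 / (2 * pi)) *\<^sub>R (LINT t:{0..2*pi}|lborel. f (cis t))"
    using f by (intro integral_angle_measure) auto
  also have "(LINT t:{0..2*pi}|lborel. f (cis t)) = integral {0..2*pi} (\<lambda>t. f (cis t))"
    by (intro set_borel_integral_eq_integral)
       (use borel_integrable_compact[OF _ c] in \<open>simp add: set_integrable_def\<close>)
  finally show ?thesis by (simp add: scaleR_conv_of_real)
qed

text \<open>Cauchy's formula, since dz / z^(k+1) is i cnj z^k d\<theta> on the unit circle. It
  allows functions that are merely continuous up to the boundary.\<close>

lemma integral_holomorphic_arc:
  fixes f :: "complex \<Rightarrow> complex"
  assumes m: "f \<in> borel_measurable borel"
    and f: "continuous_on (cball 0 1) f" "f holomorphic_on ball 0 1"
  shows "(\<integral>z. f z * cnj z ^ k \<partial>arc_measure) = (deriv ^^ k) f 0 / fact k"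
proof -
  have c: "continuous_on (sphere 0 1) f"
    by (rule continuous_on_subset[OF f(1)]) auto
  have "contour_integral (circlepath 0 1) (\<lambda>u. f u / u ^ Suc k) = 2 * pi * \<i> * (deriv ^^ k) f 0 / fact k"
    using Cauchy_contour_integral_circlepath[OF f, of 0 k] by simp
  moreover have "contour_integral (circlepath 0 1) (\<lambda>u. f u / u ^ Suc k) =
      integral {0..2*pi} (\<lambda>t. f (cis t) / cis t ^ Suc k * \<i> * cis t)"
    unfolding circlepath_def by (subst contour_integral_part_circlepath_eq) auto
  moreover have "(\<lambda>t. f (cis t) / cis t ^ Suc k * \<i> * cis t) = (\<lambda>t. \<i> * (f (cis t) * cnj (cis t) ^ k))"
    by (auto simp: field_simps cis_cnj simp flip: power_mult_distrib cis_inverse)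
  ultimately have "\<i> * integral {0..2*pi} (\<lambda>t. f (cis t) * cnj (cis t) ^ k) =
      2 * pi * \<i> * (deriv ^^ k) f 0 / fact k"
    by simp
  then have "integral {0..2*pi} (\<lambda>t. f (cis t) * cnj (cis t) ^ k) = 2 * pi * (deriv ^^ k) f 0 / fact k"
    by (simp add: mult.assoc mult.left_commute[of _ \<i>] flip: times_divide_eq_right)
  moreover have "(\<integral>z. f z * cnj z ^ k \<partial>arc_measure) =
      integral {0..2*pi} (\<lambda>t. f (cis t) * cnj (cis t) ^ k) / (2 * pi)"
    using m c by (intro integral_arc_measure) (auto intro!: continuous_intros)
  ultimately show ?thesis by simp
qed

section \<open>Bernstein--Szego approximation\<close>

text \<open>By \<open>nsq_Phi_eq_prod\<close>, the squared norm of \<open>Phi a n\<close> in any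
  probability measure that makes it orthogonal; the product form depends on the coefficients
  only.\<close>

definition szego_norm :: "(nat \<Rightarrow> complex) \<Rightarrow> nat \<Rightarrow> real" where
  "szego_norm a n = (\<Prod>j<n. 1 - (cmod (a j))\<^sup>2)"

definition bs_weight :: "(nat \<Rightarrow> complex) \<Rightarrow> nat \<Rightarrow> complex \<Rightarrow> real" where
  "bs_weight a n z = szego_norm a n / (cmod (poly (Phi a n) z))\<^sup>2"

definition bs_measure :: "(nat \<Rightarrow> complex) \<Rightarrow> nat \<Rightarrow> complex measure" where
  "bs_measure a n = density arc_measure (\<lambda>z. ennreal (bs_weight a n z))"

lemma one_minus_cmod_sq_pos: "cmod c < 1 \<Longrightarrow> 0 < 1 - (cmod c)\<^sup>2"
  using abs_square_less_1[of "cmod c"] by simp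

lemma szego_norm_pos: "\<forall>k. cmod (a k) < 1 \<Longrightarrow> szego_norm a n > 0"
  unfolding szego_norm_def by (intro prod_pos) (auto intro: one_minus_cmod_sq_pos simp del: diff_gt_0_iff_gt)

lemma poly_measurable [measurable]:
  fixes P :: "complex poly"
  shows "poly P \<in> borel_measurable borel"
  by (intro borel_measurable_continuous_onI continuous_intros)

lemma bs_weight_measurable [measurable]: "bs_weight a n \<in> borel_measurable borel"
  unfolding bs_weight_def by measurable

lemma continuous_on_bs_weight:
  assumes a: "\<forall>k. cmod (a k) < 1"
  shows "continuous_on (sphere 0 1) (bs_weight a n)"
  unfolding bs_weight_def using Phi_circle_nonzero[OF a] by (intro continuous_intros) auto

lemma bs_weight_nonneg:
  assumes a: "\<forall>k. cmod (a k) < 1"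
  shows "bs_weight a n z \<ge> 0"
  unfolding bs_weight_def using szego_norm_pos[OF a, of n] by simp

lemma bs_weight_pos:
  assumes a: "\<forall>k. cmod (a k) < 1" and "cmod z = 1"
  shows "bs_weight a n z > 0"
  unfolding bs_weight_def using szego_norm_pos[OF a, of n] Phi_circle_nonzero[OF a, of z n] assms by simp

lemma integral_bs_measure:
  fixes f :: "complex \<Rightarrow> 'b::{banach, second_countable_topology}"
  assumes a: "\<forall>k. cmod (a k) < 1" and "f \<in> borel_measurable borel"
  shows "(\<integral>z. f z \<partial>bs_measure a n) = (\<integral>z. bs_weight a n z *\<^sub>R f z \<partial>arc_measure)"
  unfolding bs_measure_def using assms
  by (intro integral_density) (auto intro: bs_weight_nonneg measurable_cong_sets[OF arc.sets_circle refl, THEN equalityD2, THEN subsetD])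

lemma circle_measure_bs:
  assumes a: "\<forall>k. cmod (a k) < 1"
  shows "circle_measure (bs_measure a n)"
proof -
  have "integrable arc_measure (bs_weight a n)"
    by (intro arc.integrable_circle continuous_on_bs_weight a) auto
  then have "(\<integral>\<^sup>+z. ennreal (bs_weight a n z) \<partial>arc_measure) < \<infinity>"
    using bs_weight_nonneg[OF a] by (subst nn_integral_eq_integral) auto
  then have "emeasure (bs_measure a n) (space (bs_measure a n)) < \<infinity>"
    unfolding bs_measure_def by (subst emeasure_density) (auto cong: nn_integral_cong)
  moreover have "AE z in bs_measure a n. cmod z = 1"
    unfolding bs_measure_def using arc.AE_circle by (subst AE_density) (auto elim: AE_mp)
  moreover have "sets (bs_measure a n) = sets borel" by (simp add: bs_measure_def)
  ultimately show ?thesis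
    by (intro circle_measure.intro finite_measureI circle_measure_axioms.intro) auto
qed

text \<open>On the circle the integrand is a multiple of z^(n-k) / Psi. As \<open>Psi\<close> has no
  zero in the closed disc, the mean value property gives the value at 0, which vanishes because k <
  n.\<close>

lemma orth_bs_measure:
  assumes a: "\<forall>k. cmod (a k) < 1"
  shows "circle_measure.orth (bs_measure a n) (Phi a n) n"
proof -
  interpret B: circle_measure "bs_measure a n" by (rule circle_measure_bs[OF a])
  have "B.ip (monom 1 k) (Phi a n) = 0" if k: "k < n" for k
  proof -
    let ?f = "\<lambda>z. z ^ (n - k) / poly (Psi a n) z"
    have "bs_weight a n z *\<^sub>R (cnj (poly (monom 1 k) z) * poly (Phi a n) z) = of_real (szego_norm a n) * (?f z * cnj z ^ 0)"
      if z: "cmod z = 1" for z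
    proof -
      have nz: "poly (Phi a n) z \<noteq> 0" using Phi_circle_nonzero[OF a z] .
      have "z ^ n = z ^ k * z ^ (n - k)" using k by (simp flip: power_add)
      moreover have "cnj z ^ k * z ^ k = 1"
        using unit_circle_mult_cnj[OF z] by (simp flip: power_mult_distrib)
      ultimately have "cnj z ^ k * z ^ n = z ^ (n - k)" by (metis mult.assoc mult_1)
      then have "cnj z ^ k * poly (Phi a n) z * poly (Psi a n) z =
          z ^ (n - k) * (poly (Phi a n) z * cnj (poly (Phi a n) z))"
        by (simp add: Psi_circle(1)[OF z] algebra_simps)
      also have "poly (Phi a n) z * cnj (poly (Phi a n) z) = of_real ((cmod (poly (Phi a n) z))\<^sup>2)"
        by (simp only: complex_norm_square)
      finally have E: "cnj z ^ k * poly (Phi a n) z * poly (Psi a n) z =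
          z ^ (n - k) * of_real ((cmod (poly (Phi a n) z))\<^sup>2)" .
      have "poly (Psi a n) z \<noteq> 0" using szego_disc[OF a] z by simp
      moreover have "complex_of_real ((cmod (poly (Phi a n) z))\<^sup>2) \<noteq> 0" using nz by simp
      ultimately have F: "cnj z ^ k * poly (Phi a n) z / of_real ((cmod (poly (Phi a n) z))\<^sup>2) = ?f z"
        using E frac_eq_eq by blast
      show ?thesis unfolding F[symmetric]
        by (simp add: bs_weight_def poly_monom scaleR_conv_of_real)
    qed
    then have "B.ip (monom 1 k) (Phi a n) =
        (\<integral>z. of_real (szego_norm a n) * (?f z * cnj z ^ 0) \<partial>arc_measure)"
      unfolding B.ip_def using a by (subst integral_bs_measure) (auto intro!: arc.integral_cong_circle)
    also have "\<dots> = of_real (szego_norm a n) * (\<integral>z. ?f z * cnj z ^ 0 \<partial>arc_measure)"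
      by (rule integral_mult_right_zero)
    also have "(\<integral>z. ?f z * cnj z ^ 0 \<partial>arc_measure) = (deriv ^^ 0) ?f 0 / fact 0"
      using szego_disc[OF a]
      by (intro integral_holomorphic_arc) (auto intro!: continuous_intros holomorphic_intros)
    also have "\<dots> = 0" using k by simp
    finally show ?thesis by simp
  qed
  then show ?thesis by (simp add: B.orth_def)
qed

text \<open>The squared norm of \<open>Phi a n\<close> is computed twice: the weight cancels it and
  leaves \<open>szego_norm a n\<close>, while the product formula gives
  \<open>szego_norm a n\<close> times the total mass.\<close>

lemma measure_bs_UNIV:
  assumes a: "\<forall>k. cmod (a k) < 1"
  shows "measure (bs_measure a n) UNIV = 1"
proof -
  interpret B: circle_measure "bs_measure a n" by (rule circle_measure_bs[OF a])
  have "B.nsq (Phi a n) = (\<integral>z. bs_weight a n z *\<^sub>R (cmod (poly (Phi a n) z))\<^sup>2 \<partial>arc_measure)"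
    unfolding B.nsq_def using a by (intro integral_bs_measure) auto
  also have "\<dots> = (\<integral>z. szego_norm a n \<partial>arc_measure)"
    using Phi_circle_nonzero[OF a] by (intro arc.integral_cong_circle) (auto simp: bs_weight_def)
  also have "\<dots> = szego_norm a n" by simp
  finally show ?thesis
    using B.nsq_Phi_eq_prod[OF a orth_bs_measure[OF a]] szego_norm_pos[OF a, of n]
    unfolding szego_norm_def by (metis less_irrefl mult_cancel_left2)
qed

text \<open>Turns the real polynomials supplied by Stone-Weierstrass into trigonometric ones, whose
  integrals are determined by finitely many moments.\<close>

lemma real_polynomial_circle:
  assumes "real_polynomial_function p"
  shows "\<exists>m P. \<forall>z. cmod z = 1 \<longrightarrow> complex_of_real (p z) = cnj z ^ m * poly P z"
  using assms
proof induction
  case (linear f)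
  interpret bounded_linear f by fact
  \<comment> \<open>From Re z = (z + cnj z)/2 and Im z = (z - cnj z)/(2i); the factor
    \<open>cnj z\<close> lowers the degrees 0 and 2 to -1 and 1.\<close>
  have "complex_of_real (f z) = cnj z ^ 1 * poly [:(f 1 + \<i> * f \<i>) / 2, 0, (f 1 - \<i> * f \<i>) / 2:] z"
    if "cmod z = 1" for z
  proof -
    have "z = Re z *\<^sub>R 1 + Im z *\<^sub>R \<i>" by (simp add: complex_eq_iff)
    then have "f z = f (Re z *\<^sub>R 1 + Im z *\<^sub>R \<i>)" by (rule arg_cong)
    also have "\<dots> = Re z * f 1 + Im z * f \<i>" by (simp only: add scaleR) simp
    finally have f: "f z = Re z * f 1 + Im z * f \<i>" .
    have "cnj z ^ 1 * poly [:(f 1 + \<i> * f \<i>) / 2, 0, (f 1 - \<i> * f \<i>) / 2:] z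
        = (f 1 + \<i> * f \<i>) / 2 * cnj z + (f 1 - \<i> * f \<i>) / 2 * (cnj z * z) * z"
      by (simp add: algebra_simps)
    also have "\<dots> = complex_of_real (f z)"
      unfolding unit_circle_mult_cnj[OF that] f by (simp add: complex_eq_iff field_simps)
    finally show ?thesis ..
  qed
  then show ?case by blast
next
  case (const c)
  have "\<forall>z. cmod z = 1 \<longrightarrow> complex_of_real c = cnj z ^ 0 * poly [:of_real c:] z" by simp
  then show ?case by blast
next
  case (add f g)
  then obtain m P m' P' where
    fg: "\<And>z. cmod z = 1 \<Longrightarrow> complex_of_real (f z) = cnj z ^ m * poly P z"
      "\<And>z. cmod z = 1 \<Longrightarrow> complex_of_real (g z) = cnj z ^ m' * poly P' z" by blast
  have "complex_of_real (f z + g z) = cnj z ^ (m + m') * poly (monom 1 m' * P + monom 1 m * P') z"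
    if z: "cmod z = 1" for z
  proof -
    have "cnj z ^ k * z ^ k = 1" for k
      using unit_circle_mult_cnj[OF z] by (simp flip: power_mult_distrib)
    then have "cnj z ^ m * poly P z + cnj z ^ m' * poly P' z =
       cnj z ^ m * (cnj z ^ m' * z ^ m') * poly P z + cnj z ^ m' * (cnj z ^ m * z ^ m) * poly P' z"
      by simp
    then show ?thesis by (simp add: fg[OF z] poly_monom power_add algebra_simps)
  qed
  then show ?case by blast
next
  case (mult f g)
  then obtain m P m' P' where
    fg: "\<And>z. cmod z = 1 \<Longrightarrow> complex_of_real (f z) = cnj z ^ m * poly P z"
      "\<And>z. cmod z = 1 \<Longrightarrow> complex_of_real (g z) = cnj z ^ m' * poly P' z" by blast
  have "complex_of_real (f z * g z) = cnj z ^ (m + m') * poly (P * P') z"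
    if z: "cmod z = 1" for z
    by (simp add: fg[OF z] power_add algebra_simps)
  then show ?case by blast
qed

text \<open>Moments of negative order are conjugates of those of positive order, so the latter
  decide all trigonometric integrals.\<close>

lemma trig_integral_eq:
  assumes "circle_measure \<mu>" "circle_measure \<nu>"
    and m: "\<And>k. k \<le> n \<Longrightarrow> (\<integral>z. z ^ k \<partial>\<mu>) = (\<integral>z. z ^ k \<partial>\<nu>)"
    and n: "m \<le> n" "degree P \<le> n"
  shows "(\<integral>z. cnj z ^ m * poly P z \<partial>\<mu>) = (\<integral>z. cnj z ^ m * poly P z \<partial>\<nu>)"
proof -
  have 1: "(\<integral>z. cnj z ^ m * z ^ k \<partial>\<kappa>) =
      (if m \<le> k then \<integral>z. z ^ (k - m) \<partial>\<kappa> else cnj (\<integral>z. z ^ (m - k) \<partial>\<kappa>))"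
    if "circle_measure \<kappa>" for \<kappa> k
  proof -
    interpret K: circle_measure \<kappa> by fact
    have z: "cnj z ^ j * z ^ j = 1" if "cmod z = 1" for z j
      using unit_circle_mult_cnj[OF that] by (simp flip: power_mult_distrib)
    show ?thesis
    proof (cases "m \<le> k")
      case True
      have "cnj z ^ m * z ^ k = z ^ (k - m)" if "cmod z = 1" for z
        using z[OF that, of m] True by (metis le_add_diff_inverse mult.assoc mult_1 power_add)
      then have "(\<integral>z. cnj z ^ m * z ^ k \<partial>\<kappa>) = (\<integral>z. z ^ (k - m) \<partial>\<kappa>)"
        by (intro K.integral_cong_circle) auto
      with True show ?thesis by simp
    next
      case False
      then have "cnj z ^ m = cnj z ^ (m - k) * cnj z ^ k" for z by (simp flip: power_add)
      then have "cnj z ^ m * z ^ k = cnj (z ^ (m - k))" if "cmod z = 1" for z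
        using z[OF that, of k] by (simp add: mult.assoc)
      then have "(\<integral>z. cnj z ^ m * z ^ k \<partial>\<kappa>) = (\<integral>z. cnj (z ^ (m - k)) \<partial>\<kappa>)"
        by (intro K.integral_cong_circle) auto
      with False show ?thesis by (simp only: Bochner_Integration.integral_cnj if_False)
    qed
  qed
  have 2: "(\<integral>z. cnj z ^ m * poly P z \<partial>\<kappa>) = (\<Sum>k\<le>degree P. coeff P k * (\<integral>z. cnj z ^ m * z ^ k \<partial>\<kappa>))"
    if "circle_measure \<kappa>" for \<kappa>
  proof -
    interpret K: circle_measure \<kappa> by fact
    have "(\<integral>z. cnj z ^ m * poly P z \<partial>\<kappa>) = (\<integral>z. (\<Sum>k\<le>degree P. coeff P k * (cnj z ^ m * z ^ k)) \<partial>\<kappa>)"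
      by (simp add: poly_altdef sum_distrib_left mult.left_commute)
    also have "\<dots> = (\<Sum>k\<le>degree P. (\<integral>z. coeff P k * (cnj z ^ m * z ^ k) \<partial>\<kappa>))"
      by (intro Bochner_Integration.integral_sum K.integrable_continuous continuous_intros)
    finally show ?thesis by simp
  qed
  have "(\<integral>z. cnj z ^ m * z ^ k \<partial>\<mu>) = (\<integral>z. cnj z ^ m * z ^ k \<partial>\<nu>)" if "k \<le> degree P" for k
    using n that m[of "k - m"] m[of "m - k"] unfolding 1[OF assms(1)] 1[OF assms(2)] by simp
  then show ?thesis unfolding 2[OF assms(1)] 2[OF assms(2)] by simp
qed

text \<open>For a trigonometric polynomial the integrals agree exactly as soon as n reaches
  \<open>m + degree P\<close>. All masses being 1, uniform approximation on the circle costs e/3 on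
  each side.\<close>

lemma bs_weak_convergence:
  assumes \<mu>: "circle_measure \<mu>" "measure \<mu> UNIV = 1"
    and a: "\<forall>k. cmod (a k) < 1" and o: "\<And>n. circle_measure.orth \<mu> (Phi a n) n"
    and h: "continuous_on UNIV (h :: complex \<Rightarrow> real)"
  shows "(\<lambda>n. \<integral>z. h z * bs_weight a n z \<partial>arc_measure) \<longlonglongrightarrow> (\<integral>z. h z \<partial>\<mu>)"
proof (rule LIMSEQ_I)
  fix e :: real assume e: "e > 0"
  interpret M: circle_measure \<mu> by fact
  have "continuous_on (sphere 0 1) h" using h by (rule continuous_on_subset) auto
  then obtain p where p: "real_polynomial_function p" "\<And>z. z \<in> sphere 0 1 \<Longrightarrow> \<bar>h z - p z\<bar> < e / 3"
    using Stone_Weierstrass_real_polynomial_function[of "sphere 0 1" h "e/3"] e by auto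
  obtain m P where P: "\<And>z. cmod z = 1 \<Longrightarrow> complex_of_real (p z) = cnj z ^ m * poly P z"
    using real_polynomial_circle[OF p(1)] by blast
  have pc: "continuous_on S p" for S
    using p(1) continuous_on_polymonial_function real_polynomial_function_eq by blast
  have close: "\<bar>(\<integral>z. h z \<partial>\<kappa>) - (\<integral>z. p z \<partial>\<kappa>)\<bar> \<le> e / 3"
    if "circle_measure \<kappa>" "measure \<kappa> UNIV = 1" for \<kappa>
  proof -
    interpret K: circle_measure \<kappa> by fact
    have i: "integrable \<kappa> h" "integrable \<kappa> p" by (intro K.integrable_continuous h pc)+
    have "\<bar>(\<integral>z. h z \<partial>\<kappa>) - (\<integral>z. p z \<partial>\<kappa>)\<bar> = \<bar>\<integral>z. h z - p z \<partial>\<kappa>\<bar>" using i by simp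
    also have "\<dots> \<le> (\<integral>z. \<bar>h z - p z\<bar> \<partial>\<kappa>)" by (rule integral_abs_bound)
    also have "\<dots> \<le> (\<integral>z. e / 3 \<partial>\<kappa>)"
      using p(2) K.AE_circle i by (intro integral_mono_AE) (auto intro: less_imp_le)
    also have "\<dots> = e / 3" using that by simp
    finally show ?thesis .
  qed
  have eq: "(\<integral>z. p z \<partial>bs_measure a n) = (\<integral>z. p z \<partial>\<mu>)" if n: "n \<ge> m + degree P" for n
  proof -
    interpret B: circle_measure "bs_measure a n" by (rule circle_measure_bs[OF a])
    have *: "complex_of_real (\<integral>z. p z \<partial>\<kappa>) = (\<integral>z. cnj z ^ m * poly P z \<partial>\<kappa>)" if "circle_measure \<kappa>" for \<kappa>
    proof -
      interpret K: circle_measure \<kappa> by fact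
      have [measurable]: "p \<in> borel_measurable borel" using pc by (intro borel_measurable_continuous_onI)
      have "complex_of_real (\<integral>z. p z \<partial>\<kappa>) = (\<integral>z. complex_of_real (p z) \<partial>\<kappa>)" by simp
      also have "\<dots> = (\<integral>z. cnj z ^ m * poly P z \<partial>\<kappa>)" using P by (intro K.integral_cong_circle) auto
      finally show ?thesis .
    qed
    have "(\<integral>z. cnj z ^ m * poly P z \<partial>bs_measure a n) = (\<integral>z. cnj z ^ m * poly P z \<partial>\<mu>)"
      using n by (intro trig_integral_eq[of _ _ n] \<mu> B.circle_measure_axioms moments_eq[of _ _ a n] a o orth_bs_measure)
        (auto simp: \<mu> measure_bs_UNIV[OF a])
    then show ?thesis using *[OF \<mu>(1)] *[OF B.circle_measure_axioms] by (metis of_real_eq_iff)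
  qed
  show "\<exists>N. \<forall>n\<ge>N. norm ((\<integral>z. h z * bs_weight a n z \<partial>arc_measure) - (\<integral>z. h z \<partial>\<mu>)) < e"
  proof (intro exI allI impI)
    fix n assume n: "n \<ge> m + degree P"
    have hm: "h \<in> borel_measurable borel" using h by (intro borel_measurable_continuous_onI)
    have "(\<integral>z. h z * bs_weight a n z \<partial>arc_measure) = (\<integral>z. h z \<partial>bs_measure a n)"
      using a hm by (subst integral_bs_measure) (auto simp: mult.commute)
    then show "norm ((\<integral>z. h z * bs_weight a n z \<partial>arc_measure) - (\<integral>z. h z \<partial>\<mu>)) < e"
      using close[OF circle_measure_bs[OF a] measure_bs_UNIV[OF a], of n] close[OF \<mu>] eq[OF n] e
      unfolding real_norm_def by arith
  qed
qed

section \<open>The weighted entropy of the approximants\<close>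

text \<open>A logarithm of \<^const>\<open>Psi\<close> on the closed disc. Each factor
  \<open>\<Psi>\<^sub>n\<^sub>+\<^sub>1 / \<Psi>\<^sub>n\<close> takes values in the half plane \<open>Re > 0\<close>,
  so the principal branch serves for each summand.\<close>

definition szego_log :: "(nat \<Rightarrow> complex) \<Rightarrow> nat \<Rightarrow> complex \<Rightarrow> complex" where
  "szego_log a n z = (\<Sum>j<n. Ln (1 - a j * (z * poly (Phi a j) z / poly (Psi a j) z)))"

lemma szego_log_measurable [measurable]: "szego_log a n \<in> borel_measurable borel"
  unfolding szego_log_def by measurable

lemma szego_factor_nonpos:
  assumes a: "\<forall>k. cmod (a k) < 1" and z: "cmod z \<le> 1"
  shows "1 - a j * (z * poly (Phi a j) z / poly (Psi a j) z) \<notin> \<real>\<^sub>\<le>\<^sub>0"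
proof -
  have "Re (a j * (z * poly (Phi a j) z / poly (Psi a j) z)) < 1"
    using szego_mult_z_less[OF a z, of j] complex_Re_le_cmod order.strict_trans1 by blast
  then show ?thesis by (auto simp: complex_nonpos_Reals_iff)
qed

lemma exp_szego_log:
  assumes a: "\<forall>k. cmod (a k) < 1" and z: "cmod z \<le> 1"
  shows "exp (szego_log a n z) = poly (Psi a n) z"
proof (induction n)
  case (Suc n)
  define u where "u = 1 - a n * (z * poly (Phi a n) z / poly (Psi a n) z)"
  have "u \<noteq> 0" using szego_factor_nonpos[OF a z, of n] by (auto simp: u_def)
  then have "exp (szego_log a (Suc n) z) = poly (Psi a n) z * u"
    using Suc by (simp only: szego_log_def sum.lessThan_Suc exp_add exp_Ln simp_thms flip: u_def)
  also have "\<dots> = poly (Psi a (Suc n)) z"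
    using szego_disc[OF a z, of n] by (simp add: Psi_Suc u_def field_simps)
  finally show ?case .
qed (simp add: szego_log_def)

lemma continuous_on_szego_log:
  assumes a: "\<forall>k. cmod (a k) < 1"
  shows "continuous_on (cball 0 1) (szego_log a n)"
  unfolding szego_log_def using szego_factor_nonpos[OF a] szego_disc[OF a]
  by (intro continuous_intros) (auto simp del: complex_nonpos_Reals_iff)

lemma holomorphic_on_szego_log:
  assumes a: "\<forall>k. cmod (a k) < 1"
  shows "szego_log a n holomorphic_on ball 0 1"
  unfolding szego_log_def using szego_factor_nonpos[OF a] szego_disc[OF a]
  by (intro holomorphic_intros) auto

lemma szego_log_0 [simp]: "szego_log a n 0 = 0"
  by (simp add: szego_log_def)

text \<open>Differentiating the identity \<open>exp_szego_log\<close> avoids differentiating the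
  separate logarithms.\<close>

lemma deriv_szego_log:
  assumes a: "\<forall>k. cmod (a k) < 1" and z: "cmod z < 1"
  shows "deriv (szego_log a n) z = poly (pderiv (Psi a n)) z / poly (Psi a n) z"
proof -
  have "(szego_log a n has_field_derivative deriv (szego_log a n) z) (at z)"
    using holomorphic_derivI[OF holomorphic_on_szego_log[OF a], of z] z by simp
  then have "((\<lambda>z. exp (szego_log a n z)) has_field_derivative
      exp (szego_log a n z) * deriv (szego_log a n) z) (at z)"
    by (rule DERIV_fun_exp)
  moreover have "((\<lambda>z. exp (szego_log a n z)) has_field_derivative poly (pderiv (Psi a n)) z) (at z)"
    using exp_szego_log[OF a, of _ n] z
    by (intro has_field_derivative_transform_within_open[OF poly_DERIV, of "ball 0 1"]) auto
  ultimately have "poly (Psi a n) z * deriv (szego_log a n) z = poly (pderiv (Psi a n)) z"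
    using exp_szego_log[OF a, of z n] z DERIV_unique by fastforce
  then show ?thesis
    using szego_disc[OF a, of z n] z by (simp add: field_simps)
qed

lemma deriv_szego_log_0:
  assumes a: "\<forall>k. cmod (a k) < 1"
  shows "deriv (szego_log a n) 0 = coeff (Psi a n) 1"
  using deriv_szego_log[OF a, of 0 n] by (simp add: poly_0_coeff_0[of "pderiv _"] coeff_pderiv)

lemma deriv2_szego_log_0:
  assumes a: "\<forall>k. cmod (a k) < 1"
  shows "(deriv ^^ 2) (szego_log a n) 0 = 2 * coeff (Psi a n) 2 - (coeff (Psi a n) 1)\<^sup>2"
proof -
  have ev: "\<forall>\<^sub>F z in nhds 0. deriv (szego_log a n) z = poly (pderiv (Psi a n)) z / poly (Psi a n) z"
    using deriv_szego_log[OF a] by (intro eventually_nhds_in_open[of "ball 0 1", THEN eventually_mono]) auto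
  have "(deriv ^^ 2) (szego_log a n) 0 = deriv (deriv (szego_log a n)) 0"
    by (simp add: eval_nat_numeral)
  also have "\<dots> = deriv (\<lambda>z. poly (pderiv (Psi a n)) z / poly (Psi a n) z) 0"
    by (rule deriv_cong_ev[OF ev refl])
  also have "\<dots> = 2 * coeff (Psi a n) 2 - (coeff (Psi a n) 1)\<^sup>2"
    by (intro DERIV_imp_deriv)
       (auto intro!: derivative_eq_intros poly_DERIV
         simp: poly_0_coeff_0[of "pderiv _"] coeff_pderiv eval_nat_numeral)
  finally show ?thesis .
qed

definition Qw :: "complex \<Rightarrow> real" where
  "Qw z = (1 - Re z)\<^sup>2"

lemma Qw_nonneg [simp]: "Qw z \<ge> 0"
  by (simp add: Qw_def)

lemma Qw_le_4: "cmod z = 1 \<Longrightarrow> Qw z \<le> 4"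
  using abs_Re_le_cmod[of z] power_mono[of "\<bar>1 - Re z\<bar>" 2 2] by (simp add: Qw_def)

lemma continuous_on_Qw [continuous_intros]: "continuous_on S Qw"
  unfolding Qw_def by (intro continuous_intros)

lemma Qw_measurable [measurable]: "Qw \<in> borel_measurable borel"
  by (intro borel_measurable_continuous_onI continuous_intros)

lemma Qw_circle:
  assumes "cmod z = 1"
  shows "complex_of_real (Qw z) = 3/2 - z - cnj z + (z\<^sup>2 + cnj z ^ 2) / 4"
proof -
  have "(Re z)\<^sup>2 + (Im z)\<^sup>2 = 1" using assms by (simp flip: cmod_power2)
  then have "Im z * Im z = 1 - Re z * Re z" by (simp add: power2_eq_square)
  then show ?thesis
    by (simp add: complex_eq_iff Qw_def power2_eq_square) (simp add: field_simps)
qed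

text \<open>The products z f and z^2 f vanish at 0 and drop out; the conjugate modes of Q pick out
  the Taylor coefficients of orders 1 and 2, and 1/8 is 1/4 divided by 2!.\<close>

lemma integral_Qw_holomorphic:
  assumes m: "f \<in> borel_measurable borel"
    and f: "continuous_on (cball 0 1) f" "f holomorphic_on ball 0 1"
  shows "(\<integral>z. of_real (Qw z) * f z \<partial>arc_measure) =
     3/2 * f 0 - deriv f 0 + (deriv ^^ 2) f 0 / 8"
proof -
  have cs: "continuous_on (sphere 0 1) f" by (rule continuous_on_subset[OF f(1)]) auto
  define g where "g j k z = z ^ j * f z * cnj z ^ k" for j k z
  have i: "integrable arc_measure (g j k)" for j k unfolding g_def
    using m by (intro arc.integrable_circle continuous_intros cs) auto
  have I: "(\<integral>z. g j k z \<partial>arc_measure) = (deriv ^^ k) (\<lambda>z. z ^ j * f z) 0 / fact k" for j k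
    using m f unfolding g_def by (intro integral_holomorphic_arc) (auto intro!: continuous_intros holomorphic_intros)
  have "(\<integral>z. of_real (Qw z) * f z \<partial>arc_measure) =
    (\<integral>z. 3/2 * g 0 0 z - g 1 0 z - g 0 1 z + (g 2 0 z / 4 + g 0 2 z / 4) \<partial>arc_measure)"
    using m unfolding g_def by (intro arc.integral_cong_circle) (auto simp: Qw_circle algebra_simps)
  also have "\<dots> = 3/2 * (\<integral>z. g 0 0 z \<partial>arc_measure) - (\<integral>z. g 1 0 z \<partial>arc_measure)
      - (\<integral>z. g 0 1 z \<partial>arc_measure) + ((\<integral>z. g 2 0 z \<partial>arc_measure) / 4 + (\<integral>z. g 0 2 z \<partial>arc_measure) / 4)"
    using i by simp
  also have "\<dots> = 3/2 * f 0 - deriv f 0 + (deriv ^^ 2) f 0 / 8"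
    unfolding I by simp
  finally show ?thesis .
qed

lemma integral_Qw: "(\<integral>z. Qw z \<partial>arc_measure) = 3/2"
proof -
  have "complex_of_real (\<integral>z. Qw z \<partial>arc_measure) = (\<integral>z. of_real (Qw z) * 1 \<partial>arc_measure)" by simp
  also have "\<dots> = of_real (3/2)" by (subst integral_Qw_holomorphic) (auto simp: eval_nat_numeral)
  finally show ?thesis by (simp only: of_real_eq_iff)
qed

text \<open>On the circle \<open>Phi\<close> may be traded for \<open>Psi\<close>, which has a
  holomorphic logarithm, whereas \<open>Phi\<close> can vanish in the disc.\<close>

lemma ln_bs_weight:
  assumes a: "\<forall>k. cmod (a k) < 1" and z: "cmod z = 1"
  shows "ln (bs_weight a n z) = ln (szego_norm a n) - 2 * Re (szego_log a n z)"
proof -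
  have "cmod (poly (Phi a n) z) = exp (Re (szego_log a n z))"
    using exp_szego_log[OF a, of z n] z norm_exp_eq_Re[of "szego_log a n z"] cmod_Psi_circle[OF z, of a n] by simp
  then show ?thesis
    using szego_norm_pos[OF a, of n] by (simp add: bs_weight_def ln_div ln_realpow)
qed

lemma entropy_bs_weight:
  assumes a: "\<forall>k. cmod (a k) < 1"
  shows "(\<integral>z. Qw z * ln (bs_weight a n z) \<partial>arc_measure) =
     3/2 * ln (szego_norm a n) + 2 * Re (coeff (Psi a n) 1)
       - Re (2 * coeff (Psi a n) 2 - (coeff (Psi a n) 1)\<^sup>2) / 4"
proof -
  have c: "continuous_on (sphere 0 1) (szego_log a n)"
    by (rule continuous_on_subset[OF continuous_on_szego_log[OF a]]) auto
  define g where "g z = of_real (Qw z) * szego_log a n z" for z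
  have i: "integrable arc_measure g" unfolding g_def
    by (intro arc.integrable_circle continuous_intros c) auto
  have i2: "integrable arc_measure (\<lambda>z. Qw z * ln (szego_norm a n))"
    by (intro arc.integrable_continuous continuous_intros)
  have Ig: "(\<integral>z. g z \<partial>arc_measure) =
      - coeff (Psi a n) 1 + (2 * coeff (Psi a n) 2 - (coeff (Psi a n) 1)\<^sup>2) / 8" unfolding g_def
    by (subst integral_Qw_holomorphic)
       (auto simp: deriv2_szego_log_0[OF a] deriv_szego_log_0[OF a] continuous_on_szego_log[OF a] holomorphic_on_szego_log[OF a])
  have "(\<integral>z. Qw z * ln (bs_weight a n z) \<partial>arc_measure) =
      (\<integral>z. Qw z * ln (szego_norm a n) - 2 * Re (g z) \<partial>arc_measure)" unfolding g_def
    by (intro arc.integral_cong_circle) (auto simp: ln_bs_weight[OF a] algebra_simps)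
  also have "\<dots> = (\<integral>z. Qw z * ln (szego_norm a n) \<partial>arc_measure) - 2 * Re (\<integral>z. g z \<partial>arc_measure)"
    using i i2 by (subst Bochner_Integration.integral_diff) auto
  also have "(\<integral>z. Qw z * ln (szego_norm a n) \<partial>arc_measure) = 3/2 * ln (szego_norm a n)"
    by (simp add: integral_Qw)
  finally show ?thesis unfolding Ig by (simp add: field_simps)
qed

text \<open>The change of the entropy when the coefficient of index j is added: the logarithm comes
  from \<open>szego_norm\<close>, the rest from the first two Taylor coefficients of log
  Psi.\<close>

definition entropy_increment :: "(int \<Rightarrow> complex) \<Rightarrow> int \<Rightarrow> real" where
  "entropy_increment \<alpha> j = 3/2 * ln (1 - (cmod (\<alpha> j))\<^sup>2) + 2 * Re (\<alpha> j * cnj (\<alpha> (j - 1)))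
     - Re (\<alpha> j * cnj (\<alpha> (j - 2))) * (1 - (cmod (\<alpha> (j - 1)))\<^sup>2) / 2
     + Re ((\<alpha> j * cnj (\<alpha> (j - 1)))\<^sup>2) / 4"

lemma entropy_bs_weight_sum:
  assumes a: "\<forall>k. cmod (\<alpha> (int k)) < 1" and \<alpha>: "\<alpha> (-1) = -1"
  shows "(\<integral>z. Qw z * ln (bs_weight (\<lambda>k. \<alpha> (int k)) n z) \<partial>arc_measure) =
     (\<Sum>j<n. entropy_increment \<alpha> (int j))"
proof -
  define b where "b = (\<lambda>k. \<alpha> (int k))"
  \<comment> \<open>For n = 0 this is the convention \<open>\<alpha> (-1) = -1\<close> matching
    \<open>Phi b 0 = 1\<close>.\<close>
  have Phi0: "coeff (Phi b n) 0 = - cnj (\<alpha> (int n - 1))" for n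
    by (cases n) (simp_all add: \<alpha> Phi_Suc b_def flip: poly_0_coeff_0)
  have Psi1: "coeff (Psi b (Suc n)) 1 = coeff (Psi b n) 1 + \<alpha> (int n) * cnj (\<alpha> (int n - 1))" for n
    by (simp add: Psi_Suc Phi0) (simp add: b_def)
  have Psi2: "2 * coeff (Psi b (Suc n)) 2 - (coeff (Psi b (Suc n)) 1)\<^sup>2 =
     2 * coeff (Psi b n) 2 - (coeff (Psi b n) 1)\<^sup>2
      + 2 * \<alpha> (int n) * cnj (\<alpha> (int n - 2)) * of_real (1 - (cmod (\<alpha> (int n - 1)))\<^sup>2)
      - (\<alpha> (int n) * cnj (\<alpha> (int n - 1)))\<^sup>2" for n
  proof (cases n)
    case 0
    \<comment> \<open>The factor 1 - |\<alpha>(-1)|^2 vanishes here, so the value at index -2 does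
      not matter.\<close>
    then show ?thesis by (simp add: Psi_Suc \<alpha> eval_nat_numeral) (simp add: b_def)
  next
    case (Suc k)
    have 1: "coeff (Phi b n) 1 = - cnj (\<alpha> (int n - 2)) - cnj (\<alpha> (int n - 1)) * coeff (Psi b k) 1"
      using Phi0[of k] by (simp add: Suc Phi_Suc) (simp add: b_def algebra_simps)
    have 2: "coeff (Psi b (Suc n)) 2 = coeff (Psi b n) 2 - \<alpha> (int n) * coeff (Phi b n) 1"
      by (simp add: Psi_Suc eval_nat_numeral) (simp add: b_def)
    have 3: "coeff (Psi b n) 1 = coeff (Psi b k) 1 + \<alpha> (int n - 1) * cnj (\<alpha> (int n - 2))"
      using Psi1[of k] by (simp add: Suc algebra_simps)
    have 4: "complex_of_real (1 - (cmod (\<alpha> (int n - 1)))\<^sup>2) = 1 - \<alpha> (int n - 1) * cnj (\<alpha> (int n - 1))"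
      by (simp only: of_real_diff complex_norm_square) simp
    \<comment> \<open>The first coefficient of \<open>Psi b k\<close> cancels against the cross term
      of the square, and their discrepancy, given by fact 3, produces the factor 1 -
      |\<alpha>(n-1)|^2.\<close>
    show ?thesis unfolding Psi1[of n] 2 1 4 3 by (simp add: power2_eq_square algebra_simps)
  qed
  have "3/2 * ln (szego_norm b n) + 2 * Re (coeff (Psi b n) 1)
       - Re (2 * coeff (Psi b n) 2 - (coeff (Psi b n) 1)\<^sup>2) / 4 = (\<Sum>j<n. entropy_increment \<alpha> (int j))"
  proof (induction n)
    case 0
    show ?case by (simp add: szego_norm_def)
  next
    case (Suc n)
    have "ln (szego_norm b (Suc n)) = ln (szego_norm b n) + ln (1 - (cmod (\<alpha> (int n)))\<^sup>2)"
      unfolding szego_norm_def prod.lessThan_Suc using a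
      by (subst ln_mult_pos) (auto simp: b_def intro!: prod_pos one_minus_cmod_sq_pos simp del: diff_gt_0_iff_gt)
    moreover have "Re (2 * \<alpha> (int n) * cnj (\<alpha> (int n - 2)) * of_real (1 - (cmod (\<alpha> (int n - 1)))\<^sup>2))
       = 2 * (Re (\<alpha> (int n) * cnj (\<alpha> (int n - 2))) * (1 - (cmod (\<alpha> (int n - 1)))\<^sup>2))"
      by (simp add: algebra_simps del: of_real_diff)
    moreover have "3/2 * (l + m) + 2 * (A + B) - (D + 2 * T - C) / 4 =
        3/2 * l + 2 * A - D / 4 + (3/2 * m + 2 * B - T / 2 + C / 4)" for l m A B C D T :: real
      by (simp add: field_simps)
    ultimately show ?case
      using Suc unfolding Psi2 unfolding Psi1 sum.lessThan_Suc entropy_increment_def plus_complex.sel minus_complex.sel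
      by (simp only:)
  qed
  moreover have "\<forall>k. cmod (b k) < 1" using a by (simp add: b_def)
  ultimately show ?thesis using entropy_bs_weight[of b n] by (simp add: b_def)
qed

section \<open>Semicontinuity of the entropy\<close>

text \<open>Positive and negative parts are compared separately; both parts of \<open>g\<close> have
  finite integrals, so infinity minus infinity cannot arise on the right.\<close>

lemma ext_integral_le:
  assumes "AE x in M. f x \<le> ereal (g x)" and g: "integrable M g"
  shows "ext_integral M f \<le> ereal (\<integral>x. g x \<partial>M)"
proof -
  have i: "integrable M (\<lambda>x. max 0 (g x))" "integrable M (\<lambda>x. max 0 (- g x))" using g by auto
  have "(\<integral>\<^sup>+x. e2ennreal (f x) \<partial>M) \<le> (\<integral>\<^sup>+x. ennreal (max 0 (g x)) \<partial>M)"
  proof (intro nn_integral_mono_AE, rule AE_mp[OF assms(1)], intro AE_I2 impI)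
    fix x assume "f x \<le> ereal (g x)"
    then have "e2ennreal (f x) \<le> e2ennreal (ereal (max 0 (g x)))"
      by (intro e2ennreal_mono) (auto simp: max_def elim: order.trans)
    then show "e2ennreal (f x) \<le> ennreal (max 0 (g x))" by (simp only: e2ennreal_ereal)
  qed
  also have "\<dots> = ennreal (\<integral>x. max 0 (g x) \<partial>M)" using i by (intro nn_integral_eq_integral) auto
  finally have P: "enn2ereal (\<integral>\<^sup>+x. e2ennreal (f x) \<partial>M) \<le> ereal (\<integral>x. max 0 (g x) \<partial>M)"
    by (metis (no_types, lifting) enn2ereal_ennreal integral_nonneg_AE AE_I2 less_eq_ennreal.rep_eq max.cobounded1)
  have "ennreal (\<integral>x. max 0 (- g x) \<partial>M) = (\<integral>\<^sup>+x. ennreal (max 0 (- g x)) \<partial>M)"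
    using i by (intro nn_integral_eq_integral[symmetric]) auto
  also have "\<dots> \<le> (\<integral>\<^sup>+x. e2ennreal (- f x) \<partial>M)"
  proof (intro nn_integral_mono_AE, rule AE_mp[OF assms(1)], intro AE_I2 impI)
    fix x assume "f x \<le> ereal (g x)"
    then have "- ereal (g x) \<le> - f x" by (simp only: ereal_minus_le_minus)
    then have "e2ennreal (ereal (- g x)) \<le> e2ennreal (- f x)" by (intro e2ennreal_mono) simp
    moreover have "ennreal (max 0 (- g x)) = ennreal (- g x)" by (simp add: max_def ennreal_neg)
    ultimately show "ennreal (max 0 (- g x)) \<le> e2ennreal (- f x)" by (simp add: e2ennreal_ereal)
  qed
  finally have N: "ereal (\<integral>x. max 0 (- g x) \<partial>M) \<le> enn2ereal (\<integral>\<^sup>+x. e2ennreal (- f x) \<partial>M)"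
    by (metis (no_types, lifting) enn2ereal_ennreal integral_nonneg_AE AE_I2 less_eq_ennreal.rep_eq max.cobounded1)
  have "ext_integral M f \<le> ereal (\<integral>x. max 0 (g x) \<partial>M) - ereal (\<integral>x. max 0 (- g x) \<partial>M)"
    unfolding ext_integral_def using P N by (rule ereal_minus_mono)
  also have "\<dots> = ereal (\<integral>x. max 0 (g x) - max 0 (- g x) \<partial>M)" using i by simp
  also have "(\<lambda>x. max 0 (g x) - max 0 (- g x)) = g" by (auto simp: max_def)
  finally show ?thesis .
qed

lemma integrable_Qw_ln_bs:
  assumes a: "\<forall>k. cmod (a k) < 1"
  shows "integrable arc_measure (\<lambda>z. Qw z * ln (bs_weight a n z))"
proof -
  have "continuous_on (sphere 0 1) (\<lambda>z. ln (bs_weight a n z))"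
    using bs_weight_pos[OF a] by (intro continuous_on_ln continuous_on_bs_weight[OF a]) (auto simp: less_imp_neq[symmetric])
  then show ?thesis
    by (intro arc.integrable_circle continuous_on_mult[OF continuous_on_Qw]) auto
qed

text \<open>The singular measure is replaced by a set \<open>S\<close> that carries it, so that
  integrals against \<open>W\<close> become integrals of \<mu> over the complement of
  \<open>S\<close>.\<close>

locale circle_decomposition = circle_measure \<mu> for \<mu> :: "complex measure" +
  fixes W :: "complex \<Rightarrow> real" and S :: "complex set"
  assumes W_measurable [measurable]: "W \<in> borel_measurable borel"
    and W_nonneg: "W z \<ge> 0"
    and S_sets [measurable]: "S \<in> sets borel"
    and S_null: "AE z in arc_measure. z \<notin> S" \<comment> \<open>\<open>S\<close> carries the singular part\<close>
    and density_eq: "density \<mu> (\<lambda>z. ennreal (indicator (- S) z)) = density arc_measure (\<lambda>z. ennreal (W z))"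
    and prob: "measure \<mu> UNIV = 1"
begin

lemma integrable_W_iff:
  assumes "f \<in> borel_measurable borel"
  shows "integrable arc_measure (\<lambda>z. W z * f z) \<longleftrightarrow> integrable \<mu> (\<lambda>z. indicator (- S) z * f z)"
proof -
  have "integrable (density \<mu> (\<lambda>z. ennreal (indicator (- S) z))) f \<longleftrightarrow> integrable \<mu> (\<lambda>z. indicator (- S) z *\<^sub>R f z)"
    using assms by (intro integrable_density) auto
  moreover have "integrable (density arc_measure (\<lambda>z. ennreal (W z))) f \<longleftrightarrow> integrable arc_measure (\<lambda>z. W z *\<^sub>R f z)"
    using assms by (intro integrable_density) (auto simp: W_nonneg)
  ultimately show ?thesis using density_eq by simp
qed

lemma integral_W:
  assumes "f \<in> borel_measurable borel"
  shows "(\<integral>z. W z * f z \<partial>arc_measure) = (\<integral>z. indicator (- S) z * f z \<partial>\<mu>)"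
proof -
  have "(\<integral>z. f z \<partial>density \<mu> (\<lambda>z. ennreal (indicator (- S) z))) = (\<integral>z. indicator (- S) z *\<^sub>R f z \<partial>\<mu>)"
    using assms by (intro integral_density) auto
  moreover have "(\<integral>z. f z \<partial>density arc_measure (\<lambda>z. ennreal (W z))) = (\<integral>z. W z *\<^sub>R f z \<partial>arc_measure)"
    using assms by (intro integral_density) (auto simp: W_nonneg)
  ultimately show ?thesis using density_eq by simp
qed

lemma integrable_W:
  assumes "f \<in> borel_measurable borel" "\<And>z. cmod z = 1 \<Longrightarrow> \<bar>f z\<bar> \<le> B"
  shows "integrable arc_measure (\<lambda>z. W z * f z)"
  unfolding integrable_W_iff[OF assms(1)]
proof (rule integrable_const_bound[of _ B])
  show "AE z in \<mu>. norm (indicator (- S) z * f z) \<le> B"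
    using AE_circle
  proof (rule eventually_mono)
    fix z :: complex assume "cmod z = 1"
    then have "\<bar>f z\<bar> \<le> B" by (rule assms(2))
    then show "norm (indicator (- S) z * f z) \<le> B"
      using abs_ge_zero[of "f z"] by (auto simp: indicator_def)
  qed
qed (use assms in auto)

lemma integral_W_le:
  assumes f: "f \<in> borel_measurable borel" "\<And>z. cmod z = 1 \<Longrightarrow> \<bar>f z\<bar> \<le> B" "\<And>z. f z \<ge> 0"
  shows "(\<integral>z. W z * f z \<partial>arc_measure) \<le> (\<integral>z. f z \<partial>\<mu>)"
  unfolding integral_W[OF f(1)]
proof (rule integral_mono)
  show "integrable \<mu> (\<lambda>z. indicator (- S) z * f z)"
    using integrable_W[OF f(1,2)] integrable_W_iff[OF f(1)] by simp
  show "integrable \<mu> f"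
    using AE_circle f by (intro integrable_const_bound[of _ B]) (auto elim!: eventually_mono)
qed (auto simp: indicator_def f(3))

lemma entropy_le:
  assumes a: "\<forall>k. cmod (a k) < 1"
  shows "ext_integral arc_measure (\<lambda>z. ereal (Qw z) * elog (W z)) \<le>
    ereal ((\<integral>z. Qw z * ln (bs_weight a n z) \<partial>arc_measure)
      + (\<integral>z. Qw z * (cmod (poly (Phi a n) z))\<^sup>2 \<partial>\<mu>) / szego_norm a n - 3/2)"
proof -
  let ?F = "\<lambda>z. Qw z * (cmod (poly (Phi a n) z))\<^sup>2"
  have Fc: "continuous_on UNIV ?F" by (intro continuous_intros)
  have Fm [measurable]: "?F \<in> borel_measurable borel" by measurable
  have "bounded (?F ` sphere 0 1)"
    by (intro compact_imp_bounded compact_continuous_image continuous_on_subset[OF Fc]) auto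
  then obtain B where "\<forall>x\<in>?F ` sphere 0 1. norm x \<le> B"
    unfolding bounded_iff by blast
  then have B: "\<bar>?F z\<bar> \<le> B" if "cmod z = 1" for z using that by simp
  have i1: "integrable arc_measure (\<lambda>z. W z * ?F z)" by (rule integrable_W[OF Fm B])
  note i2 = integrable_Qw_ln_bs[OF a, of n]
  have i3: "integrable arc_measure Qw"
    by (intro arc.integrable_continuous continuous_intros)
  have "ext_integral arc_measure (\<lambda>z. ereal (Qw z) * elog (W z)) \<le>
    ereal (\<integral>z. Qw z * ln (bs_weight a n z) + W z * ?F z / szego_norm a n - Qw z \<partial>arc_measure)"
  proof (rule ext_integral_le)
    show "AE z in arc_measure. ereal (Qw z) * elog (W z) \<le>
      ereal (Qw z * ln (bs_weight a n z) + W z * ?F z / szego_norm a n - Qw z)"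
      using arc.AE_circle
    proof (rule eventually_mono)
      fix z :: complex assume z: "cmod z = 1"
      let ?b = "bs_weight a n z"
      have b: "?b > 0" using bs_weight_pos[OF a z] .
      have 1: "W z * ?F z / szego_norm a n = Qw z * (W z / ?b)"
        by (simp add: bs_weight_def)
      show "ereal (Qw z) * elog (W z) \<le>
        ereal (Qw z * ln (bs_weight a n z) + W z * ?F z / szego_norm a n - Qw z)"
      proof (cases "W z > 0")
        case True
        then have "ln (W z / ?b) \<le> W z / ?b - 1" using b by (intro ln_le_minus_one) auto
        then have "ln (W z) \<le> ln ?b + W z / ?b - 1" using True b by (simp add: ln_div)
        then have "Qw z * ln (W z) \<le> Qw z * (ln ?b + W z / ?b - 1)" by (intro mult_left_mono) auto
        then show ?thesis using True unfolding 1 by (simp add: elog_def algebra_simps)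
      next
        case False
        then have "W z = 0" using W_nonneg[of z] by simp
        \<comment> \<open>If \<open>Qw z\<close> vanishes, 0 times -infinity is 0 in
          \<open>ereal\<close> and both sides are 0; otherwise the left side is -infinity.\<close>
        moreover have "Qw z = 0 \<or> Qw z > 0" using Qw_nonneg[of z] by linarith
        ultimately show ?thesis by (auto simp: elog_def)
      qed
    qed
  qed (use i1 i2 i3 in simp)
  also have "(\<integral>z. Qw z * ln (bs_weight a n z) + W z * ?F z / szego_norm a n - Qw z \<partial>arc_measure) =
     (\<integral>z. Qw z * ln (bs_weight a n z) \<partial>arc_measure) + (\<integral>z. W z * ?F z \<partial>arc_measure) / szego_norm a n - 3/2"
    using i1 i2 i3 by (simp add: integral_Qw)
  also have "ereal \<dots> \<le> ereal ((\<integral>z. Qw z * ln (bs_weight a n z) \<partial>arc_measure)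
      + (\<integral>z. ?F z \<partial>\<mu>) / szego_norm a n - 3/2)"
    using integral_W_le[OF Fm B] szego_norm_pos[OF a, of n]
    by (simp add: divide_right_mono)
  finally show ?thesis .
qed

end

context circle_measure
begin

text \<open>The arithmetic-geometric mean suffices in place of Cauchy-Schwarz, as it is applied to
  polynomials whose squared norms share one bound.\<close>

lemma cmod_ip_le: "cmod (ip P R) \<le> (nsq P + nsq R) / 2"
proof -
  have "cmod (ip P R) \<le> (\<integral>z. cmod (cnj (poly P z) * poly R z) \<partial>\<nu>)"
    unfolding ip_def by (rule integral_norm_bound)
  also have "\<dots> \<le> (\<integral>z. ((cmod (poly P z))\<^sup>2 + (cmod (poly R z))\<^sup>2) / 2 \<partial>\<nu>)"
  proof (rule integral_mono)
    fix z
    have "(cmod (poly P z) - cmod (poly R z))\<^sup>2 \<ge> 0" by simp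
    then show "cmod (cnj (poly P z) * poly R z) \<le> ((cmod (poly P z))\<^sup>2 + (cmod (poly R z))\<^sup>2) / 2"
      by (simp add: norm_mult power2_eq_square algebra_simps)
  qed (auto intro!: integrable_norm)
  also have "\<dots> = (nsq P + nsq R) / 2" by (simp add: nsq_def)
  finally show ?thesis .
qed

lemma nsq_pCons: "nsq (pCons 0 P) = nsq P"
  using ip_pCons[of P P] by (simp add: ip_self)

text \<open>By the recursion, z Phi and z^2 Phi are polynomials orthogonal to \<open>Phi a n\<close>
  up to terms with a factor \<open>a n\<close> or \<open>a (Suc n)\<close>. So the modes 1 and 2 of
  Q contribute little and its mean 3/2 remains.\<close>

lemma weighted_nsq_Phi_approx:
  assumes o: "\<And>n. orth (Phi a n) n" and a: "\<forall>k. cmod (a k) < 1" and m: "measure \<nu> UNIV = 1"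
  shows "\<bar>(\<integral>z. Qw z * (cmod (poly (Phi a n) z))\<^sup>2 \<partial>\<nu>) / szego_norm a n - 3/2\<bar> \<le>
    3 * (cmod (a n) + cmod (a (Suc n)))"
proof -
  let ?P = "Phi a n" and ?N = "szego_norm a n"
  have N: "nsq (Phi a k) = szego_norm a k" for k
    using nsq_Phi_eq_prod[OF a o, of k] m by (simp add: szego_norm_def)
  have pos: "szego_norm a k > 0" for k by (rule szego_norm_pos[OF a])
  have le: "szego_norm a (Suc n) \<le> ?N"
    using pos[of n] by (simp add: szego_norm_def mult_le_cancel_left1)
  have z: "pCons 0 (Phi a k) = Phi a (Suc k) + smult (cnj (a k)) (Psi a k)" for k
    by (simp add: Phi_Suc)
  have m1: "cmod (ip ?P (pCons 0 ?P)) \<le> cmod (a n) * ?N"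
  proof -
    have "ip ?P (pCons 0 ?P) = cnj (a n) * ip ?P (Psi a n)"
      unfolding z using ip_orth[OF o[of "Suc n"], of ?P] by (simp add: ip_add_right ip_smult_right)
    moreover have "cmod (ip ?P (Psi a n)) \<le> ?N"
      using cmod_ip_le[of ?P "Psi a n"] by (simp add: nsq_Psi N)
    ultimately show ?thesis by (simp add: norm_mult mult_left_mono)
  qed
  have m2: "cmod (ip ?P (pCons 0 (pCons 0 ?P))) \<le> (cmod (a n) + cmod (a (Suc n))) * ?N"
  proof -
    have "ip ?P (pCons 0 (pCons 0 ?P)) = ip ?P (pCons 0 (Phi a (Suc n))) + cnj (a n) * ip ?P (pCons 0 (Psi a n))"
    proof -
      have "pCons 0 (pCons 0 ?P) = pCons 0 (Phi a (Suc n)) + smult (cnj (a n)) (pCons 0 (Psi a n))"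
        unfolding z[of n] by simp
      then show ?thesis by (simp only: ip_add_right ip_smult_right)
    qed
    also have "ip ?P (pCons 0 (Phi a (Suc n))) = cnj (a (Suc n)) * ip ?P (Psi a (Suc n))"
      unfolding z using ip_orth[OF o[of "Suc (Suc n)"], of ?P] by (simp add: ip_add_right ip_smult_right)
    finally have "cmod (ip ?P (pCons 0 (pCons 0 ?P))) \<le>
       cmod (a (Suc n)) * cmod (ip ?P (Psi a (Suc n))) + cmod (a n) * cmod (ip ?P (pCons 0 (Psi a n)))"
      by (metis (no_types, lifting) complex_mod_cnj norm_mult norm_triangle_ineq)
    also have "\<dots> \<le> cmod (a (Suc n)) * ?N + cmod (a n) * ?N"
      using cmod_ip_le[of ?P "Psi a (Suc n)"] cmod_ip_le[of ?P "pCons 0 (Psi a n)"] le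
      by (intro add_mono mult_left_mono) (auto simp: nsq_pCons nsq_Psi N)
    finally show ?thesis by (simp add: algebra_simps)
  qed
  have "complex_of_real (\<integral>z. Qw z * (cmod (poly ?P z))\<^sup>2 \<partial>\<nu>) =
    (\<integral>z. 3/2 * (cnj (poly ?P z) * poly ?P z) - cnj (poly ?P z) * poly (pCons 0 ?P) z
       - cnj (cnj (poly ?P z) * poly (pCons 0 ?P) z)
       + (cnj (poly ?P z) * poly (pCons 0 (pCons 0 ?P)) z / 4 + cnj (cnj (poly ?P z) * poly (pCons 0 (pCons 0 ?P)) z) / 4) \<partial>\<nu>)"
    unfolding integral_complex_of_real[symmetric]
  proof (intro integral_cong_circle)
    fix z :: complex assume z: "cmod z = 1"
    have "cnj (poly ?P z) * poly ?P z = of_real ((cmod (poly ?P z))\<^sup>2)"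
      by (simp only: complex_norm_square mult.commute)
    then have "complex_of_real (Qw z * (cmod (poly ?P z))\<^sup>2) = (3/2 - z - cnj z + (z\<^sup>2 + cnj z ^ 2) / 4) * (cnj (poly ?P z) * poly ?P z)"
      using Qw_circle[OF z] by (simp only: of_real_mult)
    also have "\<dots> = 3/2 * (cnj (poly ?P z) * poly ?P z) - cnj (poly ?P z) * poly (pCons 0 ?P) z
       - cnj (cnj (poly ?P z) * poly (pCons 0 ?P) z)
       + (cnj (poly ?P z) * poly (pCons 0 (pCons 0 ?P)) z / 4 + cnj (cnj (poly ?P z) * poly (pCons 0 (pCons 0 ?P)) z) / 4)"
      by (simp add: power2_eq_square) (simp add: algebra_simps)
    finally show "complex_of_real (Qw z * (cmod (poly ?P z))\<^sup>2) = \<dots>" .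
  qed (intro borel_measurable_continuous_onI continuous_intros; simp)+
  also have "\<dots> = 3/2 * ip ?P ?P - ip ?P (pCons 0 ?P) - cnj (ip ?P (pCons 0 ?P))
      + (ip ?P (pCons 0 (pCons 0 ?P)) / 4 + cnj (ip ?P (pCons 0 (pCons 0 ?P))) / 4)"
  proof -
    define g where "g R z = cnj (poly ?P z) * poly R z" for R z
    have i: "integrable \<nu> (g R)" "integrable \<nu> (\<lambda>z. cnj (g R z))" for R
      unfolding g_def by (intro integrable_continuous continuous_intros)+
    have ipg: "ip ?P R = (\<integral>z. g R z \<partial>\<nu>)" for R by (simp add: ip_def g_def)
    show ?thesis unfolding ipg Bochner_Integration.integral_cnj[symmetric] g_def[symmetric]
      using i by (simp del: Bochner_Integration.integral_cnj complex_cnj_mult)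
  qed
  finally have "complex_of_real (\<integral>z. Qw z * (cmod (poly ?P z))\<^sup>2 \<partial>\<nu>) =
    3/2 * of_real ?N - ip ?P (pCons 0 ?P) - cnj (ip ?P (pCons 0 ?P))
      + (ip ?P (pCons 0 (pCons 0 ?P)) / 4 + cnj (ip ?P (pCons 0 (pCons 0 ?P))) / 4)"
    by (simp add: ip_self N)
  then have "Re (complex_of_real (\<integral>z. Qw z * (cmod (poly ?P z))\<^sup>2 \<partial>\<nu>)) =
    Re (3/2 * of_real ?N - ip ?P (pCons 0 ?P) - cnj (ip ?P (pCons 0 ?P))
      + (ip ?P (pCons 0 (pCons 0 ?P)) / 4 + cnj (ip ?P (pCons 0 (pCons 0 ?P))) / 4))" by (rule arg_cong)
  then have eq: "(\<integral>z. Qw z * (cmod (poly ?P z))\<^sup>2 \<partial>\<nu>) - 3/2 * ?N =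
      - 2 * Re (ip ?P (pCons 0 ?P)) + Re (ip ?P (pCons 0 (pCons 0 ?P))) / 2"
    by simp
  \<comment> \<open>The coefficient 1/2 of the second shift is rounded up to 1, which gives 2 + 1 =
    3.\<close>
  have "\<bar>(\<integral>z. Qw z * (cmod (poly ?P z))\<^sup>2 \<partial>\<nu>) - 3/2 * ?N\<bar> \<le>
      2 * (cmod (a n) * ?N) + (cmod (a n) + cmod (a (Suc n))) * ?N"
    unfolding eq using m1 m2 abs_Re_le_cmod[of "ip ?P (pCons 0 ?P)"] abs_Re_le_cmod[of "ip ?P (pCons 0 (pCons 0 ?P))"]
    by linarith
  also have "\<dots> \<le> 3 * (cmod (a n) + cmod (a (Suc n))) * ?N"
    using pos[of n] by (simp add: algebra_simps)
  finally show ?thesis using pos[of n] by (simp add: field_simps abs_le_iff)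
qed

end

section \<open>Continuous approximation of bounded Borel functions in two measures at once\<close>

lemma integrable_bounded_borel:
  fixes f :: "complex \<Rightarrow> real"
  assumes "circle_measure \<kappa>" "f \<in> borel_measurable borel" "\<And>z. \<bar>f z\<bar> \<le> B"
  shows "integrable \<kappa> f"
proof -
  interpret circle_measure \<kappa> by fact
  show ?thesis using assms(2,3) by (intro integrable_const_bound[of _ B]) auto
qed

lemma approx_compact_open:
  fixes \<kappa> :: "complex measure"
  assumes \<kappa>: "circle_measure \<kappa>" and A: "A \<in> sets borel" and e: "e > 0"
  obtains K U where "compact K" "open U" "K \<subseteq> A" "A \<subseteq> U" "measure \<kappa> (U - K) < e"
proof -
  interpret circle_measure \<kappa> by fact
  have fin: "emeasure \<kappa> (space \<kappa>) \<noteq> \<infinity>" by simp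
  have "emeasure \<kappa> A < ennreal (measure \<kappa> A + e/2)"
    using e by (subst emeasure_eq_measure) (simp add: ennreal_less_iff)
  then obtain U where U: "A \<subseteq> U" "open U" "emeasure \<kappa> U < ennreal (measure \<kappa> A + e/2)"
    unfolding outer_regular[OF sets_circle fin A] INF_less_iff by blast
  have "compact K \<and> K \<subseteq> A \<and> measure \<kappa> A - e/2 < measure \<kappa> K \<Longrightarrow> thesis" for K
  proof -
    assume K: "compact K \<and> K \<subseteq> A \<and> measure \<kappa> A - e/2 < measure \<kappa> K"
    have "K \<in> sets borel" using K by (simp add: compact_imp_closed)
    moreover have "measure \<kappa> U < measure \<kappa> A + e/2"
      using U(3) e by (simp add: emeasure_eq_measure ennreal_less_iff del: ennreal_plus)
    ultimately have "measure \<kappa> (U - K) < e"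
      using K U(1,2) by (subst finite_measure_Diff) auto
    then show thesis using that K U by blast
  qed
  moreover have "\<exists>K. compact K \<and> K \<subseteq> A \<and> measure \<kappa> A - e/2 < measure \<kappa> K"
  proof (cases "measure \<kappa> A = 0")
    case True
    then show ?thesis using e by (intro exI[of _ "{}"]) auto
  next
    case False
    \<comment> \<open>Clipped at 0, since \<open>ennreal\<close> is faithful only on nonnegative
      reals.\<close>
    define t where "t = max 0 (measure \<kappa> A - e/2)"
    have t: "0 \<le> t" "t < measure \<kappa> A"
      using False e measure_nonneg[of \<kappa> A] by (auto simp: t_def less_le)
    then have "ennreal t < emeasure \<kappa> A" by (simp add: emeasure_eq_measure ennreal_less_iff)
    then obtain K where K: "compact K" "K \<subseteq> A" "ennreal t < emeasure \<kappa> K"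
      unfolding inner_regular[OF sets_circle fin A] less_SUP_iff by blast
    then have "t < measure \<kappa> K" using t by (simp add: emeasure_eq_measure ennreal_less_iff)
    then have "measure \<kappa> A - e/2 < measure \<kappa> K" by (simp add: t_def)
    with K show ?thesis by blast
  qed
  ultimately show thesis by blast
qed

text \<open>One Urysohn function serves both measures: it is 1 on the union of the two compact sets
  and 0 off the intersection of the two open ones, so for either measure the error lives on its own
  difference set.\<close>

lemma approx_indicator:
  fixes \<mu> \<nu> :: "complex measure"
  assumes \<mu>: "circle_measure \<mu>" and \<nu>: "circle_measure \<nu>" and A: "A \<in> sets borel" and e: "e > 0"
  obtains g :: "complex \<Rightarrow> real" where "continuous_on UNIV g" "\<And>z. \<bar>g z\<bar> \<le> 1"
    "(\<integral>z. \<bar>indicator A z - g z\<bar> \<partial>\<mu>) < e" "(\<integral>z. \<bar>indicator A z - g z\<bar> \<partial>\<nu>) < e"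
proof -
  obtain K1 U1 where 1: "compact K1" "open U1" "K1 \<subseteq> A" "A \<subseteq> U1" "measure \<mu> (U1 - K1) < e"
    using approx_compact_open[OF \<mu> A e] by blast
  obtain K2 U2 where 2: "compact K2" "open U2" "K2 \<subseteq> A" "A \<subseteq> U2" "measure \<nu> (U2 - K2) < e"
    using approx_compact_open[OF \<nu> A e] by blast
  define K U where "K = K1 \<union> K2" and "U = U1 \<inter> U2"
  have KU: "closed K" "closed (- U)" "K \<inter> - U = {}" "K \<subseteq> A" "A \<subseteq> U" "open U"
    using 1 2 by (auto simp: K_def U_def compact_imp_closed)
  obtain g :: "complex \<Rightarrow> real" where g: "continuous_on UNIV g" "\<And>z. g z \<in> closed_segment 1 0"
      "\<And>z. z \<in> K \<Longrightarrow> g z = 1" "\<And>z. z \<in> - U \<Longrightarrow> g z = 0"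
    using Urysohn[OF KU(1-3), of 1 0] by blast
  have g01: "0 \<le> g z" "g z \<le> 1" for z using g(2)[of z] by (auto simp: closed_segment_eq_real_ivl)
  have gm [measurable]: "g \<in> borel_measurable borel" using g(1) by (rule borel_measurable_continuous_onI)
  have *: "(\<integral>z. \<bar>indicator A z - g z\<bar> \<partial>\<kappa>) < e"
    if \<kappa>: "circle_measure \<kappa>" and K': "K' \<subseteq> K" "U \<subseteq> U'" "compact K'" "open U'" "measure \<kappa> (U' - K') < e" for \<kappa> K' U'
  proof -
    interpret circle_measure \<kappa> by fact
    have s: "U' - K' \<in> sets borel" using K' by (simp add: compact_imp_closed)
    have "(\<integral>z. \<bar>indicator A z - g z\<bar> \<partial>\<kappa>) \<le> (\<integral>z. indicator (U' - K') z \<partial>\<kappa>)"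
    proof (rule integral_mono)
      show "integrable \<kappa> (\<lambda>z. \<bar>indicator A z - g z\<bar>)"
        using A g01 by (intro integrable_bounded_borel[OF \<kappa>, of _ 1]) (auto simp: indicator_def)
      show "integrable \<kappa> (indicator (U' - K') :: complex \<Rightarrow> real)"
        using s by (intro integrable_bounded_borel[OF \<kappa>, of _ 1]) (auto simp: indicator_def)
      show "\<bar>indicator A z - g z\<bar> \<le> indicator (U' - K') z" for z
        using g01[of z] g(3,4)[of z] KU(4,5) K'(1,2) by (auto simp: indicator_def)
    qed
    also have "\<dots> = measure \<kappa> (U' - K')" using s by simp
    finally show ?thesis using K' by simp
  qed
  show thesis
  proof (rule that[OF g(1)])
    show "\<bar>g z\<bar> \<le> 1" for z using g01[of z] by simp
  qed (use *[OF \<mu>, of K1 U1] *[OF \<nu>, of K2 U2] 1 2 in \<open>auto simp: K_def U_def\<close>)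
qed

text \<open>The sum counts the positive multiples of d up to x, which is the floor of x/d; the bound
  \<open>real N * d\<close> ensures that none is missed.\<close>

lemma approx_step_sum:
  fixes d :: real
  assumes "0 \<le> x" "x \<le> real N * d" "d > 0"
  shows "\<bar>x - (\<Sum>i=1..N. d * indicator {y. real i * d \<le> y} x)\<bar> \<le> d"
proof -
  define k where "k = nat \<lfloor>x / d\<rfloor>"
  have x0: "0 \<le> x / d" using assms by simp
  have "{i\<in>{1..N}. real i * d \<le> x} = {1..k}"
  proof safe
    fix i assume "i \<in> {1..N}" "real i * d \<le> x"
    then show "i \<in> {1..k}" using assms x0 by (auto simp: k_def le_nat_iff le_floor_iff field_simps)
  next
    fix i assume i: "i \<in> {1..k}"
    then have "real i \<le> x / d" using x0 by (auto simp: k_def le_nat_iff le_floor_iff)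
    then show "real i * d \<le> x" using assms by (simp add: field_simps)
    have "x / d \<le> real N" using assms by (simp add: field_simps)
    then have "real i \<le> real N" using \<open>real i \<le> x / d\<close> by linarith
    then show "i \<in> {1..N}" using i by simp
  qed
  moreover have "(\<Sum>i=1..N. d * indicator {y. real i * d \<le> y} x) = d * real (card {i\<in>{1..N}. real i * d \<le> x})"
    by (simp add: indicator_def sum.If_cases flip: sum_distrib_left) (simp add: Int_def)
  ultimately have eq: "(\<Sum>i=1..N. d * indicator {y. real i * d \<le> y} x) = d * real k" by simp
  have "real k \<le> x / d" "x / d \<le> real k + 1" using x0 by (auto simp: k_def; linarith)+
  then show ?thesis unfolding eq using assms by (simp add: field_simps abs_le_iff)
qed

text \<open>Layer cake: h is within d of a sum of N superlevel indicators of weight d. Approximating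
  each to within 1/N costs another d in total, hence d = e/2.\<close>

lemma approx_bounded:
  fixes \<mu> \<nu> :: "complex measure" and h :: "complex \<Rightarrow> real"
  assumes \<mu>: "circle_measure \<mu>" "measure \<mu> UNIV = 1" and \<nu>: "circle_measure \<nu>" "measure \<nu> UNIV = 1"
    and h: "h \<in> borel_measurable borel" "\<And>z. 0 \<le> h z" "\<And>z. h z \<le> B" and e: "e > 0"
  obtains g :: "complex \<Rightarrow> real" where "continuous_on UNIV g"
    "(\<integral>z. \<bar>h z - g z\<bar> \<partial>\<mu>) < e" "(\<integral>z. \<bar>h z - g z\<bar> \<partial>\<nu>) < e"
proof -
  define d where "d = e / 2"
  have d: "d > 0" using e by (simp add: d_def)
  obtain N where N: "B / d < real N" using reals_Archimedean2 by blast
  then have B: "B \<le> real N * d" using d by (simp add: field_simps)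
  have "0 \<le> B / d" using h(2)[of 0] h(3)[of 0] d by simp
  then have N0: "N > 0" using N by linarith
  define A where "A i = {z. real i * d \<le> h z}" for i
  have A: "A i \<in> sets borel" for i unfolding A_def using h(1) by measurable
  have "\<exists>g::complex\<Rightarrow>real. continuous_on UNIV g \<and> (\<forall>z. \<bar>g z\<bar> \<le> 1) \<and>
    (\<integral>z. \<bar>indicator (A i) z - g z\<bar> \<partial>\<mu>) < 1 / real N \<and> (\<integral>z. \<bar>indicator (A i) z - g z\<bar> \<partial>\<nu>) < 1 / real N" for i
  proof -
    have "1 / real N > 0" using N0 by simp
    from approx_indicator[OF \<mu>(1) \<nu>(1) A[of i] this] show ?thesis by blast
  qed
  then obtain g :: "nat \<Rightarrow> complex \<Rightarrow> real" where g: "\<And>i. continuous_on UNIV (g i)" "\<And>i z. \<bar>g i z\<bar> \<le> 1"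
    "\<And>i. (\<integral>z. \<bar>indicator (A i) z - g i z\<bar> \<partial>\<mu>) < 1 / real N" "\<And>i. (\<integral>z. \<bar>indicator (A i) z - g i z\<bar> \<partial>\<nu>) < 1 / real N"
    by metis
  define G where "G z = (\<Sum>i=1..N. d * g i z)" for z
  have Gc: "continuous_on UNIV G" unfolding G_def by (intro continuous_intros g)
  have *: "(\<integral>z. \<bar>h z - G z\<bar> \<partial>\<kappa>) < e"
    if \<kappa>: "circle_measure \<kappa>" "measure \<kappa> UNIV = 1"
      and gi: "\<And>i. (\<integral>z. \<bar>indicator (A i) z - g i z\<bar> \<partial>\<kappa>) < 1 / real N" for \<kappa>
  proof -
    interpret circle_measure \<kappa> by fact
    have gm: "g i \<in> borel_measurable borel" for i using g(1) by (rule borel_measurable_continuous_onI)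
    have ii: "integrable \<kappa> (\<lambda>z. \<bar>indicator (A i) z - g i z\<bar>)" for i
    proof (rule integrable_bounded_borel[OF \<kappa>(1)])
      show "\<bar>\<bar>indicator (A i) z - g i z\<bar>\<bar> \<le> 2" for z using g(2)[of i z] by (auto simp: indicator_def)
    qed (use A gm in auto)
    have "integrable \<kappa> h" using h by (intro integrable_bounded_borel[OF \<kappa>(1), of _ B]) auto
    moreover have "integrable \<kappa> G" by (rule integrable_continuous[OF Gc])
    ultimately have hG: "integrable \<kappa> (\<lambda>z. \<bar>h z - G z\<bar>)" by simp
    have "(\<integral>z. \<bar>h z - G z\<bar> \<partial>\<kappa>) \<le> (\<integral>z. d + (\<Sum>i=1..N. d * \<bar>indicator (A i) z - g i z\<bar>) \<partial>\<kappa>)"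
    proof (rule integral_mono[OF hG])
      show "integrable \<kappa> (\<lambda>z. d + (\<Sum>i=1..N. d * \<bar>indicator (A i) z - g i z\<bar>))" using ii by auto
      fix z
      have "\<bar>h z - (\<Sum>i=1..N. d * indicator {y. real i * d \<le> y} (h z))\<bar> \<le> d"
        using h(2,3)[of z] B d by (intro approx_step_sum) auto
      moreover have "(\<Sum>i=1..N. d * indicator {y. real i * d \<le> y} (h z)) = (\<Sum>i=1..N. d * indicator (A i) z)"
        by (simp add: A_def indicator_def)
      moreover have "\<bar>(\<Sum>i=1..N. d * indicator (A i) z) - G z\<bar> \<le> (\<Sum>i=1..N. d * \<bar>indicator (A i) z - g i z\<bar>)"
        unfolding G_def sum_subtractf[symmetric] right_diff_distrib[symmetric]
        using d by (intro order.trans[OF sum_abs]) (simp add: abs_mult)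
      ultimately show "\<bar>h z - G z\<bar> \<le> d + (\<Sum>i=1..N. d * \<bar>indicator (A i) z - g i z\<bar>)" by linarith
    qed
    also have "\<dots> = d + (\<Sum>i=1..N. d * (\<integral>z. \<bar>indicator (A i) z - g i z\<bar> \<partial>\<kappa>))"
      using ii \<kappa> by simp
    also have "(\<Sum>i=1..N. d * (\<integral>z. \<bar>indicator (A i) z - g i z\<bar> \<partial>\<kappa>)) < (\<Sum>i=1..N. d * (1 / real N))"
      using d gi N0 by (intro sum_strict_mono mult_strict_left_mono) auto
    also have "(\<Sum>i=1..N. d * (1 / real N)) = d" using N0 by simp
    finally show ?thesis by (simp add: d_def)
  qed
  show thesis
    using *[OF \<mu> g(3)] *[OF \<nu> g(4)] by (intro that[OF Gc])
qed

lemma continuous_on_Qw_ln: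
  assumes "continuous_on UNIV g" "\<And>z. (0::real) < g z"
  shows "continuous_on UNIV (\<lambda>z. Qw z * ln (g z))"
  using assms by (intro continuous_on_mult continuous_on_Qw continuous_on_ln) (auto simp: less_imp_neq[symmetric])

lemma abs_ln_diff_le:
  fixes x y c :: real
  assumes "c > 0" "x \<ge> c" "y \<ge> c"
  shows "\<bar>ln x - ln y\<bar> \<le> \<bar>x - y\<bar> / c"
proof -
  have *: "ln u - ln v \<le> \<bar>u - v\<bar> / c" if "u \<ge> c" "v \<ge> c" for u v
  proof -
    have "ln u - ln v = ln (u / v)" using that assms(1) by (simp add: ln_div)
    also have "\<dots> \<le> u / v - 1" using that assms(1) by (intro ln_le_minus_one) auto
    also have "\<dots> = (u - v) / v" using that assms(1) by (simp add: field_simps)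
    also have "\<dots> \<le> \<bar>u - v\<bar> / v" using that assms(1) by (intro divide_right_mono) auto
    also have "\<dots> \<le> \<bar>u - v\<bar> / c" using that assms(1) by (intro divide_left_mono) auto
    finally show ?thesis .
  qed
  from *[OF assms(2,3)] *[OF assms(3,2)] show ?thesis by (simp add: abs_minus_commute abs_le_iff)
qed

lemma integral_Qw_bound:
  assumes \<kappa>: "circle_measure \<kappa>" and f: "f \<in> borel_measurable borel" and u: "u \<in> borel_measurable borel"
    and i: "integrable \<kappa> f" and fu: "\<And>z. \<bar>u z\<bar> \<le> f z"
  shows "\<bar>\<integral>z. Qw z * u z \<partial>\<kappa>\<bar> \<le> 4 * (\<integral>z. f z \<partial>\<kappa>)" "integrable \<kappa> (\<lambda>z. Qw z * u z)"
proof -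
  interpret K: circle_measure \<kappa> by fact
  have AE: "AE z in \<kappa>. norm (Qw z * u z) \<le> 4 * f z"
    using K.AE_circle
  proof (rule eventually_mono)
    fix z :: complex assume "cmod z = 1"
    then show "norm (Qw z * u z) \<le> 4 * f z"
      using Qw_le_4[of z] fu[of z] by (simp add: abs_mult mult_mono)
  qed
  show iq: "integrable \<kappa> (\<lambda>z. Qw z * u z)"
  proof (rule Bochner_Integration.integrable_bound[of _ "\<lambda>z. 4 * f z"])
    show "AE z in \<kappa>. norm (Qw z * u z) \<le> norm (4 * f z)"
      using AE by (rule eventually_mono) (use fu in \<open>simp add: order.trans[OF abs_ge_zero]\<close>)
  qed (use i u in auto)
  have "\<bar>\<integral>z. Qw z * u z \<partial>\<kappa>\<bar> \<le> (\<integral>z. \<bar>Qw z * u z\<bar> \<partial>\<kappa>)" by (rule integral_abs_bound)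
  also have "\<dots> \<le> (\<integral>z. 4 * f z \<partial>\<kappa>)" using AE iq i by (intro integral_mono_AE) auto
  finally show "\<bar>\<integral>z. Qw z * u z \<partial>\<kappa>\<bar> \<le> 4 * (\<integral>z. f z \<partial>\<kappa>)" by simp
qed

text \<open>Small w gives w/v <= 1, in the middle range v = w, and for w > M the quotient w/v is w/M
  itself while ln M < ln w. The loss w/M has small integral for large M.\<close>

lemma truncated_ln_bound:
  fixes M w :: real
  assumes M: "M \<ge> 1" and w: "w \<ge> 0"
  defines "v \<equiv> max (1 / M) (min M w)"
  shows "w * (1 / v) - 1 + ln v \<le> ln (max w (1 / M)) + w / M"
proof -
  have M0: "M > 0" "1 / M \<le> M" using M by (auto simp: field_simps power2_eq_square[symmetric])
  consider "w \<le> 1 / M" | "1 / M \<le> w" "w \<le> M" | "M < w" by linarith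
  then show ?thesis
  proof cases
    case 1
    then have "v = 1 / M" using M0 by (auto simp: v_def max_def min_def)
    moreover have "w * M \<le> 1" using 1 M0 by (simp add: field_simps)
    moreover have "w / M \<ge> 0" using w M0 by simp
    ultimately show ?thesis using 1 by (simp add: max_def)
  next
    case 2
    then have "v = w" "w > 0" using M0 by (auto simp: v_def max_def min_def intro: less_le_trans[of 0 "1/M"])
    then show ?thesis using 2 M0 by (simp add: max_def)
  next
    case 3
    then have "v = M" using M0 by (auto simp: v_def max_def min_def)
    moreover have "ln M \<le> ln w" using 3 M0 by simp
    moreover have "max w (1 / M) = w" using 3 M0 by (simp add: max_def)
    ultimately show ?thesis by simp
  qed
qed

section \<open>The lower bound\<close>

context circle_decomposition
begin

lemma entropy_limit_le_continuous:
  assumes a: "\<forall>k. cmod (a k) < 1" and o: "\<And>n. orth (Phi a n) n"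
    and R: "(\<lambda>n. \<integral>z. Qw z * ln (bs_weight a n z) \<partial>arc_measure) \<longlonglongrightarrow> R"
    and g: "continuous_on UNIV g" "\<And>z. g z > 0"
  shows "R \<le> (\<integral>z. Qw z * g z \<partial>\<mu>) - 3/2 - (\<integral>z. Qw z * ln (g z) \<partial>arc_measure)"
proof (rule LIMSEQ_le[OF R])
  have c: "continuous_on UNIV (\<lambda>z. Qw z * g z)" "continuous_on UNIV (\<lambda>z. Qw z * ln (g z))"
    by (intro continuous_intros g(1)) (rule continuous_on_Qw_ln[OF g])
  then have gm: "(\<lambda>z. Qw z * g z) \<in> borel_measurable borel" by (intro borel_measurable_continuous_onI)
  show "(\<lambda>n. (\<integral>z. (Qw z * g z) * bs_weight a n z \<partial>arc_measure) - 3/2 - (\<integral>z. Qw z * ln (g z) \<partial>arc_measure))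
      \<longlonglongrightarrow> (\<integral>z. Qw z * g z \<partial>\<mu>) - 3/2 - (\<integral>z. Qw z * ln (g z) \<partial>arc_measure)"
    by (intro tendsto_intros bs_weak_convergence[OF circle_measure_axioms prob a o c(1)])
  have "(\<integral>z. Qw z * ln (bs_weight a n z) \<partial>arc_measure) \<le>
      (\<integral>z. (Qw z * g z) * bs_weight a n z \<partial>arc_measure) - 3/2 - (\<integral>z. Qw z * ln (g z) \<partial>arc_measure)" for n
  proof -
    have i1: "integrable arc_measure (\<lambda>z. (Qw z * g z) * bs_weight a n z)"
      using gm by (intro arc.integrable_circle continuous_on_mult continuous_on_bs_weight[OF a] continuous_on_subset[OF c(1)]) auto
    have i2: "integrable arc_measure (\<lambda>z. Qw z * ln (g z))" by (rule arc.integrable_continuous[OF c(2)])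
    have i3: "integrable arc_measure Qw" by (intro arc.integrable_continuous continuous_intros)
    have "(\<integral>z. Qw z * ln (bs_weight a n z) \<partial>arc_measure) \<le>
      (\<integral>z. (Qw z * g z) * bs_weight a n z - Qw z - Qw z * ln (g z) \<partial>arc_measure)"
    proof (rule integral_mono_AE[OF integrable_Qw_ln_bs[OF a]])
      show "AE z in arc_measure. Qw z * ln (bs_weight a n z) \<le>
          (Qw z * g z) * bs_weight a n z - Qw z - Qw z * ln (g z)"
        using arc.AE_circle
      proof (rule eventually_mono)
        fix z :: complex assume "cmod z = 1"
        then have b: "bs_weight a n z > 0" by (rule bs_weight_pos[OF a])
        have "ln (g z * bs_weight a n z) \<le> g z * bs_weight a n z - 1"
          using b g(2)[of z] by (intro ln_le_minus_one) auto
        then have "ln (bs_weight a n z) \<le> g z * bs_weight a n z - 1 - ln (g z)"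
          using b g(2)[of z] by (simp add: ln_mult_pos)
        then have "Qw z * ln (bs_weight a n z) \<le> Qw z * (g z * bs_weight a n z - 1 - ln (g z))"
          by (rule mult_left_mono) simp
        then show "Qw z * ln (bs_weight a n z) \<le> (Qw z * g z) * bs_weight a n z - Qw z - Qw z * ln (g z)"
          by (simp add: algebra_simps)
      qed
    qed (use i1 i2 i3 in simp)
    also have "\<dots> = (\<integral>z. (Qw z * g z) * bs_weight a n z \<partial>arc_measure) - 3/2 - (\<integral>z. Qw z * ln (g z) \<partial>arc_measure)"
      using i1 i2 i3 by (simp add: integral_Qw)
    finally show ?thesis .
  qed
  then show "\<exists>N. \<forall>n\<ge>N. (\<integral>z. Qw z * ln (bs_weight a n z) \<partial>arc_measure) \<le>
      (\<integral>z. (Qw z * g z) * bs_weight a n z \<partial>arc_measure) - 3/2 - (\<integral>z. Qw z * ln (g z) \<partial>arc_measure)" by blast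
qed

text \<open>The logarithm is Lipschitz with constant 1/c above c, so closeness in both measures
  carries over to both integrals.\<close>

lemma entropy_limit_le_borel:
  assumes a: "\<forall>k. cmod (a k) < 1" and o: "\<And>n. orth (Phi a n) n"
    and R: "(\<lambda>n. \<integral>z. Qw z * ln (bs_weight a n z) \<partial>arc_measure) \<longlonglongrightarrow> R"
    and h: "h \<in> borel_measurable borel" "\<And>z. c \<le> h z" "\<And>z. h z \<le> B" and c: "c > 0"
  shows "R \<le> (\<integral>z. Qw z * h z \<partial>\<mu>) - 3/2 - (\<integral>z. Qw z * ln (h z) \<partial>arc_measure)"
proof (rule field_le_epsilon)
  fix e :: real assume e: "e > 0"
  \<comment> \<open>As Q is at most 4, the two integrals move by at most 4d and 4d/c, each no more
    than e/2.\<close>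
  define d where "d = min (e / 8) (c * e / 8)"
  have d: "d > 0" "4 * d \<le> e / 2" "4 * (d / c) \<le> e / 2" using e c by (auto simp: d_def min_def field_simps)
  have h0: "0 \<le> h z" for z using h(2)[of z] c by linarith
  obtain g0 where g0: "continuous_on UNIV g0" "(\<integral>z. \<bar>h z - g0 z\<bar> \<partial>\<mu>) < d" "(\<integral>z. \<bar>h z - g0 z\<bar> \<partial>arc_measure) < d"
    using approx_bounded[OF circle_measure_axioms prob circle_measure_arc measure_arc_UNIV h(1) h0 h(3) d(1)] by blast
  \<comment> \<open>Raising the approximant to c makes its logarithm controllable and, since h >= c,
    only brings it closer to h.\<close>
  define g where "g z = max c (g0 z)" for z
  have g: "continuous_on UNIV g" "\<And>z. c \<le> g z" unfolding g_def by (intro continuous_intros g0) auto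
  then have gpos: "g z > 0" for z using c less_le_trans by blast
  have gm: "g \<in> borel_measurable borel" "g0 \<in> borel_measurable borel"
    using g g0 by (auto intro: borel_measurable_continuous_onI)
  have closer: "\<bar>h z - g z\<bar> \<le> \<bar>h z - g0 z\<bar>" for z using h(2)[of z] by (auto simp: g_def max_def)
  have hi: "integrable \<kappa> h" "integrable \<kappa> g" "integrable \<kappa> g0" if "circle_measure \<kappa>" for \<kappa>
  proof -
    interpret K: circle_measure \<kappa> by fact
    show "integrable \<kappa> h" using h h0 by (intro integrable_bounded_borel[OF that, of _ B]) auto
    show "integrable \<kappa> g" "integrable \<kappa> g0" by (intro K.integrable_continuous g g0)+
  qed
  have close: "(\<integral>z. \<bar>h z - g z\<bar> \<partial>\<kappa>) \<le> d"
    if "circle_measure \<kappa>" "(\<integral>z. \<bar>h z - g0 z\<bar> \<partial>\<kappa>) < d" for \<kappa>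
  proof -
    have "(\<integral>z. \<bar>h z - g z\<bar> \<partial>\<kappa>) \<le> (\<integral>z. \<bar>h z - g0 z\<bar> \<partial>\<kappa>)"
      using hi[OF that(1)] closer by (intro integral_mono) auto
    with that(2) show ?thesis by simp
  qed
  have i1: "integrable \<mu> (\<lambda>z. Qw z * g z)" "integrable arc_measure (\<lambda>z. Qw z * ln (g z))"
    by (intro integrable_continuous continuous_intros g(1))
       (rule arc.integrable_continuous[OF continuous_on_Qw_ln[OF g(1) gpos]])
  note \<mu> = circle_measure_axioms
  have 1: "\<bar>\<integral>z. Qw z * (h z - g z) \<partial>\<mu>\<bar> \<le> 4 * (\<integral>z. \<bar>h z - g z\<bar> \<partial>\<mu>)" "integrable \<mu> (\<lambda>z. Qw z * (h z - g z))"
    using hi[OF \<mu>] gm h by (intro integral_Qw_bound[OF \<mu>]; auto)+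
  have 2: "\<bar>\<integral>z. Qw z * (ln (h z) - ln (g z)) \<partial>arc_measure\<bar> \<le> 4 * (\<integral>z. \<bar>h z - g z\<bar> / c \<partial>arc_measure)"
    "integrable arc_measure (\<lambda>z. Qw z * (ln (h z) - ln (g z)))"
  proof -
    have le: "\<bar>ln (h z) - ln (g z)\<bar> \<le> \<bar>h z - g z\<bar> / c" for z
      by (rule abs_ln_diff_le[OF c h(2) g(2)])
    then show "\<bar>\<integral>z. Qw z * (ln (h z) - ln (g z)) \<partial>arc_measure\<bar> \<le> 4 * (\<integral>z. \<bar>h z - g z\<bar> / c \<partial>arc_measure)"
      "integrable arc_measure (\<lambda>z. Qw z * (ln (h z) - ln (g z)))"
      using hi[OF circle_measure_arc] gm h g c
      by (intro integral_Qw_bound[OF circle_measure_arc, of "\<lambda>z. \<bar>h z - g z\<bar> / c"]; auto intro: le)+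
  qed
  have "(\<integral>z. Qw z * h z \<partial>\<mu>) = (\<integral>z. Qw z * g z + Qw z * (h z - g z) \<partial>\<mu>)" by (simp add: algebra_simps)
  also have "\<dots> = (\<integral>z. Qw z * g z \<partial>\<mu>) + (\<integral>z. Qw z * (h z - g z) \<partial>\<mu>)"
    using i1 1 by (intro Bochner_Integration.integral_add)
  finally have A: "(\<integral>z. Qw z * h z \<partial>\<mu>) = (\<integral>z. Qw z * g z \<partial>\<mu>) + (\<integral>z. Qw z * (h z - g z) \<partial>\<mu>)" .
  have "(\<integral>z. Qw z * ln (h z) \<partial>arc_measure) = (\<integral>z. Qw z * ln (g z) + Qw z * (ln (h z) - ln (g z)) \<partial>arc_measure)"
    by (simp add: algebra_simps)
  also have "\<dots> = (\<integral>z. Qw z * ln (g z) \<partial>arc_measure) + (\<integral>z. Qw z * (ln (h z) - ln (g z)) \<partial>arc_measure)"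
    using i1 2 by (intro Bochner_Integration.integral_add)
  finally have B: "(\<integral>z. Qw z * ln (h z) \<partial>arc_measure) =
    (\<integral>z. Qw z * ln (g z) \<partial>arc_measure) + (\<integral>z. Qw z * (ln (h z) - ln (g z)) \<partial>arc_measure)" .
  have "(\<integral>z. \<bar>h z - g z\<bar> / c \<partial>arc_measure) \<le> d / c"
    using close[OF circle_measure_arc g0(3)] c by (simp add: divide_right_mono)
  then show "R \<le> (\<integral>z. Qw z * h z \<partial>\<mu>) - 3/2 - (\<integral>z. Qw z * ln (h z) \<partial>arc_measure) + e"
    using entropy_limit_le_continuous[OF a o R g(1) gpos] A B 1 2 close[OF \<mu> g0(2)] d by linarith
qed

text \<open>Arc length does not see \<open>S\<close>, so there the test function can be 1/M, at a
  cost of at most 4/M in \<mu>. The other 4/M is the loss in \<open>truncated_ln_bound\<close>,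
  integrated against Q.\<close>

lemma entropy_limit_le_truncated:
  assumes a: "\<forall>k. cmod (a k) < 1" and o: "\<And>n. orth (Phi a n) n"
    and R: "(\<lambda>n. \<integral>z. Qw z * ln (bs_weight a n z) \<partial>arc_measure) \<longlonglongrightarrow> R"
    and M: "M \<ge> 1"
    and i: "integrable arc_measure (\<lambda>z. Qw z * ln (max (W z) (1 / M)))"
  shows "R \<le> (\<integral>z. Qw z * ln (max (W z) (1 / M)) \<partial>arc_measure) + 8 / M"
proof -
  define V where "V z = max (1 / M) (min M (W z))" for z
  define h where "h z = (if z \<in> S then 1 / M else 1 / V z)" for z
  have M0: "M > 0" "1 / M \<le> M" using M by (auto simp: field_simps power2_eq_square[symmetric])
  have V: "1 / M \<le> V z" "V z \<le> M" "V z > 0" for z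
    using M0 less_le_trans[of 0 "1/M" "V z"] by (auto simp: V_def)
  have Vm [measurable]: "V \<in> borel_measurable borel" unfolding V_def by measurable
  have hm: "h \<in> borel_measurable borel" unfolding h_def by measurable
  have V': "1 / M \<le> 1 / V z" "1 / V z \<le> M" for z
    using V[of z] M0 by (auto simp: field_simps)
  have h: "1 / M \<le> h z" "h z \<le> M" for z
    using V'[of z] M0 by (auto simp: h_def)
  have habs: "\<bar>h z\<bar> \<le> M" for z
    using h[of z] M0 by (smt (verit) divide_nonneg_pos)
  have "R \<le> (\<integral>z. Qw z * h z \<partial>\<mu>) - 3/2 - (\<integral>z. Qw z * ln (h z) \<partial>arc_measure)"
    by (rule entropy_limit_le_borel[OF a o R hm h]) (use M0 in auto)
  also have "(\<integral>z. Qw z * ln (h z) \<partial>arc_measure) = (\<integral>z. - (Qw z * ln (V z)) \<partial>arc_measure)"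
    by (rule integral_cong_AE) (use hm V S_null in \<open>auto simp: h_def ln_div less_imp_neq[symmetric] elim!: eventually_mono\<close>)
  also have "\<dots> = - (\<integral>z. Qw z * ln (V z) \<partial>arc_measure)" by simp
  also have "(\<integral>z. Qw z * h z \<partial>\<mu>) \<le> 4 / M + (\<integral>z. Qw z * (W z * (1 / V z)) \<partial>arc_measure)"
  proof -
    let ?f = "\<lambda>z. Qw z * (1 / V z)"
    have fm: "?f \<in> borel_measurable borel" by measurable
    have fb: "\<bar>?f z\<bar> \<le> 4 * M" if "cmod z = 1" for z
      using Qw_le_4[OF that] V'[of z] V[of z] M0 by (auto simp: abs_mult intro!: mult_mono simp del: times_divide_eq_right)
    have i': "integrable \<mu> (\<lambda>z. indicator (- S) z * ?f z)"
      using integrable_W[OF fm fb] integrable_W_iff[OF fm] by simp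
    have "(\<integral>z. Qw z * h z \<partial>\<mu>) \<le> (\<integral>z. 4 / M + indicator (- S) z * ?f z \<partial>\<mu>)"
    proof (rule integral_mono_AE)
      show "integrable \<mu> (\<lambda>z. Qw z * h z)"
        using hm habs by (intro integral_Qw_bound(2)[OF circle_measure_axioms, of "\<lambda>_. M"]
            integrable_bounded_borel[OF circle_measure_axioms hm]) auto
      show "integrable \<mu> (\<lambda>z. 4 / M + indicator (- S) z * ?f z)" using i' by simp
      show "AE z in \<mu>. Qw z * h z \<le> 4 / M + indicator (- S) z * ?f z"
        using AE_circle
      proof (rule eventually_mono)
        fix z :: complex assume "cmod z = 1"
        then have "Qw z / M \<le> 4 / M" using Qw_le_4[of z] M0 by (intro divide_right_mono) auto
        then show "Qw z * h z \<le> 4 / M + indicator (- S) z * ?f z"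
          using M0 by (auto simp: h_def indicator_def)
      qed
    qed
    also have "\<dots> = 4 / M + (\<integral>z. indicator (- S) z * ?f z \<partial>\<mu>)" using i' prob by simp
    also have "(\<integral>z. indicator (- S) z * ?f z \<partial>\<mu>) = (\<integral>z. W z * ?f z \<partial>arc_measure)"
      by (rule integral_W[OF fm, symmetric])
    finally show ?thesis by (simp add: ac_simps)
  qed
  finally have le: "R \<le> 4 / M + (\<integral>z. Qw z * (W z * (1 / V z)) \<partial>arc_measure) - 3/2 - - (\<integral>z. Qw z * ln (V z) \<partial>arc_measure)"
    by simp
  have eq: "integrable arc_measure (\<lambda>z. Qw z * (W z * (1 / V z)) - Qw z + Qw z * ln (V z))"
    "(\<integral>z. Qw z * (W z * (1 / V z)) \<partial>arc_measure) - 3/2 - - (\<integral>z. Qw z * ln (V z) \<partial>arc_measure)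
     = (\<integral>z. Qw z * (W z * (1 / V z)) - Qw z + Qw z * ln (V z) \<partial>arc_measure)"
  proof -
    have fm: "(\<lambda>z. Qw z * (1 / V z)) \<in> borel_measurable borel" by measurable
    have "\<bar>Qw z * (1 / V z)\<bar> \<le> 4 * M" if "cmod z = 1" for z
      using Qw_le_4[OF that] V'[of z] V[of z] M0 by (auto simp: abs_mult intro!: mult_mono simp del: times_divide_eq_right)
    from integrable_W[OF fm this] have 1: "integrable arc_measure (\<lambda>z. Qw z * (W z * (1 / V z)))"
      by (simp add: ac_simps)
    have 2: "integrable arc_measure Qw" by (intro arc.integrable_continuous continuous_intros)
    have "\<bar>ln (V z)\<bar> \<le> ln M" for z
    proof -
      have "ln (V z) \<le> ln M" using V[of z] by simp
      moreover have "ln (1 / M) \<le> ln (V z)" using V[of z] M0 by (subst ln_le_cancel_iff) auto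
      ultimately show ?thesis using M0 by (simp add: ln_div)
    qed
    then have 3: "integrable arc_measure (\<lambda>z. Qw z * ln (V z))"
      by (intro integral_Qw_bound(2)[OF circle_measure_arc, of "\<lambda>_. ln M"]) auto
    show "integrable arc_measure (\<lambda>z. Qw z * (W z * (1 / V z)) - Qw z + Qw z * ln (V z))"
      "(\<integral>z. Qw z * (W z * (1 / V z)) \<partial>arc_measure) - 3/2 - - (\<integral>z. Qw z * ln (V z) \<partial>arc_measure)
       = (\<integral>z. Qw z * (W z * (1 / V z)) - Qw z + Qw z * ln (V z) \<partial>arc_measure)"
      using 1 2 3 by (simp_all add: integral_Qw)
  qed
  have iW: "integrable arc_measure (\<lambda>z. W z * Qw z)" using Qw_le_4 by (intro integrable_W[of Qw 4]) auto
  have "(\<integral>z. Qw z * (W z * (1 / V z)) - Qw z + Qw z * ln (V z) \<partial>arc_measure) \<le>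
     (\<integral>z. Qw z * ln (max (W z) (1 / M)) + W z * Qw z / M \<partial>arc_measure)"
  proof (intro integral_mono eq(1))
    fix z
    have "Qw z * (W z * (1 / V z) - 1 + ln (V z)) \<le> Qw z * (ln (max (W z) (1 / M)) + W z / M)"
      using truncated_ln_bound[OF M W_nonneg[of z]] by (intro mult_left_mono) (auto simp: V_def)
    then show "Qw z * (W z * (1 / V z)) - Qw z + Qw z * ln (V z) \<le> Qw z * ln (max (W z) (1 / M)) + W z * Qw z / M"
      by (simp add: algebra_simps)
  qed (use i iW in simp)
  also have "(\<integral>z. Qw z * ln (max (W z) (1 / M)) + W z * Qw z / M \<partial>arc_measure) \<le>
      (\<integral>z. Qw z * ln (max (W z) (1 / M)) \<partial>arc_measure) + 4 / M"
  proof -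
    have "(\<integral>z. W z * Qw z \<partial>arc_measure) \<le> (\<integral>z. Qw z \<partial>\<mu>)"
      using Qw_le_4 by (intro integral_W_le[of Qw 4]) auto
    also have "\<dots> \<le> (\<integral>z. 4 \<partial>\<mu>)"
      using AE_circle by (intro integral_mono_AE integrable_continuous continuous_intros) (auto elim!: eventually_mono intro: Qw_le_4)
    finally have "(\<integral>z. W z * Qw z \<partial>arc_measure) \<le> 4" using prob by simp
    then show ?thesis using i iW M0 by (simp add: divide_right_mono)
  qed
  finally show ?thesis using le eq(2) by simp
qed

text \<open>The truncation level is removed by Fatou applied to the negative parts; the positive
  part is integrable because ln W <= W.\<close>

lemma entropy_ge:
  assumes a: "\<forall>k. cmod (a k) < 1" and o: "\<And>n. orth (Phi a n) n"
    and R: "(\<lambda>n. \<integral>z. Qw z * ln (bs_weight a n z) \<partial>arc_measure) \<longlonglongrightarrow> R"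
  shows "ereal R \<le> ext_integral arc_measure (\<lambda>z. ereal (Qw z) * elog (W z))"
proof -
  \<comment> \<open>Where \<open>W z = 0\<close>, the default \<open>ln 0 = 0\<close> yields 0,
    which is the right positive part of -infinity.\<close>
  define p where "p z = Qw z * max 0 (ln (W z))" for z
  define q where "q k z = Qw z * max 0 (- ln (max (W z) (1 / real (Suc k))))" for k z
  have [measurable]: "p \<in> borel_measurable borel" "q k \<in> borel_measurable borel" for k
    unfolding p_def q_def by measurable
  have iW: "integrable arc_measure (\<lambda>z. W z * Qw z)" using Qw_le_4 by (intro integrable_W[of Qw 4]) auto
  have p0: "p z \<ge> 0" and q0: "q k z \<ge> 0" for k z by (simp_all add: p_def q_def)
  have "max 0 (ln (W z)) \<le> W z" for z
    using ln_le_minus_one[of "W z"] W_nonneg[of z] by (cases "W z = 0") auto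
  then have "p z \<le> W z * Qw z" for z
    unfolding p_def by (subst mult.commute[of "W z"]) (intro mult_left_mono; simp)
  then have ip: "integrable arc_measure p"
    using p0 by (intro Bochner_Integration.integrable_bound[OF iW]) (auto intro!: AE_I2 simp: W_nonneg)
  have iq: "integrable arc_measure (q k)" for k
  proof -
    have "max 0 (- ln (max (W z) (1 / real (Suc k)))) \<le> ln (real (Suc k))" for z
    proof -
      have "ln (1 / real (Suc k)) \<le> ln (max (W z) (1 / real (Suc k)))"
        by (subst ln_le_cancel_iff) (auto simp: less_max_iff_disj)
      then show ?thesis by (simp add: ln_div)
    qed
    then show ?thesis unfolding q_def
      by (intro integral_Qw_bound(2)[OF circle_measure_arc, of "\<lambda>_. ln (real (Suc k))"]) auto
  qed
  \<comment> \<open>Since 1/(k+1) <= 1, truncation touches the negative part only, and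
    \<open>p\<close> is the same for all k.\<close>
  have pq: "Qw z * ln (max (W z) (1 / real (Suc k))) = p z - q k z" for z k
  proof -
    have "ln (max (W z) (1 / real (Suc k))) = max 0 (ln (W z)) - max 0 (- ln (max (W z) (1 / real (Suc k))))"
    proof (cases "W z \<ge> 1")
      case True
      moreover have "1 / real (Suc k) \<le> 1" by simp
      ultimately have "max (W z) (1 / real (Suc k)) = W z" by linarith
      with True show ?thesis by simp
    next
      case False
      then have "max (W z) (1 / real (Suc k)) \<le> 1" "max (W z) (1 / real (Suc k)) > 0"
        by (auto simp: less_max_iff_disj)
      then have "ln (max (W z) (1 / real (Suc k))) \<le> 0" by (simp only: ln_le_zero_iff)
      moreover have "ln (W z) \<le> 0" using False W_nonneg[of z] by (cases "W z = 0") auto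
      ultimately show ?thesis by simp
    qed
    then show ?thesis unfolding p_def q_def right_diff_distrib[symmetric]
      by (rule arg_cong[of _ _ "times (Qw z)"])
  qed
  define C where "C = (\<integral>z. p z \<partial>arc_measure) - R"
  have qC: "(\<integral>z. q k z \<partial>arc_measure) \<le> C + 8 / real (Suc k)" for k
  proof -
    have "R \<le> (\<integral>z. Qw z * ln (max (W z) (1 / real (Suc k))) \<partial>arc_measure) + 8 / real (Suc k)"
      using ip iq by (intro entropy_limit_le_truncated[OF a o R]) (simp_all add: pq del: of_nat_Suc)
    also have "(\<integral>z. Qw z * ln (max (W z) (1 / real (Suc k))) \<partial>arc_measure) =
        (\<integral>z. p z \<partial>arc_measure) - (\<integral>z. q k z \<partial>arc_measure)"
      unfolding pq using ip iq by (rule Bochner_Integration.integral_diff)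
    finally show ?thesis by (simp add: C_def)
  qed
  have lim: "(\<lambda>k. C + 8 / real (Suc k)) \<longlonglongrightarrow> C"
    using tendsto_add[OF tendsto_const[of C] tendsto_mult[OF tendsto_const[of 8] LIMSEQ_inverse_real_of_nat]]
    by (simp add: divide_inverse)
  \<comment> \<open>Nonnegativity of \<open>C\<close> is needed for \<open>ennreal C\<close> to
    represent it below.\<close>
  have "0 \<le> C + 8 / real (Suc k)" for k
    using order.trans[OF Bochner_Integration.integral_nonneg qC[of k]] q0 by blast
  then have C0: "0 \<le> C" using LIMSEQ_le_const[OF lim] by blast
  have P: "(\<integral>\<^sup>+z. e2ennreal (ereal (Qw z) * elog (W z)) \<partial>arc_measure) = ennreal (\<integral>z. p z \<partial>arc_measure)"
  proof -
    have "e2ennreal (ereal (Qw z) * elog (W z)) = ennreal (p z)" for z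
    proof (cases "W z > 0")
      case True
      then have "e2ennreal (ereal (Qw z) * elog (W z)) = ennreal (Qw z * ln (W z))"
        by (simp add: elog_def e2ennreal_ereal)
      also have "\<dots> = ennreal (p z)"
        by (cases "ln (W z) \<ge> 0") (auto simp: p_def max_def ennreal_neg mult_nonneg_nonpos)
      finally show ?thesis .
    next
      case False
      then have "W z = 0" using W_nonneg[of z] by simp
      moreover have "Qw z = 0 \<or> Qw z > 0" using Qw_nonneg[of z] by linarith
      ultimately show ?thesis by (auto simp: elog_def p_def e2ennreal_neg)
    qed
    then show ?thesis using ip p0 by (simp add: nn_integral_eq_integral)
  qed
  have N: "(\<integral>\<^sup>+z. e2ennreal (- (ereal (Qw z) * elog (W z))) \<partial>arc_measure) \<le> ennreal C"
  proof -
    \<comment> \<open>The sequence is eventually constant where W > 0; where W = 0 it is Q ln(k+1),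
      which is 0 or tends to infinity according to Q.\<close>
    have "(\<lambda>k. ennreal (q k z)) \<longlonglongrightarrow> e2ennreal (- (ereal (Qw z) * elog (W z)))" for z
    proof (cases "W z > 0")
      case True
      obtain n where n: "1 / real (Suc n) < W z"
        using True by (metis nat_approx_posE)
      have "e2ennreal (- (ereal (Qw z) * elog (W z))) = ennreal (- (Qw z * ln (W z)))"
        using True by (simp add: elog_def e2ennreal_ereal)
      also have "\<dots> = ennreal (Qw z * max 0 (- ln (W z)))"
        by (cases "ln (W z) \<ge> 0") (auto simp: max_def ennreal_neg)
      finally have W1: "e2ennreal (- (ereal (Qw z) * elog (W z))) = ennreal (Qw z * max 0 (- ln (W z)))" .
      have "ennreal (q k z) = e2ennreal (- (ereal (Qw z) * elog (W z)))" if "k \<ge> n" for k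
      proof -
        have "1 / real (Suc k) \<le> 1 / real (Suc n)" using that by (intro divide_left_mono) auto
        then have "max (W z) (1 / real (Suc k)) = W z" using n by linarith
        then show ?thesis unfolding W1 by (simp only: q_def)
      qed
      then show ?thesis by (intro tendsto_eventually eventually_sequentiallyI[of n])
    next
      case False
      then have W0: "W z = 0" using W_nonneg[of z] by simp
      have q: "q k z = Qw z * ln (real (Suc k))" for k
        by (simp add: q_def W0 ln_div)
      show ?thesis
      proof (cases "Qw z = 0")
        case True
        then show ?thesis by (simp add: q_def e2ennreal_neg flip: zero_ereal_def)
      next
        case False
        then have "Qw z > 0" using Qw_nonneg[of z] by linarith
        moreover have "filterlim (\<lambda>k. ln (real (Suc k))) at_top sequentially"
          by (intro filterlim_compose[OF ln_at_top] filterlim_compose[OF filterlim_real_sequentially] filterlim_Suc)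
        ultimately have "filterlim (\<lambda>k. q k z) at_top sequentially"
          unfolding q by (intro filterlim_tendsto_pos_mult_at_top[OF tendsto_const])
        then have "(\<lambda>k. ennreal (q k z)) \<longlonglongrightarrow> top" by (simp add: ennreal_tendsto_top_eq_at_top)
        then show ?thesis using W0 \<open>Qw z > 0\<close> by (simp add: elog_def)
      qed
    qed
    then have "(\<integral>\<^sup>+z. e2ennreal (- (ereal (Qw z) * elog (W z))) \<partial>arc_measure) =
        (\<integral>\<^sup>+z. liminf (\<lambda>k. ennreal (q k z)) \<partial>arc_measure)"
      by (intro nn_integral_cong) (simp add: lim_imp_Liminf[symmetric])
    also have "\<dots> \<le> liminf (\<lambda>k. \<integral>\<^sup>+z. ennreal (q k z) \<partial>arc_measure)"
      by (intro nn_integral_liminf) simp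
    also have "\<dots> = liminf (\<lambda>k. ennreal (\<integral>z. q k z \<partial>arc_measure))"
      using iq q0 by (simp add: nn_integral_eq_integral)
    also have "\<dots> \<le> liminf (\<lambda>k. ennreal (C + 8 / real (Suc k)))"
      by (intro Liminf_mono always_eventually allI ennreal_leI qC)
    also have "\<dots> = ennreal C"
      by (intro lim_imp_Liminf tendsto_ennrealI lim) simp
    finally show ?thesis .
  qed
  have "ereal R = ereal (\<integral>z. p z \<partial>arc_measure) - ereal C" by (simp add: C_def)
  also have "\<dots> \<le> ext_integral arc_measure (\<lambda>z. ereal (Qw z) * elog (W z))"
    unfolding ext_integral_def P
  proof (rule ereal_minus_mono)
    show "ereal (\<integral>z. p z \<partial>arc_measure) \<le> enn2ereal (ennreal (\<integral>z. p z \<partial>arc_measure))"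
      using p0 by (subst enn2ereal_ennreal) (auto intro: Bochner_Integration.integral_nonneg)
    show "enn2ereal (\<integral>\<^sup>+z. e2ennreal (- (ereal (Qw z) * elog (W z))) \<partial>arc_measure) \<le> ereal C"
      using N C0 by (metis enn2ereal_ennreal less_eq_ennreal.rep_eq)
  qed
  finally show ?thesis .
qed

end

section \<open>The Lebesgue decomposition on the circle\<close>

text \<open>A Borel inverse of \<open>cis\<close> on [0, 2 pi). \<open>Ln\<close> has imaginary part
  in (-pi, pi], so negative arguments are shifted by a full turn.\<close>

definition circle_angle :: "complex \<Rightarrow> real" where
  "circle_angle z = (if Im (Ln z) < 0 then Im (Ln z) + 2 * pi else Im (Ln z))"

lemma circle_angle_measurable [measurable]: "circle_angle \<in> borel_measurable borel"
  unfolding circle_angle_def by measurable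

lemma circle_angle_cis:
  assumes "0 \<le> t" "t < 2 * pi"
  shows "circle_angle (cis t) = t"
proof (cases "t \<le> pi")
  case True
  have "Ln (exp (\<i> * of_real t)) = \<i> * of_real t"
  proof (rule Ln_exp)
    show "- pi < Im (\<i> * complex_of_real t)" using assms pi_gt_zero by (simp del: pi_gt_zero)
    show "Im (\<i> * complex_of_real t) \<le> pi" using True by simp
  qed
  then show ?thesis using assms by (simp add: circle_angle_def cis_conv_exp)
next
  case False
  have "cis t = exp (\<i> * of_real (t - 2 * pi))"
    unfolding cis_conv_exp[symmetric] by (simp flip: cis_divide)
  moreover have "Ln (exp (\<i> * of_real (t - 2 * pi))) = \<i> * of_real (t - 2 * pi)"
  proof (rule Ln_exp)
    show "- pi < Im (\<i> * complex_of_real (t - 2 * pi))" using False by simp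
    show "Im (\<i> * complex_of_real (t - 2 * pi)) \<le> pi" using assms pi_gt_zero by (simp del: pi_gt_zero)
  qed
  ultimately show ?thesis using assms by (simp add: circle_angle_def)
qed

lemma elog_measurable [measurable]: "elog \<in> borel_measurable borel"
  unfolding elog_def by measurable

text \<open>Discards the endpoint 2 pi, where \<open>cis\<close> repeats its value at 0 and
  \<open>circle_angle\<close> is no inverse.\<close>

lemma AE_angle_measure: "AE t in angle_measure. 0 \<le> t \<and> t < 2 * pi"
proof -
  have "AE t in lborel. t \<noteq> 2 * pi" by (rule AE_lborel_singleton)
  then show ?thesis
    unfolding angle_measure_def
    by (subst AE_uniform_measure) (auto elim!: eventually_mono)
qed

text \<open>Carries the density from angles to the circle, where the polynomials live.
  \<open>S\<close> is the set that witnesses mutual singularity.\<close>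

lemma circle_decomposition_of_lebesgue:
  assumes \<mu>: "circle_prob_measure \<mu>" and d: "lebesgue_decomposition \<mu> w \<mu>\<^sub>s"
  obtains W S where "circle_decomposition \<mu> W S"
    "ext_integral angle_measure (\<lambda>\<theta>. ereal ((1 - cos \<theta>)\<^sup>2) * elog (w \<theta>)) =
     ext_integral arc_measure (\<lambda>z. ereal (Qw z) * elog (W z))"
proof -
  have wm [measurable]: "w \<in> borel_measurable borel" and w0: "\<And>t. t \<in> {0..2 * pi} \<Longrightarrow> 0 \<le> w t"
    and sets_s [measurable_cong]: "sets \<mu>\<^sub>s = sets borel"
    and dec: "\<And>A. A \<in> sets borel \<Longrightarrow> emeasure \<mu> A =
        emeasure (distr (density angle_measure (\<lambda>t. ennreal (w t))) borel cis) A + emeasure \<mu>\<^sub>s A"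
    and sing: "mutually_singular arc_measure \<mu>\<^sub>s"
    using d unfolding lebesgue_decomposition_def arc_measure_def by auto
  have space_s: "space \<mu>\<^sub>s = UNIV" using sets_s by (metis sets_eq_imp_space_eq space_borel)
  obtain S where S [measurable]: "S \<in> sets borel" and S1: "emeasure arc_measure S = 0" and S2: "emeasure \<mu>\<^sub>s (- S) = 0"
    using sing unfolding mutually_singular_def by (auto simp: sets_s space_s Compl_eq_Diff_UNIV)
  interpret prob_space \<mu> using \<mu> by (simp add: circle_prob_measure_def)
  have \<mu>c: "circle_measure \<mu>"
    using \<mu> by (intro circle_measure.intro circle_measure_axioms.intro finite_measure_axioms)
      (auto simp: circle_prob_measure_def)
  interpret M: circle_measure \<mu> by fact
  \<comment> \<open>The locale wants \<open>W\<close> nonnegative everywhere, while \<open>w\<close>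
    is known to be so only on [0, 2 pi].\<close>
  define W where "W z = max 0 (w (circle_angle z))" for z
  have Wm [measurable]: "W \<in> borel_measurable borel" unfolding W_def by measurable
  have W_cis: "AE t in angle_measure. W (cis t) = w t"
    using AE_angle_measure by (rule eventually_mono) (auto simp: W_def circle_angle_cis w0 max_def)
  have ac: "emeasure (distr (density angle_measure (\<lambda>t. ennreal (w t))) borel cis) A =
      emeasure (density arc_measure (\<lambda>z. ennreal (W z))) A" if A [measurable]: "A \<in> sets borel" for A
  proof -
    have "emeasure (distr (density angle_measure (\<lambda>t. ennreal (w t))) borel cis) A =
      emeasure (density angle_measure (\<lambda>t. ennreal (w t))) (cis -` A \<inter> space (density angle_measure (\<lambda>t. ennreal (w t))))"
      by (intro emeasure_distr) auto
    also have "\<dots> = (\<integral>\<^sup>+t. ennreal (w t) * indicator A (cis t) \<partial>angle_measure)"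
      by (subst emeasure_density) (auto intro!: nn_integral_cong simp: indicator_def)
    also have "\<dots> = (\<integral>\<^sup>+t. ennreal (W (cis t)) * indicator A (cis t) \<partial>angle_measure)"
      using W_cis by (intro nn_integral_cong_AE) (auto elim!: eventually_mono)
    also have "\<dots> = (\<integral>\<^sup>+z. ennreal (W z) * indicator A z \<partial>arc_measure)"
      unfolding arc_measure_def by (subst nn_integral_distr) auto
    also have "\<dots> = emeasure (density arc_measure (\<lambda>z. ennreal (W z))) A"
      by (intro emeasure_density[symmetric]) auto
    finally show ?thesis .
  qed
  have null: "S \<in> null_sets arc_measure" using S1 by (simp add: null_setsI)
  have AES: "AE z in arc_measure. z \<notin> S" by (rule AE_not_in[OF null])
  have "density \<mu> (\<lambda>z. ennreal (indicator (- S) z)) = density arc_measure (\<lambda>z. ennreal (W z))"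
  proof (rule measure_eqI)
    fix A assume "A \<in> sets (density \<mu> (\<lambda>z. ennreal (indicator (- S) z)))"
    then have A [measurable]: "A \<in> sets borel" by simp
    have "emeasure (density \<mu> (\<lambda>z. ennreal (indicator (- S) z))) A =
        (\<integral>\<^sup>+z. ennreal (indicator (- S) z) * indicator A z \<partial>\<mu>)"
      by (intro emeasure_density) auto
    also have "\<dots> = (\<integral>\<^sup>+z. indicator (A - S) z \<partial>\<mu>)"
      by (intro nn_integral_cong) (auto simp: indicator_def)
    also have "\<dots> = emeasure \<mu> (A - S)" by simp
    also have "\<dots> = emeasure (density arc_measure (\<lambda>z. ennreal (W z))) (A - S) + emeasure \<mu>\<^sub>s (A - S)"
      by (simp add: dec ac)
    also have "emeasure \<mu>\<^sub>s (A - S) = 0"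
      using S2 emeasure_mono[of "A - S" "- S" \<mu>\<^sub>s] by auto
    also have "emeasure (density arc_measure (\<lambda>z. ennreal (W z))) (A - S) + 0 =
        (\<integral>\<^sup>+z. ennreal (W z) * indicator (A - S) z \<partial>arc_measure)"
      by (simp add: emeasure_density)
    also have "\<dots> = (\<integral>\<^sup>+z. ennreal (W z) * indicator A z \<partial>arc_measure)"
      using AES by (intro nn_integral_cong_AE) (auto elim!: eventually_mono simp: indicator_def)
    also have "\<dots> = emeasure (density arc_measure (\<lambda>z. ennreal (W z))) A"
      by (intro emeasure_density[symmetric]) auto
    finally show "emeasure (density \<mu> (\<lambda>z. ennreal (indicator (- S) z))) A =
      emeasure (density arc_measure (\<lambda>z. ennreal (W z))) A" .
  qed simp
  then have "circle_decomposition \<mu> W S"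
    using AES prob_space by (intro circle_decomposition.intro circle_decomposition_axioms.intro \<mu>c) (auto simp: W_def)
  moreover have "ext_integral angle_measure (\<lambda>\<theta>. ereal ((1 - cos \<theta>)\<^sup>2) * elog (w \<theta>)) =
     ext_integral arc_measure (\<lambda>z. ereal (Qw z) * elog (W z))"
  proof -
    have eq: "AE t in angle_measure. ereal ((1 - cos t)\<^sup>2) * elog (w t) = ereal (Qw (cis t)) * elog (W (cis t))"
      using W_cis by (rule eventually_mono) (simp add: Qw_def)
    have "(\<integral>\<^sup>+t. e2ennreal (ereal ((1 - cos t)\<^sup>2) * elog (w t)) \<partial>angle_measure) =
        (\<integral>\<^sup>+z. e2ennreal (ereal (Qw z) * elog (W z)) \<partial>arc_measure)"
      unfolding arc_measure_def using eq
      by (subst nn_integral_distr) (auto intro!: nn_integral_cong_AE elim!: eventually_mono)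
    moreover have "(\<integral>\<^sup>+t. e2ennreal (- (ereal ((1 - cos t)\<^sup>2) * elog (w t))) \<partial>angle_measure) =
        (\<integral>\<^sup>+z. e2ennreal (- (ereal (Qw z) * elog (W z))) \<partial>arc_measure)"
      unfolding arc_measure_def using eq
      by (subst nn_integral_distr) (auto intro!: nn_integral_cong_AE elim!: eventually_mono)
    ultimately show ?thesis by (simp add: ext_integral_def)
  qed
  ultimately show thesis by (rule that)
qed

section \<open>The sum rule in terms of the coefficients\<close>

definition log_term :: "complex \<Rightarrow> real" where
  "log_term a = ln (1 - (cmod a)\<^sup>2) + (cmod a)\<^sup>2 + 1/2 * cmod a ^ 4"

definition sq_diff_term :: "complex \<Rightarrow> complex \<Rightarrow> real" where
  "sq_diff_term a b = ((cmod a)\<^sup>2 - (cmod b)\<^sup>2)\<^sup>2"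

definition diff_term :: "complex \<Rightarrow> complex \<Rightarrow> real" where
  "diff_term a b = (6 * (cmod a)\<^sup>2 + 6 * (cmod b)\<^sup>2 - (cmod (a - b))\<^sup>2) * (cmod (a - b))\<^sup>2"

definition second_diff_term :: "complex \<Rightarrow> complex \<Rightarrow> complex \<Rightarrow> real" where
  "second_diff_term c a b = (1 - (cmod a)\<^sup>2) * (cmod (c - 2 * a + b))\<^sup>2"

lemma cmod_sq_diff: "(cmod (a - b))\<^sup>2 = (cmod a)\<^sup>2 + (cmod b)\<^sup>2 - 2 * Re (a * cnj b)"
  by (simp only: cmod_power2) (simp add: power2_eq_square algebra_simps)

lemma cmod_sq_add: "(cmod (a + b))\<^sup>2 = (cmod a)\<^sup>2 + (cmod b)\<^sup>2 + 2 * Re (a * cnj b)"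
  by (simp only: cmod_power2) (simp add: power2_eq_square algebra_simps)

lemma cmod_sq_second_diff: "(cmod (c - 2 * a + b))\<^sup>2 = (cmod c)\<^sup>2 + 4 * (cmod a)\<^sup>2 + (cmod b)\<^sup>2
    - 4 * Re (c * cnj a) - 4 * Re (a * cnj b) + 2 * Re (c * cnj b)"
  by (simp only: cmod_power2) (simp add: power2_eq_square algebra_simps)

lemma Re_mult_cnj_sq: "Re ((a * cnj b)\<^sup>2) = 2 * (Re (a * cnj b))\<^sup>2 - (cmod a)\<^sup>2 * (cmod b)\<^sup>2"
  by (simp only: cmod_power2) (simp add: power2_eq_square algebra_simps)

text \<open>The parallelogram law. This form shows the sign and yields the second identity of the
  theorem.\<close>

lemma diff_term_alt:
  "diff_term a b = (4 * (cmod a)\<^sup>2 + 4 * (cmod b)\<^sup>2 + (cmod (a + b))\<^sup>2) * (cmod (a - b))\<^sup>2"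
  unfolding diff_term_def cmod_sq_add cmod_sq_diff by simp

lemma diff_term_nonneg: "diff_term a b \<ge> 0"
  unfolding diff_term_alt by simp

definition sum_rule_term :: "(int \<Rightarrow> complex) \<Rightarrow> int \<Rightarrow> real" where
  "sum_rule_term \<alpha> j = 3/2 * log_term (\<alpha> j) - 1/4 * sq_diff_term (\<alpha> j) (\<alpha> (j - 1))
     - 1/4 * second_diff_term (\<alpha> (j + 1)) (\<alpha> j) (\<alpha> (j - 1)) - 1/8 * diff_term (\<alpha> j) (\<alpha> (j - 1))"

text \<open>The potential that telescopes. Every summand contains a factor from \<open>a\<close> or
  \<open>b\<close>, so it vanishes as the coefficients do.\<close>

definition sum_rule_boundary :: "complex \<Rightarrow> complex \<Rightarrow> complex \<Rightarrow> real" where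
  "sum_rule_boundary a b c = - ((cmod a)\<^sup>2 - (cmod b)\<^sup>2) / 4 + Re (a * cnj b)
     - (1 - (cmod b)\<^sup>2) * Re (a * cnj c) / 2 + 7/8 * (cmod b) ^ 4
     + (cmod b)\<^sup>2 * (cmod a)\<^sup>2 / 4 - (cmod b)\<^sup>2 * Re (a * cnj b)"

lemma sum_rule_telescope:
  "sum_rule_term \<alpha> j - entropy_increment \<alpha> j =
     sum_rule_boundary (\<alpha> (j + 1)) (\<alpha> j) (\<alpha> (j - 1)) - sum_rule_boundary (\<alpha> j) (\<alpha> (j - 1)) (\<alpha> (j - 2))"
proof -
  have 4: "u ^ 4 = u\<^sup>2 * u\<^sup>2" for u :: real by (simp add: eval_nat_numeral)
  \<comment> \<open>A polynomial identity in free variables: x', x, y are the squared moduli at j+1,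
    j, j-1; r', r are real parts of products of neighbours and q', q of those two apart; l is the
    logarithm, which cancels.\<close>
  have *: "3/2 * (l + x + 1/2 * (x * x)) - 1/4 * (x - y)\<^sup>2 -
      1/4 * ((1 - x) * (x' + 4 * x + y - 4 * r' - 4 * r + 2 * q'))
      - 1/8 * ((6 * x + 6 * y - (x + y - 2 * r)) * (x + y - 2 * r))
      - (3/2 * l + 2 * r - q * (1 - y) / 2 + (2 * r\<^sup>2 - x * y) / 4) =
      (- (x' - x) / 4 + r' - (1 - x) * q' / 2 + 7/8 * (x * x) + x * x' / 4 - x * r')
      - (- (x - y) / 4 + r - (1 - y) * q / 2 + 7/8 * (y * y) + y * x / 4 - y * r)"
    for l x y x' r r' q q' :: real
    by (simp add: power2_eq_square field_simps)
  show ?thesis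
    unfolding sum_rule_term_def entropy_increment_def sum_rule_boundary_def log_term_def sq_diff_term_def
      second_diff_term_def diff_term_def cmod_sq_second_diff cmod_sq_diff Re_mult_cnj_sq 4
    by (rule *)
qed

lemma sum_rule_partial:
  assumes "\<alpha> (-1) = -1"
  shows "(\<Sum>j<n. sum_rule_term \<alpha> (int j)) + 9/8 = (\<Sum>j<n. entropy_increment \<alpha> (int j))
    + sum_rule_boundary (\<alpha> (int n)) (\<alpha> (int n - 1)) (\<alpha> (int n - 2))"
proof (induction n)
  case 0
  \<comment> \<open>With b = -1 the factor 1 - |b|^2 removes c and the terms in a cancel, leaving
    1/4 + 7/8 = 9/8.\<close>
  show ?case by (simp add: sum_rule_boundary_def assms field_simps)
next
  case (Suc n)
  have e: "int (Suc n) = int n + 1" "int n + 1 - 1 = int n" "int n + 1 - 2 = int n - 1" by simp_all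
  show ?case
    using Suc sum_rule_telescope[of \<alpha> "int n"] unfolding sum.lessThan_Suc e by linarith
qed

text \<open>In the closed disc each summand is at most its coefficient times |a| or |b|; the
  constant 4 is generous.\<close>

lemma sum_rule_boundary_le:
  assumes "cmod a \<le> 1" "cmod b \<le> 1" "cmod c \<le> 1"
  shows "\<bar>sum_rule_boundary a b c\<bar> \<le> 4 * (cmod a + cmod b)"
proof -
  have sq: "(cmod u)\<^sup>2 \<le> cmod u" if "cmod u \<le> 1" for u
    using that by (simp add: power2_eq_square mult_left_le)
  have Re: "\<bar>Re (a * cnj u)\<bar> \<le> cmod a" if "cmod u \<le> 1" for u
  proof -
    have "\<bar>Re (a * cnj u)\<bar> \<le> cmod a * cmod u" using abs_Re_le_cmod[of "a * cnj u"] by (simp add: norm_mult)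
    also have "\<dots> \<le> cmod a" using that by (simp add: mult_left_le)
    finally show ?thesis .
  qed
  have b: "0 \<le> (cmod b)\<^sup>2" "(cmod b)\<^sup>2 \<le> 1" using sq[OF assms(2)] assms(2) by auto
  have m: "\<bar>t * u\<bar> \<le> \<bar>u\<bar>" if "0 \<le> t" "t \<le> 1" for t u :: real
    using that by (simp add: abs_mult mult_left_le_one_le)
  have 1: "\<bar>(1 - (cmod b)\<^sup>2) * Re (a * cnj c)\<bar> \<le> cmod a"
    using b by (intro order.trans[OF m Re[OF assms(3)]]) auto
  have 2: "\<bar>(cmod b)\<^sup>2 * (cmod a)\<^sup>2\<bar> \<le> cmod a"
    using m[OF b, of "(cmod a)\<^sup>2"] sq[OF assms(1)] by simp
  have 3: "\<bar>(cmod b)\<^sup>2 * Re (a * cnj b)\<bar> \<le> cmod a"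
    using m[OF b] Re[OF assms(2)] order.trans by blast
  have 4: "cmod b ^ 4 \<le> cmod b"
    using assms(2) power_decreasing[of 1 4 "cmod b"] by auto
  have *: "\<bar>- (A - B) / 4 + r - s / 2 + 7/8 * f + m / 4 - t\<bar> \<le> 4 * (u + v)"
    if "0 \<le> A" "A \<le> u" "0 \<le> B" "B \<le> v" "\<bar>r\<bar> \<le> u" "\<bar>s\<bar> \<le> u" "0 \<le> f" "f \<le> v" "\<bar>m\<bar> \<le> u" "\<bar>t\<bar> \<le> u"
    for A B r s f m t u v :: real
    using that by (simp add: abs_le_iff field_simps)
  show ?thesis unfolding sum_rule_boundary_def
    by (rule *) (use 1 2 3 4 sq[OF assms(1)] sq[OF assms(2)] Re[OF assms(2)] in simp_all)
qed

text \<open>For x = |a|^2 this is the Taylor remainder of ln(1 - x) after the quadratic term, which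
  starts with -x^3/3. Each bound follows from the sign of a derivative; for the upper one it is that
  of 2 - 3t, nonnegative for t <= 1/2.\<close>

lemma log_term_bounds:
  assumes "cmod a < 1"
  shows "(cmod a) ^ 6 / 3 \<le> - log_term a"
    and "(cmod a)\<^sup>2 \<le> 1/2 \<Longrightarrow> - log_term a \<le> (cmod a) ^ 6"
proof -
  define x where "x = (cmod a)\<^sup>2"
  have x: "0 \<le> x" "x < 1" using assms abs_square_less_1[of "cmod a"] by (auto simp: x_def)
  have p: "(cmod a) ^ 6 = x ^ 3" "(cmod a) ^ 4 = x\<^sup>2" by (simp_all add: x_def flip: power_mult)
  have "0 \<le> - ln (1 - x) - x - x\<^sup>2 / 2 - x ^ 3 / 3"
  proof -
    have "(\<lambda>t. - ln (1 - t) - t - t\<^sup>2 / 2 - t ^ 3 / 3) 0 \<le> (\<lambda>t. - ln (1 - t) - t - t\<^sup>2 / 2 - t ^ 3 / 3) x"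
    proof (rule DERIV_nonneg_imp_nondecreasing[OF x(1)])
      fix t assume t: "0 \<le> t" "t \<le> x"
      then have "1 - t > 0" using x by simp
      then have "((\<lambda>t. - ln (1 - t) - t - t\<^sup>2 / 2 - t ^ 3 / 3) has_real_derivative t ^ 3 / (1 - t)) (at t)"
        by (auto intro!: derivative_eq_intros simp: field_simps power2_eq_square power3_eq_cube)
      moreover have "t ^ 3 / (1 - t) \<ge> 0" using t \<open>1 - t > 0\<close> by simp
      ultimately show "\<exists>y. ((\<lambda>t. - ln (1 - t) - t - t\<^sup>2 / 2 - t ^ 3 / 3) has_real_derivative y) (at t) \<and> 0 \<le> y" by blast
    qed
    then show ?thesis by simp
  qed
  then show "(cmod a) ^ 6 / 3 \<le> - log_term a"
    by (simp add: log_term_def p flip: x_def)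
  assume "(cmod a)\<^sup>2 \<le> 1/2"
  then have x2: "x \<le> 1/2" by (simp add: x_def)
  have "(\<lambda>t. t ^ 3 + ln (1 - t) + t + t\<^sup>2 / 2) 0 \<le> (\<lambda>t. t ^ 3 + ln (1 - t) + t + t\<^sup>2 / 2) x"
  proof (rule DERIV_nonneg_imp_nondecreasing[OF x(1)])
    fix t assume t: "0 \<le> t" "t \<le> x"
    then have t1: "1 - t > 0" using x by simp
    then have "((\<lambda>t. t ^ 3 + ln (1 - t) + t + t\<^sup>2 / 2) has_real_derivative t\<^sup>2 * (2 - 3 * t) / (1 - t)) (at t)"
      by (auto intro!: derivative_eq_intros simp: field_simps power2_eq_square power3_eq_cube)
    moreover have "t\<^sup>2 * (2 - 3 * t) / (1 - t) \<ge> 0" using t t1 x2 by simp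
    ultimately show "\<exists>y. ((\<lambda>t. t ^ 3 + ln (1 - t) + t + t\<^sup>2 / 2) has_real_derivative y) (at t) \<and> 0 \<le> y" by blast
  qed
  then show "- log_term a \<le> (cmod a) ^ 6"
    by (simp add: log_term_def p flip: x_def)
qed

text \<open>Young's inequality for the exponents 3 and 3/2 with constant 1: the larger of u^2 and t
  replaces the other.\<close>

lemma sq_mult_sq_le:
  fixes u t :: real
  assumes "0 \<le> u" "0 \<le> t"
  shows "u\<^sup>2 * t\<^sup>2 \<le> u ^ 6 + t ^ 3"
proof (cases "u\<^sup>2 \<le> t")
  case True
  then have "u\<^sup>2 * t\<^sup>2 \<le> t * t\<^sup>2" using assms by (intro mult_right_mono) auto
  then show ?thesis using assms by (simp add: power2_eq_square power3_eq_cube add_increasing)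
next
  case False
  then have "t\<^sup>2 \<le> (u\<^sup>2)\<^sup>2" using assms by (intro power_mono) auto
  then have "u\<^sup>2 * t\<^sup>2 \<le> u\<^sup>2 * (u\<^sup>2)\<^sup>2" by (intro mult_left_mono) auto
  also have "u\<^sup>2 * (u\<^sup>2)\<^sup>2 = u ^ 6" by (simp add: eval_nat_numeral)
  finally show ?thesis using assms by (simp add: add_increasing2)
qed

text \<open>A discrete Gagliardo--Nirenberg inequality: summation by parts moves one difference from
  \<open>|d\<^sub>n|\<^sup>3\<close> onto \<open>cnj d\<^sub>n |d\<^sub>n|\<close>, and Young's inequality absorbs the cubes that remain.\<close>

lemma summable_diff_cubed:
  fixes b :: "nat \<Rightarrow> complex"
  assumes b1: "\<And>n. cmod (b n) \<le> 1" and s6: "summable (\<lambda>n. cmod (b n) ^ 6)"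
    and s2: "summable (\<lambda>n. (cmod (b (n + 2) - 2 * b (n + 1) + b n))\<^sup>2)"
  shows "summable (\<lambda>n. cmod (b (n + 1) - b n) ^ 3)"
proof -
  define d where "d n = b (n + 1) - b n" for n
  \<comment> \<open>Its product with d is |d|^3, and its increments are bounded by those of d times
    |d|.\<close>
  define c where "c n = cnj (d n) * cmod (d n)" for n
  define D where "D n = b (n + 2) - 2 * b (n + 1) + b n" for n
  define P where "P N = (\<Sum>n<N. cmod (d n) ^ 3)" for N
  have Dd: "D n = d (Suc n) - d n" for n by (simp add: D_def d_def)
  have d2: "cmod (d n) \<le> 2" for n
    using norm_triangle_ineq4[of "b (n + 1)" "b n"] b1[of n] b1[of "n + 1"] by (simp add: d_def)
  have d8: "cmod (d n) ^ 3 \<le> 8" for n using power_mono[OF d2[of n], of 3] by simp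
  have c4: "cmod (c n) \<le> 4" for n
    using mult_mono[OF d2[of n] d2[of n]] by (simp add: c_def norm_mult)
  have cd: "c n * d n = of_real (cmod (d n) ^ 3)" for n
  proof -
    have "c n * d n = (d n * cnj (d n)) * cmod (d n)" by (simp add: c_def mult_ac)
    also have "\<dots> = of_real ((cmod (d n))\<^sup>2 * cmod (d n))"
      by (simp only: complex_norm_square[symmetric] of_real_mult)
    finally show ?thesis by (simp add: power2_eq_square power3_eq_cube)
  qed
  have parts: "(\<Sum>n<N. c n * d n) = c N * b N - c 0 * b 0 - (\<Sum>n<N. (c (Suc n) - c n) * b (Suc n))" for N
    by (induction N) (simp_all add: d_def algebra_simps)
  \<comment> \<open>From (8v - ut)^2 >= 0. The weight 1/16 leaves the cubes with total coefficient
    1/8, small enough to be absorbed.\<close>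
  have young: "u * v * t \<le> 4 * v\<^sup>2 + (u ^ 6 + t ^ 3) / 16" if "0 \<le> u" "0 \<le> v" "0 \<le> t" for u v t :: real
  proof -
    have 1: "u\<^sup>2 * t\<^sup>2 \<le> u ^ 6 + t ^ 3" using that by (intro sq_mult_sq_le)
    have "0 \<le> (8 * v - u * t)\<^sup>2" by simp
    then have "16 * (u * v * t) \<le> 64 * v\<^sup>2 + u\<^sup>2 * t\<^sup>2" by (simp add: power2_eq_square algebra_simps)
    moreover have "16 * p \<le> 64 * q + m \<Longrightarrow> m \<le> r \<Longrightarrow> p \<le> 4 * q + r / 16" for p q m r :: real by simp
    ultimately show ?thesis using 1 by blast
  qed
  have cdiff: "cmod (c (Suc n) - c n) \<le> cmod (D n) * cmod (d (Suc n)) + cmod (D n) * cmod (d n)" for n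
  proof -
    have "c (Suc n) - c n = cnj (D n) * cmod (d (Suc n)) + cnj (d n) * of_real (cmod (d (Suc n)) - cmod (d n))"
      by (simp add: c_def Dd algebra_simps)
    then have "cmod (c (Suc n) - c n) \<le> cmod (D n) * cmod (d (Suc n)) + cmod (d n) * \<bar>cmod (d (Suc n)) - cmod (d n)\<bar>"
      by (metis norm_triangle_ineq norm_mult complex_mod_cnj norm_of_real abs_norm_cancel)
    also have "\<dots> \<le> cmod (D n) * cmod (d (Suc n)) + cmod (d n) * cmod (D n)"
      unfolding Dd by (intro add_left_mono mult_left_mono norm_triangle_ineq3) auto
    finally show ?thesis by (simp add: mult.commute)
  qed
  \<comment> \<open>The two boundary terms of the summation by parts give 4 each, and the index
    shift in the cubes gives 8/16 = 1/2. In sum P N <= K + P N / 8, whence the factor 8/7.\<close>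
  define K where "K = 8 + 8 * (\<Sum>n. (cmod (D n))\<^sup>2) + (\<Sum>n. cmod (b (Suc n)) ^ 6) / 8 + 1 / 2"
  have sD: "summable (\<lambda>n. (cmod (D n))\<^sup>2)" using s2 by (simp add: D_def)
  have sb: "summable (\<lambda>n. cmod (b (Suc n)) ^ 6)" using s6 by (subst summable_Suc_iff)
  have bound: "P N \<le> K * 8 / 7" for N
  proof -
    have "P N = cmod (\<Sum>n<N. c n * d n)"
    proof -
      have "(\<Sum>n<N. c n * d n) = of_real (P N)" by (simp add: cd P_def)
      moreover have "P N \<ge> 0" unfolding P_def by (intro sum_nonneg) auto
      ultimately show ?thesis by simp
    qed
    also have "\<dots> \<le> cmod (c N * b N) + cmod (c 0 * b 0) + cmod (\<Sum>n<N. (c (Suc n) - c n) * b (Suc n))"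
      unfolding parts by (intro order.trans[OF norm_triangle_ineq4] add_mono order_refl norm_triangle_ineq4)
    finally have 1: "P N \<le> cmod (c N * b N) + cmod (c 0 * b 0) + cmod (\<Sum>n<N. (c (Suc n) - c n) * b (Suc n))" .
    have 2: "cmod (c n * b n) \<le> 4" for n
      using mult_mono[OF c4[of n] b1[of n]] by (simp add: norm_mult)
    have "cmod (\<Sum>n<N. (c (Suc n) - c n) * b (Suc n)) \<le>
        (\<Sum>n<N. 8 * (cmod (D n))\<^sup>2 + cmod (b (Suc n)) ^ 6 / 8 + (cmod (d n) ^ 3 + cmod (d (Suc n)) ^ 3) / 16)"
    proof (intro sum_norm_le)
      fix n
      have "cmod ((c (Suc n) - c n) * b (Suc n)) \<le>
          (cmod (D n) * cmod (d (Suc n)) + cmod (D n) * cmod (d n)) * cmod (b (Suc n))"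
        unfolding norm_mult using cdiff[of n] by (intro mult_right_mono) auto
      also have "\<dots> = cmod (b (Suc n)) * cmod (D n) * cmod (d (Suc n)) + cmod (b (Suc n)) * cmod (D n) * cmod (d n)"
        by (simp add: algebra_simps)
      also have "\<dots> \<le> (4 * (cmod (D n))\<^sup>2 + (cmod (b (Suc n)) ^ 6 + cmod (d (Suc n)) ^ 3) / 16)
          + (4 * (cmod (D n))\<^sup>2 + (cmod (b (Suc n)) ^ 6 + cmod (d n) ^ 3) / 16)"
        by (intro add_mono young) auto
      finally show "cmod ((c (Suc n) - c n) * b (Suc n)) \<le>
          8 * (cmod (D n))\<^sup>2 + cmod (b (Suc n)) ^ 6 / 8 + (cmod (d n) ^ 3 + cmod (d (Suc n)) ^ 3) / 16"
        by (simp add: field_simps)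
    qed
    also have "\<dots> = 8 * (\<Sum>n<N. (cmod (D n))\<^sup>2) + (\<Sum>n<N. cmod (b (Suc n)) ^ 6) / 8
        + (P N + (\<Sum>n<N. cmod (d (Suc n)) ^ 3)) / 16"
      by (simp add: P_def sum.distrib sum_distrib_left sum_divide_distrib add_divide_distrib)
    finally have 3: "cmod (\<Sum>n<N. (c (Suc n) - c n) * b (Suc n)) \<le>
        8 * (\<Sum>n<N. (cmod (D n))\<^sup>2) + (\<Sum>n<N. cmod (b (Suc n)) ^ 6) / 8
        + (P N + (\<Sum>n<N. cmod (d (Suc n)) ^ 3)) / 16" .
    have 4: "(\<Sum>n<N. cmod (d (Suc n)) ^ 3) \<le> P N + 8"
    proof -
      have "P (Suc N) = cmod (d 0) ^ 3 + (\<Sum>n<N. cmod (d (Suc n)) ^ 3)"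
        unfolding P_def by (rule sum.lessThan_Suc_shift)
      moreover have "P (Suc N) = P N + cmod (d N) ^ 3" by (simp add: P_def)
      moreover have "0 \<le> cmod (d 0) ^ 3" by simp
      ultimately show ?thesis using d8[of N] by linarith
    qed
    have 5: "(\<Sum>n<N. (cmod (D n))\<^sup>2) \<le> (\<Sum>n. (cmod (D n))\<^sup>2)"
      by (intro sum_le_suminf sD) auto
    have 6: "(\<Sum>n<N. cmod (b (Suc n)) ^ 6) \<le> (\<Sum>n. cmod (b (Suc n)) ^ 6)"
      by (intro sum_le_suminf sb) auto
    show ?thesis
      using 1 2[of N] 2[of 0] 3 4 5 6 unfolding K_def by argo
  qed
  have "summable (\<lambda>n. cmod (d n) ^ 3)"
    using bound unfolding P_def by (intro summableI_nonneg_bounded[where x = "K * 8 / 7"]) simp_all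
  then show ?thesis by (simp add: d_def)
qed

section \<open>Series of constant sign in the extended reals\<close>

lemma suminf_ereal_nonneg:
  fixes f :: "nat \<Rightarrow> real"
  assumes "\<And>n. f n \<ge> 0"
  shows "(\<Sum>n. ereal (f n)) = (if summable f then ereal (suminf f) else \<infinity>)"
proof (cases "(\<Sum>n. ereal (f n)) = \<infinity>")
  case True
  have "\<not> summable f"
  proof
    assume "summable f"
    then have "(\<lambda>n. ereal (f n)) sums ereal (suminf f)" by (simp add: sums_ereal summable_sums)
    with True show False by (simp add: sums_iff)
  qed
  with True show ?thesis by simp
next
  case False
  then show ?thesis using assms by (simp add: summable_ereal suminf_ereal)
qed

lemma suminf_ereal_nonpos:
  fixes f :: "nat \<Rightarrow> real"
  assumes "\<And>n. f n \<le> 0"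
  shows "(\<Sum>n. ereal (f n)) = (if summable f then ereal (suminf f) else - \<infinity>)"
proof -
  have "(\<lambda>n. ereal (- f n)) sums (\<Sum>n. ereal (- f n))"
    using assms by (intro summable_sums summable_ereal_pos) simp
  then have "(\<lambda>n. - (\<Sum>i<n. ereal (- f i))) \<longlonglongrightarrow> - (\<Sum>n. ereal (- f n))"
    unfolding sums_def by (rule tendsto_uminus_ereal)
  moreover have "- (\<Sum>i<n. ereal (- f i)) = (\<Sum>i<n. ereal (f i))" for n
    by (simp add: sum_negf)
  ultimately have "(\<lambda>n. ereal (f n)) sums - (\<Sum>n. ereal (- f n))" by (simp add: sums_def)
  then have "(\<Sum>n. ereal (f n)) = - (\<Sum>n. ereal (- f n))" by (rule sums_unique[symmetric])
  also have "(\<Sum>n. ereal (- f n)) = (if summable f then ereal (- suminf f) else \<infinity>)"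
    using assms suminf_ereal_nonneg[of "\<lambda>n. - f n"] by (simp add: summable_minus_iff suminf_minus)
  finally show ?thesis by simp
qed

text \<open>All four series enter \<open>t\<close> with the same sign, so nothing cancels: -8t
  dominates each of them, 1/8 being the smallest coefficient, and one divergent series already makes
  the value -infinity.\<close>

lemma ereal_sum_rule_eq:
  fixes l s d e t :: "nat \<Rightarrow> real"
  assumes sgn: "\<And>n. l n \<le> 0" "\<And>n. s n \<ge> 0" "\<And>n. d n \<ge> 0" "\<And>n. e n \<ge> 0"
  assumes t: "\<And>n. t n = 3/2 * l n - 1/4 * s n - 1/4 * d n - 1/8 * e n"
  shows "summable t \<longleftrightarrow> summable l \<and> summable s \<and> summable d \<and> summable e"
    and "ereal (9/8) + ereal (3/2) * (\<Sum>n. ereal (l n)) - ereal (1/4) * (\<Sum>n. ereal (s n))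
      - ereal (1/4) * (\<Sum>n. ereal (d n)) - ereal (1/8) * (\<Sum>n. ereal (e n)) =
      (if summable t then ereal (9/8 + suminf t) else - \<infinity>)"
proof -
  have bd: "\<bar>l n\<bar> \<le> 8 * (- t n)" "\<bar>s n\<bar> \<le> 8 * (- t n)" "\<bar>d n\<bar> \<le> 8 * (- t n)" "\<bar>e n\<bar> \<le> 8 * (- t n)" for n
    using sgn[of n] t[of n] by auto
  show iff: "summable t \<longleftrightarrow> summable l \<and> summable s \<and> summable d \<and> summable e"
  proof
    assume "summable t"
    then have m: "summable (\<lambda>n. 8 * (- t n))" by (intro summable_mult summable_minus)
    have "summable f" if "\<And>n. \<bar>f n\<bar> \<le> 8 * (- t n)" for f
      by (rule summable_comparison_test'[OF m]) (use that in simp)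
    then show "summable l \<and> summable s \<and> summable d \<and> summable e"
      using bd by blast
  next
    assume "summable l \<and> summable s \<and> summable d \<and> summable e"
    then show "summable t" unfolding t by (intro summable_diff summable_mult) auto
  qed
  show "ereal (9/8) + ereal (3/2) * (\<Sum>n. ereal (l n)) - ereal (1/4) * (\<Sum>n. ereal (s n))
      - ereal (1/4) * (\<Sum>n. ereal (d n)) - ereal (1/8) * (\<Sum>n. ereal (e n)) =
      (if summable t then ereal (9/8 + suminf t) else - \<infinity>)"
  proof (cases "summable t")
    case True
    then have su: "summable l" "summable s" "summable d" "summable e" using iff by auto
    then have "(\<lambda>n. 3/2 * l n - 1/4 * s n - 1/4 * d n - 1/8 * e n) sums
        (3/2 * suminf l - 1/4 * suminf s - 1/4 * suminf d - 1/8 * suminf e)"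
      by (intro sums_diff sums_mult summable_sums)
    then have "suminf t = 3/2 * suminf l - 1/4 * suminf s - 1/4 * suminf d - 1/8 * suminf e"
      unfolding t[symmetric] by (rule sums_unique[symmetric])
    then show ?thesis using True su
      by (simp add: suminf_ereal_nonneg suminf_ereal_nonpos sgn)
  next
    case False
    then have "\<not> (summable l \<and> summable s \<and> summable d \<and> summable e)" using iff by auto
    with False show ?thesis
      by (auto simp: suminf_ereal_nonneg suminf_ereal_nonpos sgn)
  qed
qed

lemma power6_tendsto_0:
  fixes b :: "nat \<Rightarrow> complex"
  assumes "summable (\<lambda>n. cmod (b n) ^ 6)"
  shows "b \<longlonglongrightarrow> 0"
proof -
  have "(\<lambda>n. root 6 (cmod (b n) ^ 6)) \<longlonglongrightarrow> root 6 0"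
    by (intro tendsto_real_root summable_LIMSEQ_zero assms)
  then have "(\<lambda>n. cmod (b n)) \<longlonglongrightarrow> 0" by (simp add: real_root_power_cancel)
  then show ?thesis by (rule tendsto_norm_zero_cancel)
qed

lemma log_term_nonpos:
  assumes "cmod a < 1"
  shows "log_term a \<le> 0"
proof -
  have "0 \<le> cmod a ^ 6 / 3" by simp
  also note log_term_bounds(1)[OF assms]
  finally show ?thesis by simp
qed

text \<open>Forwards, the logarithmic terms control the sixth powers, so the coefficients tend to 0
  and the weight of the second differences is eventually above 1/2. Backwards, cubes of first
  differences are summable by \<open>summable_diff_cubed\<close>, which handles the mixed terms.
  Comparisons use shifted series, since the left side begins with the index -1.\<close>

lemma sum_rule_summable_iff:
  fixes \<alpha> :: "int \<Rightarrow> complex"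
  assumes a: "\<forall>k. cmod (\<alpha> (int k)) < 1"
  shows "(summable (\<lambda>n. log_term (\<alpha> (int n))) \<and> summable (\<lambda>n. sq_diff_term (\<alpha> (int n)) (\<alpha> (int n - 1)))
      \<and> summable (\<lambda>n. second_diff_term (\<alpha> (int n + 1)) (\<alpha> (int n)) (\<alpha> (int n - 1)))
      \<and> summable (\<lambda>n. diff_term (\<alpha> (int n)) (\<alpha> (int n - 1)))) \<longleftrightarrow>
    summable (\<lambda>n. (cmod (\<alpha> (int n + 2) - 2 * \<alpha> (int n + 1) + \<alpha> (int n)))\<^sup>2 + cmod (\<alpha> (int n)) ^ 6)"
    (is "?L \<longleftrightarrow> summable ?v")
proof
  define b where "b n = \<alpha> (int n)" for n
  have b1: "cmod (b n) < 1" for n using a by (simp add: b_def)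
  have Suc: "int (Suc n) = int n + 1" "int n + 1 + 1 = int n + 2" "int n + 1 - 1 = int n" for n by simp_all
  {
    assume L: ?L
    have s6: "summable (\<lambda>n. cmod (b n) ^ 6)"
    proof (rule summable_comparison_test')
      show "summable (\<lambda>n. 3 * (- log_term (b n)))" using L unfolding b_def by (intro summable_mult summable_minus) auto
      show "norm (cmod (b n) ^ 6) \<le> 3 * (- log_term (b n))" if "n \<ge> 0" for n
        using log_term_bounds(1)[OF b1[of n]] by simp
    qed
    have "b \<longlonglongrightarrow> 0" by (rule power6_tendsto_0[OF s6])
    then have "(\<lambda>n. 1 - (cmod (b (Suc n)))\<^sup>2) \<longlonglongrightarrow> 1 - (cmod 0)\<^sup>2"
      by (intro tendsto_intros LIMSEQ_Suc)
    then have ev: "eventually (\<lambda>n. 1/2 < 1 - (cmod (b (Suc n)))\<^sup>2) sequentially"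
      by (rule order_tendstoD) simp
    have "summable (\<lambda>n. (cmod (\<alpha> (int n + 2) - 2 * \<alpha> (int n + 1) + \<alpha> (int n)))\<^sup>2)"
    proof (rule summable_comparison_test_ev)
      have "summable (\<lambda>n. second_diff_term (\<alpha> (int (Suc n) + 1)) (\<alpha> (int (Suc n))) (\<alpha> (int (Suc n) - 1)))"
        using L by (subst summable_Suc_iff) auto
      then show "summable (\<lambda>n. 2 * second_diff_term (\<alpha> (int n + 2)) (\<alpha> (int n + 1)) (\<alpha> (int n)))"
        unfolding Suc by (rule summable_mult)
      show "\<forall>\<^sub>F n in sequentially. norm ((cmod (\<alpha> (int n + 2) - 2 * \<alpha> (int n + 1) + \<alpha> (int n)))\<^sup>2)
          \<le> 2 * second_diff_term (\<alpha> (int n + 2)) (\<alpha> (int n + 1)) (\<alpha> (int n))"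
        using ev
      proof (rule eventually_mono)
        fix n assume "1/2 < 1 - (cmod (b (Suc n)))\<^sup>2"
        then have *: "1 \<le> 2 * (1 - (cmod (\<alpha> (int n + 1)))\<^sup>2)" by (simp add: b_def add.commute)
        show "norm ((cmod (\<alpha> (int n + 2) - 2 * \<alpha> (int n + 1) + \<alpha> (int n)))\<^sup>2)
          \<le> 2 * second_diff_term (\<alpha> (int n + 2)) (\<alpha> (int n + 1)) (\<alpha> (int n))"
          using mult_right_mono[OF * zero_le_power2, of "cmod (\<alpha> (int n + 2) - 2 * \<alpha> (int n + 1) + \<alpha> (int n))"]
          by (simp only: second_diff_term_def mult.assoc mult_1 real_norm_def abs_power2)
      qed
    qed
    with s6 show "summable ?v" by (intro summable_add) (simp_all add: b_def)
  }
  assume v: "summable ?v"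
  have s6: "summable (\<lambda>n. cmod (b n) ^ 6)"
    by (rule summable_comparison_test'[OF v]) (simp add: b_def)
  have s2: "summable (\<lambda>n. (cmod (\<alpha> (int n + 2) - 2 * \<alpha> (int n + 1) + \<alpha> (int n)))\<^sup>2)"
    by (rule summable_comparison_test'[OF v]) simp
  have "summable (\<lambda>n. cmod (b (n + 1) - b n) ^ 3)"
  proof (rule summable_diff_cubed[OF less_imp_le[OF b1] s6])
    show "summable (\<lambda>n. (cmod (b (n + 2) - 2 * b (n + 1) + b n))\<^sup>2)"
      using s2 by (simp add: b_def add.commute)
  qed
  then have s3: "summable (\<lambda>n. cmod (\<alpha> (int n + 1) - \<alpha> (int n)) ^ 3)"
    by (simp add: b_def add.commute)
  have "b \<longlonglongrightarrow> 0" by (rule power6_tendsto_0[OF s6])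
  then have "(\<lambda>n. (cmod (b n))\<^sup>2) \<longlonglongrightarrow> (cmod 0)\<^sup>2" by (intro tendsto_intros)
  then have ev: "eventually (\<lambda>n. (cmod (b n))\<^sup>2 < 1/2) sequentially" by (rule order_tendstoD) simp
  have L1: "summable (\<lambda>n. log_term (\<alpha> (int n)))"
  proof (rule summable_comparison_test_ev[OF _ s6])
    show "\<forall>\<^sub>F n in sequentially. norm (log_term (\<alpha> (int n))) \<le> cmod (b n) ^ 6"
      using ev
    proof (rule eventually_mono)
      fix n assume "(cmod (b n))\<^sup>2 < 1/2"
      then have "- log_term (b n) \<le> cmod (b n) ^ 6" by (intro log_term_bounds(2)[OF b1]) simp
      then show "norm (log_term (\<alpha> (int n))) \<le> cmod (b n) ^ 6"
        using log_term_nonpos[OF b1[of n]] by (simp add: b_def)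
    qed
  qed
  have "summable (\<lambda>n. second_diff_term (\<alpha> (int (Suc n) + 1)) (\<alpha> (int (Suc n))) (\<alpha> (int (Suc n) - 1)))"
    unfolding Suc
  proof (rule summable_comparison_test'[OF s2])
    fix n :: nat
    have "0 \<le> 1 - (cmod (\<alpha> (int n + 1)))\<^sup>2" "1 - (cmod (\<alpha> (int n + 1)))\<^sup>2 \<le> 1"
      using one_minus_cmod_sq_pos[OF b1[of "Suc n"]] by (auto simp: b_def add.commute)
    then show "norm (second_diff_term (\<alpha> (int n + 2)) (\<alpha> (int n + 1)) (\<alpha> (int n)))
        \<le> (cmod (\<alpha> (int n + 2) - 2 * \<alpha> (int n + 1) + \<alpha> (int n)))\<^sup>2"
      by (simp add: second_diff_term_def abs_mult mult_left_le_one_le)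
  qed
  then have L3: "summable (\<lambda>n. second_diff_term (\<alpha> (int n + 1)) (\<alpha> (int n)) (\<alpha> (int n - 1)))"
    by (subst (asm) summable_Suc_iff)
  \<comment> \<open>Dominates the products |\<alpha>|^2 |difference|^2 by
    \<open>sq_mult_sq_le\<close>, used for both neighbours.\<close>
  define M where "M n = cmod (b (Suc n)) ^ 6 + cmod (b n) ^ 6 + 2 * cmod (\<alpha> (int n + 1) - \<alpha> (int n)) ^ 3" for n
  have sM: "summable M" unfolding M_def using s6 s3
    by (intro summable_add summable_mult) (simp_all add: summable_Suc_iff[of "\<lambda>n. cmod (b n) ^ 6"])
  have Mb: "((cmod (\<alpha> (int n + 1)))\<^sup>2 + (cmod (\<alpha> (int n)))\<^sup>2) * (cmod (\<alpha> (int n + 1) - \<alpha> (int n)))\<^sup>2 \<le> M n" for n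
    using sq_mult_sq_le[of "cmod (\<alpha> (int n + 1))" "cmod (\<alpha> (int n + 1) - \<alpha> (int n))"]
      sq_mult_sq_le[of "cmod (\<alpha> (int n))" "cmod (\<alpha> (int n + 1) - \<alpha> (int n))"]
    by (simp add: M_def b_def algebra_simps)
  have "summable (\<lambda>n. sq_diff_term (\<alpha> (int (Suc n))) (\<alpha> (int (Suc n) - 1)))"
    unfolding Suc
  proof (rule summable_comparison_test'[OF summable_mult[OF sM, of 2]])
    fix n :: nat
    let ?x = "cmod (\<alpha> (int n + 1))" and ?y = "cmod (\<alpha> (int n))"
    have "sq_diff_term (\<alpha> (int n + 1)) (\<alpha> (int n)) = (?x + ?y)\<^sup>2 * (?x - ?y)\<^sup>2"
      by (simp add: sq_diff_term_def power2_eq_square algebra_simps)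
    also have "\<dots> \<le> (2 * (?x\<^sup>2 + ?y\<^sup>2)) * (cmod (\<alpha> (int n + 1) - \<alpha> (int n)))\<^sup>2"
    proof (intro mult_mono)
      have "0 \<le> (?x - ?y)\<^sup>2" by simp
      then show "(?x + ?y)\<^sup>2 \<le> 2 * (?x\<^sup>2 + ?y\<^sup>2)" by (simp add: power2_eq_square algebra_simps)
      show "(?x - ?y)\<^sup>2 \<le> (cmod (\<alpha> (int n + 1) - \<alpha> (int n)))\<^sup>2"
        using norm_triangle_ineq3 by (intro abs_le_square_iff[THEN iffD1]) simp
    qed auto
    also have "\<dots> \<le> 2 * M n" unfolding mult.assoc by (intro mult_left_mono Mb) simp
    finally show "norm (sq_diff_term (\<alpha> (int n + 1)) (\<alpha> (int n))) \<le> 2 * M n"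
      by (simp add: sq_diff_term_def)
  qed
  then have L2: "summable (\<lambda>n. sq_diff_term (\<alpha> (int n)) (\<alpha> (int n - 1)))"
    by (subst (asm) summable_Suc_iff)
  have "summable (\<lambda>n. diff_term (\<alpha> (int (Suc n))) (\<alpha> (int (Suc n) - 1)))"
    unfolding Suc
  proof (rule summable_comparison_test'[OF summable_mult[OF sM, of 6]])
    fix n :: nat
    have "diff_term (\<alpha> (int n + 1)) (\<alpha> (int n)) \<le>
      (6 * ((cmod (\<alpha> (int n + 1)))\<^sup>2 + (cmod (\<alpha> (int n)))\<^sup>2)) * (cmod (\<alpha> (int n + 1) - \<alpha> (int n)))\<^sup>2"
      unfolding diff_term_def by (intro mult_right_mono) auto
    also have "\<dots> \<le> 6 * M n" unfolding mult.assoc by (intro mult_left_mono Mb) simp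
    finally show "norm (diff_term (\<alpha> (int n + 1)) (\<alpha> (int n))) \<le> 6 * M n"
      using diff_term_nonneg by simp
  qed
  then have L4: "summable (\<lambda>n. diff_term (\<alpha> (int n)) (\<alpha> (int n - 1)))"
    by (subst (asm) summable_Suc_iff)
  show ?L using L1 L2 L3 L4 by blast
qed

text \<open>Because no \<open>t n\<close> is positive, its partial sums converge or tend to
  -infinity. In the first case the coefficients tend to 0 and the two bounds meet in the limit; in
  the second the upper bound with a uniformly bounded error is enough.\<close>

theorem sum_rule:
  fixes \<mu> \<mu>\<^sub>s :: "complex measure" and w :: "real \<Rightarrow> real"
  assumes \<mu>: "circle_prob_measure \<mu>" and inf: "infinite (msupport \<mu>)"
    and d: "lebesgue_decomposition \<mu> w \<mu>\<^sub>s"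
  defines "\<alpha> \<equiv> verblunsky \<mu>"
  defines "t \<equiv> \<lambda>n::nat. sum_rule_term \<alpha> (int n)"
  shows "ext_integral angle_measure (\<lambda>\<theta>. ereal ((1 - cos \<theta>)\<^sup>2) * elog (w \<theta>)) =
      (if summable t then ereal (9/8 + suminf t) else - \<infinity>)"
    and "summable t \<longleftrightarrow> summable (\<lambda>n::nat. (cmod (\<alpha> (int n + 2) - 2 * \<alpha> (int n + 1) + \<alpha> (int n)))\<^sup>2 + cmod (\<alpha> (int n)) ^ 6)"
    and "\<forall>k. cmod (\<alpha> (int k)) < 1"
proof -
  obtain W S where WS: "circle_decomposition \<mu> W S"
    "ext_integral angle_measure (\<lambda>\<theta>. ereal ((1 - cos \<theta>)\<^sup>2) * elog (w \<theta>)) =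
     ext_integral arc_measure (\<lambda>z. ereal (Qw z) * elog (W z))" (is "_ = ?I")
    using circle_decomposition_of_lebesgue[OF \<mu> d] by blast
  interpret circle_decomposition \<mu> W S by fact
  interpret nontrivial_circle_measure \<mu> by unfold_locales (rule inf)
  define a where "a k = \<alpha> (int k)" for k
  show a1: "\<forall>k. cmod (\<alpha> (int k)) < 1" unfolding \<alpha>_def using cmod_verblunsky_less_1 by blast
  then have a: "\<forall>k. cmod (a k) < 1" by (simp add: a_def)
  have o: "orth (Phi a n) n" for n by (rule orth_Phi) (simp add: a_def \<alpha>_def)
  have \<alpha>m: "\<alpha> (-1) = -1" "\<alpha> (-2) = -1" by (simp_all add: \<alpha>_def verblunsky_def)
  have \<alpha>le: "cmod (\<alpha> j) \<le> 1" for j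
  proof (cases "j < 0")
    case True
    then show ?thesis by (simp add: \<alpha>_def verblunsky_def)
  next
    case False
    then show ?thesis using a1[rule_format, of "nat j"] by simp
  qed
  define l where "l n = log_term (\<alpha> (int n))" for n
  define s where "s n = sq_diff_term (\<alpha> (int n)) (\<alpha> (int n - 1))" for n
  define dd where "dd n = second_diff_term (\<alpha> (int n + 1)) (\<alpha> (int n)) (\<alpha> (int n - 1))" for n
  define e where "e n = diff_term (\<alpha> (int n)) (\<alpha> (int n - 1))" for n
  have sgn: "l n \<le> 0" "s n \<ge> 0" "dd n \<ge> 0" "e n \<ge> 0" for n
    using log_term_nonpos a1 diff_term_nonneg one_minus_cmod_sq_pos[OF a1[rule_format, of n]]
    by (auto simp: l_def s_def dd_def e_def sq_diff_term_def second_diff_term_def)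
  have t: "t n = 3/2 * l n - 1/4 * s n - 1/4 * dd n - 1/8 * e n" for n
    by (simp add: t_def sum_rule_term_def l_def s_def dd_def e_def)
  have tle: "t n \<le> 0" for n unfolding t using sgn[of n] by linarith
  have iff: "summable t \<longleftrightarrow> summable l \<and> summable s \<and> summable dd \<and> summable e"
    by (rule ereal_sum_rule_eq(1)[OF sgn t])
  then show summ: "summable t \<longleftrightarrow> summable (\<lambda>n::nat. (cmod (\<alpha> (int n + 2) - 2 * \<alpha> (int n + 1) + \<alpha> (int n)))\<^sup>2 + cmod (\<alpha> (int n)) ^ 6)"
    using sum_rule_summable_iff[OF a1] by (simp add: l_def[abs_def] s_def[abs_def] dd_def[abs_def] e_def[abs_def])
  define E where "E n = (\<integral>z. Qw z * ln (bs_weight a n z) \<partial>arc_measure)" for n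
  define B where "B n = sum_rule_boundary (\<alpha> (int n)) (\<alpha> (int n - 1)) (\<alpha> (int n - 2))" for n
  have E: "E n = (\<Sum>j<n. t j) + 9/8 - B n" for n
    using entropy_bs_weight_sum[OF a1 \<alpha>m(1), of n] sum_rule_partial[of \<alpha> n, OF \<alpha>m(1)]
    by (simp add: E_def B_def t_def a_def[abs_def])
  \<comment> \<open>The first part bounds the boundary term, the second the defect from
    \<open>weighted_nsq_Phi_approx\<close>. All moduli are at most 1, so the total stays below
    14.\<close>
  define c where "c n = 4 * (cmod (\<alpha> (int n)) + cmod (\<alpha> (int n - 1))) + 3 * (cmod (\<alpha> (int n)) + cmod (\<alpha> (int n + 1)))" for n
  have B: "\<bar>B n\<bar> \<le> 4 * (cmod (\<alpha> (int n)) + cmod (\<alpha> (int n - 1)))" for n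
    unfolding B_def by (intro sum_rule_boundary_le \<alpha>le)
  have up: "?I \<le> ereal ((\<Sum>j<n. t j) + 9/8 + c n)" for n
  proof -
    have "?I \<le> ereal (E n + (\<integral>z. Qw z * (cmod (poly (Phi a n) z))\<^sup>2 \<partial>\<mu>) / szego_norm a n - 3/2)"
      unfolding E_def by (rule entropy_le[OF a])
    also have "\<dots> \<le> ereal ((\<Sum>j<n. t j) + 9/8 + c n)"
    proof -
      have "int (Suc n) = int n + 1" by simp
      then show ?thesis
        using E[of n] B[of n] weighted_nsq_Phi_approx[OF o a prob, of n] unfolding c_def a_def ereal_less_eq
        by (simp only: abs_le_iff) linarith
    qed
    finally show ?thesis .
  qed
  have c14: "c n \<le> 14" for n using \<alpha>le[of "int n"] \<alpha>le[of "int n - 1"] \<alpha>le[of "int n + 1"] by (simp add: c_def)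
  have "?I = (if summable t then ereal (9/8 + suminf t) else - \<infinity>)"
  proof (cases "summable t")
    case True
    then have "summable (\<lambda>n. cmod (a n) ^ 6)"
      unfolding summ by (rule summable_comparison_test') (simp add: a_def)
    then have a0: "a \<longlonglongrightarrow> 0" by (rule power6_tendsto_0)
    then have \<alpha>0: "(\<lambda>n. \<alpha> (int n)) \<longlonglongrightarrow> 0" by (simp add: a_def[abs_def])
    have \<alpha>1: "(\<lambda>n. \<alpha> (int n + 1)) \<longlonglongrightarrow> 0"
      using LIMSEQ_Suc[OF \<alpha>0] by (simp add: add.commute)
    have \<alpha>2: "(\<lambda>n. \<alpha> (int n - 1)) \<longlonglongrightarrow> 0"
      by (rule LIMSEQ_imp_Suc) (use \<alpha>0 in simp)
    have "(\<lambda>n. 4 * (cmod (\<alpha> (int n)) + cmod (\<alpha> (int n - 1)))) \<longlonglongrightarrow> 4 * (cmod 0 + cmod 0)"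
      by (intro tendsto_intros \<alpha>0 \<alpha>1 \<alpha>2)
    then have B0: "B \<longlonglongrightarrow> 0"
      using B by (intro Lim_null_comparison[of B]) (auto intro: always_eventually)
    have "c \<longlonglongrightarrow> 4 * (cmod 0 + cmod 0) + 3 * (cmod 0 + cmod 0)"
      unfolding c_def[abs_def] by (intro tendsto_intros \<alpha>0 \<alpha>1 \<alpha>2)
    then have c0: "c \<longlonglongrightarrow> 0" by simp
    have st: "(\<lambda>n. \<Sum>j<n. t j) \<longlonglongrightarrow> suminf t" using True by (rule summable_LIMSEQ)
    have "(\<lambda>n. (\<Sum>j<n. t j) + 9/8 - B n) \<longlonglongrightarrow> suminf t + 9/8 - 0"
      by (intro tendsto_intros st B0)
    then have "E \<longlonglongrightarrow> suminf t + 9/8" by (simp add: E[abs_def])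
    then have lo: "ereal (suminf t + 9/8) \<le> ?I"
      unfolding E_def[abs_def] by (intro entropy_ge[OF a o])
    have "(\<lambda>n. (\<Sum>j<n. t j) + 9/8 + c n) \<longlonglongrightarrow> suminf t + 9/8 + 0"
      by (intro tendsto_intros st c0)
    then have "(\<lambda>n. ereal ((\<Sum>j<n. t j) + 9/8 + c n)) \<longlonglongrightarrow> ereal (suminf t + 9/8)" by simp
    then have "?I \<le> ereal (suminf t + 9/8)"
      by (rule LIMSEQ_le_const) (use up in blast)
    with lo True show ?thesis by (simp add: add.commute)
  next
    case False
    have "?I \<le> ereal K" for K
    proof -
      have "\<exists>n. \<not> (\<Sum>j<n. - t j) \<le> 9/8 + 14 - K"
      proof (rule ccontr)
        assume "\<not> (\<exists>n. \<not> (\<Sum>j<n. - t j) \<le> 9/8 + 14 - K)"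
        then have "summable (\<lambda>j. - t j)"
          using tle by (intro summableI_nonneg_bounded[where x = "9/8 + 14 - K"]) auto
        with False show False by (simp add: summable_minus_iff)
      qed
      then obtain n where "\<not> (\<Sum>j<n. - t j) \<le> 9/8 + 14 - K" ..
      then have "(\<Sum>j<n. t j) + 9/8 + c n \<le> K" using c14[of n] by (simp add: sum_negf)
      then show ?thesis using up[of n] by (meson ereal_less_eq(3) order.trans)
    qed
    then have "?I = - \<infinity>" by (rule ereal_bot)
    with False show ?thesis by simp
  qed
  with WS(2) show "ext_integral angle_measure (\<lambda>\<theta>. ereal ((1 - cos \<theta>)\<^sup>2) * elog (w \<theta>)) =
      (if summable t then ereal (9/8 + suminf t) else - \<infinity>)" by simp
qed

theorem theorem4p8:
  fixes \<mu> \<mu>\<^sub>s :: "complex measure" and w :: "real \<Rightarrow> real"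
    and \<alpha> :: "int \<Rightarrow> complex" and \<rho> :: "int \<Rightarrow> real" and I :: ereal
  assumes "circle_prob_measure \<mu>"
    and "infinite (msupport \<mu>)"
    and "lebesgue_decomposition \<mu> w \<mu>\<^sub>s"
    and "\<alpha> = verblunsky \<mu>"
    and "\<rho> = (\<lambda>j. sqrt (1 - (cmod (\<alpha> j))\<^sup>2))"
    and "I = ext_integral angle_measure (\<lambda>\<theta>. ereal ((1 - cos \<theta>)\<^sup>2) * elog (w \<theta>))"
  shows "(I > - \<infinity> \<longleftrightarrow>
           summable (\<lambda>n::nat. (cmod (\<alpha> (int n + 2) - 2 * \<alpha> (int n + 1) + \<alpha> (int n)))\<^sup>2
                              + (cmod (\<alpha> (int n))) ^ 6))
    \<and> I = ereal (9/8)
          + ereal (3/2) * (\<Sum>j::nat. ereal (ln (1 - (cmod (\<alpha> (int j)))\<^sup>2) + (cmod (\<alpha> (int j)))\<^sup>2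
                                            + 1/2 * (cmod (\<alpha> (int j))) ^ 4))
          - ereal (1/4) * (\<Sum>j::nat. ereal (((cmod (\<alpha> (int j)))\<^sup>2 - (cmod (\<alpha> (int j - 1)))\<^sup>2)\<^sup>2))
          - ereal (1/4) * (\<Sum>j::nat. ereal ((\<rho> (int j))\<^sup>2
                            * (cmod (\<alpha> (int j + 1) - 2 * \<alpha> (int j) + \<alpha> (int j - 1)))\<^sup>2))
          - ereal (1/8) * (\<Sum>j::nat. ereal ((6 * (cmod (\<alpha> (int j)))\<^sup>2 + 6 * (cmod (\<alpha> (int j - 1)))\<^sup>2
                            - (cmod (\<alpha> (int j) - \<alpha> (int j - 1)))\<^sup>2)
                            * (cmod (\<alpha> (int j) - \<alpha> (int j - 1)))\<^sup>2))
    \<and> I = ereal (9/8)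
          + ereal (3/2) * (\<Sum>j::nat. ereal (ln (1 - (cmod (\<alpha> (int j)))\<^sup>2) + (cmod (\<alpha> (int j)))\<^sup>2
                                            + 1/2 * (cmod (\<alpha> (int j))) ^ 4))
          - ereal (1/4) * (\<Sum>j::nat. ereal (((cmod (\<alpha> (int j)))\<^sup>2 - (cmod (\<alpha> (int j - 1)))\<^sup>2)\<^sup>2))
          - ereal (1/4) * (\<Sum>j::nat. ereal ((\<rho> (int j))\<^sup>2
                            * (cmod (\<alpha> (int j + 1) - 2 * \<alpha> (int j) + \<alpha> (int j - 1)))\<^sup>2))
          - ereal (1/8) * (\<Sum>j::nat. ereal ((4 * (cmod (\<alpha> (int j)))\<^sup>2 + 4 * (cmod (\<alpha> (int j - 1)))\<^sup>2
                            + (cmod (\<alpha> (int j) + \<alpha> (int j - 1)))\<^sup>2)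
                            * (cmod (\<alpha> (int j) - \<alpha> (int j - 1)))\<^sup>2))"
proof -
  define t where "t = (\<lambda>n::nat. sum_rule_term \<alpha> (int n))"
  have I: "I = (if summable t then ereal (9/8 + suminf t) else - \<infinity>)"
    and summ: "summable t \<longleftrightarrow> summable (\<lambda>n::nat. (cmod (\<alpha> (int n + 2) - 2 * \<alpha> (int n + 1) + \<alpha> (int n)))\<^sup>2
        + cmod (\<alpha> (int n)) ^ 6)"
    and a1: "\<forall>k. cmod (\<alpha> (int k)) < 1"
    using sum_rule[OF assms(1-3)] unfolding t_def assms(4,6) by blast+
  have \<rho>: "(\<rho> (int n))\<^sup>2 = 1 - (cmod (\<alpha> (int n)))\<^sup>2" for n
    using one_minus_cmod_sq_pos[OF a1[rule_format, of n]] by (simp add: assms(5))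
  have sgn: "log_term (\<alpha> (int n)) \<le> 0" "0 \<le> sq_diff_term (\<alpha> (int n)) (\<alpha> (int n - 1))"
    "0 \<le> second_diff_term (\<alpha> (int n + 1)) (\<alpha> (int n)) (\<alpha> (int n - 1))" "0 \<le> diff_term (\<alpha> (int n)) (\<alpha> (int n - 1))" for n
    using log_term_nonpos a1 diff_term_nonneg one_minus_cmod_sq_pos[OF a1[rule_format, of n]]
    by (auto simp: sq_diff_term_def second_diff_term_def)
  have t: "t n = 3/2 * log_term (\<alpha> (int n)) - 1/4 * sq_diff_term (\<alpha> (int n)) (\<alpha> (int n - 1))
     - 1/4 * second_diff_term (\<alpha> (int n + 1)) (\<alpha> (int n)) (\<alpha> (int n - 1)) - 1/8 * diff_term (\<alpha> (int n)) (\<alpha> (int n - 1))" for n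
    by (simp add: t_def sum_rule_term_def)
  note eq = I[folded ereal_sum_rule_eq(2)[OF sgn t]]
  show ?thesis
  proof (intro conjI)
    show "I > - \<infinity> \<longleftrightarrow> summable (\<lambda>n::nat. (cmod (\<alpha> (int n + 2) - 2 * \<alpha> (int n + 1) + \<alpha> (int n)))\<^sup>2
        + (cmod (\<alpha> (int n))) ^ 6)"
      unfolding summ[symmetric] I by simp
  \<comment> \<open>The two identities differ only in the last series, whose summands agree by
    \<open>diff_term_alt\<close>.\<close>
  qed (use eq in \<open>simp_all only: \<rho> log_term_def sq_diff_term_def second_diff_term_def flip: diff_term_def diff_term_alt\<close>)
qed

end
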